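(* Let $p\in(1,\infty)$, let $(\mu_t)_{t\ge0}$ be the marginal laws of an $\mathbb{R}^d$-valued Lévy process starting in $0$ with $\int_{\mathbb{R}^d}|x|^p\,\mu_1(dx)<\infty$, and let $\varphi\colon[0,+\infty)\to[0,+\infty]$ be lower semicontinuous, convex, increasing, not constant, with $\varphi(0)=0$ and such that $x\mapsto\varphi(x^{1/p})$ is convex on $[0,\infty)$. Let $\mathscr{S}(t)$, $t\ge0$, be the operators on $C_0(\mathbb{R}^d)$ defined in the context. Let $f\in C_0(\mathbb{R}^d)$ and define $u\colon[0,\infty)\times\mathbb{R}^d\to\mathbb{R}$ by $u(t,x):=\mathscr{S}(t)f(x)$. Then $u$ is a viscosity solution (in the sense of the context) of $$\begin{cases}\partial_t u(t,x)=A^\mu u(t,x)+\varphi^\ast(|\nabla u(t,x)|) & \text{for }(t,x)\in(0,\infty)\times\mathbb{R}^d,\\ u(0,x)=f(x)&\text{for }x\in\mathbb{R}^d,\end{cases}$$ where $A^\mu$ is the generator of the Lévy process, $\nabla$ is the spatial gradient and $\varphi^\ast(y):=\sup_{x\ge0}(xy-\varphi(x))$ for $y\ge0$.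
   Context: "Increasing" is in the weak sense (nondecreasing). $|\cdot|$ is the Euclidean norm. $\mathcal{P}_p(\mathbb{R}^d)$ is the set of Borel probability measures on $\mathbb{R}^d$ with finite $p$-th moment, and $\mathcal{W}_p(\mu,\nu)=\inf_\gamma\big(\int|y-x|^p\,\gamma(dx,dy)\big)^{1/p}$, the infimum being over all couplings $\gamma$ of $\mu$ and $\nu$. $C_0(\mathbb{R}^d)$ is the space of real-valued continuous functions on $\mathbb{R}^d$ vanishing at infinity, with the supremum norm $\|\cdot\|_\infty$. Operators. Set $\varphi_t(a):=t\varphi(a/t)$ for $t>0$, $\varphi_0(0):=0$ and $\varphi_0(a):=+\infty$ for $a>0$. For $t\ge0$, $f\in C_0(\mathbb{R}^d)$, $x\in\mathbb{R}^d$, $$S(t)f(x):=\sup_{\nu\in\mathcal{P}_p(\mathbb{R}^d)}\Big(\int_{\mathbb{R}^d}f(x+y)\,\nu(dy)-\varphi_t(\mathcal{W}_p(\mu_t,\nu))\Big).$$ Each $S(t)$ maps $C_0(\mathbb{R}^d)$ to itself. For $n\in\mathbb{N}$, $t\ge0$ let $k=\lfloor2^nt\rfloor$, $t_n=k2^{-n}$, and $\mathscr{S}^n(t):=S(2^{-n})\circ\cdots\circ S(2^{-n})\circ S(t-t_n)$ with $k$ factors $S(2^{-n})$. Finally $\mathscr{S}(t)f:=\lim_{n\to\infty}\mathscr{S}^n(t)f$ (pointwise; the limit exists and lies in $C_0(\mathbb{R}^d)$). Generator. $A^\mu$ with domain $D(A^\mu)\subset C_0(\mathbb{R}^d)$ is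 the infinitesimal generator of the Feller semigroup $S^\mu(t)f(x):=\int_{\mathbb{R}^d}f(x+y)\,\mu_t(dy)$ on $C_0(\mathbb{R}^d)$, i.e. $A^\mu f=\lim_{t\downarrow0}(S^\mu(t)f-f)/t$ in supremum norm, for those $f$ for which this limit exists. Viscosity solution. $C^1_0(\mathbb{R}^d)$ is the space of continuously differentiable $f\in C_0(\mathbb{R}^d)$ whose gradient vanishes at infinity. A test function is a map $v\colon(0,\infty)\to C_0(\mathbb{R}^d)$ that is differentiable with respect to the supremum norm and satisfies $v(t)\in D(A^\mu)\cap C^1_0(\mathbb{R}^d)$ for every $t\in(0,\infty)$; write $v(t,x)=v(t)(x)$. A continuous function $u\colon[0,\infty)\to C_0(\mathbb{R}^d)$ (with $u(t,x)=u(t)(x)$ and $u(0,\cdot)=f$) is a viscosity subsolution of $\partial_tu=\mathscr{A}u$, $u(0,\cdot)=f$, where $\mathscr{A}g:=A^\mu g+\varphi^\ast(|\nabla g|)$ for $g\in D(A^\mu)\cap C_0^1(\mathbb{R}^d)$, if for every $(t,x)\in(0,\infty)\times\mathbb{R}^d$ and every test function $v$ with $u\le v$ on $(0,\infty)\times\mathbb{R}^d$ and $v(t,x)=u(t,x)$ one has $\partial_tv(t,x)\le\mathscr{A}v(t,x)$. It is a viscosity supersolution if the same holds with both "$\le$" replaced by "$\ge$", and a viscosity solution if it is both. *)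

theory Defs
  imports "HOL-Probability.Probability"
begin

text \<open>The state space is a Euclidean space \<open>'a\<close> of arbitrary dimension. Functions on it are elements of
  the library type of bounded continuous functions, whose norm is the supremum norm.\<close>

definition C0 :: "('a::euclidean_space \<Rightarrow>\<^sub>C real) set" where
  "C0 = {f. (apply_bcontfun f \<longlongrightarrow> 0) at_infinity}"

definition grad :: "('a::euclidean_space \<Rightarrow> real) \<Rightarrow> 'a \<Rightarrow> 'a" where
  "grad f x = (THE D. GDERIV f x :> D)"

definition C1_0 :: "('a::euclidean_space \<Rightarrow>\<^sub>C real) set" where
  "C1_0 = {f \<in> C0. (\<forall>x. apply_bcontfun f differentiable (at x)) \<and>
     continuous_on UNIV (grad f) \<and> (grad f \<longlongrightarrow> 0) at_infinity}"

section \<open>Levy processes, Wasserstein distance\<close>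

text \<open>Only stochastic continuity is required of the paths; every such process has a
  right-continuous modification with left limits, which has the same marginal laws.\<close>

definition levy_process :: "'w measure \<Rightarrow> (real \<Rightarrow> 'w \<Rightarrow> 'a::euclidean_space) \<Rightarrow> bool" where
  "levy_process M X \<longleftrightarrow>
     prob_space M \<and>
     (\<forall>t\<ge>0. X t \<in> borel_measurable M) \<and>
     (AE \<omega> in M. X 0 \<omega> = 0) \<and>
     (\<forall>(n::nat) (s::nat \<Rightarrow> real). 0 \<le> s 0 \<and> (\<forall>i<n. s i < s (Suc i)) \<longrightarrow>
        prob_space.indep_vars M (\<lambda>_. borel) (\<lambda>i \<omega>. X (s (Suc i)) \<omega> - X (s i) \<omega>) {..<n}) \<and>
     (\<forall>s\<ge>0. \<forall>h\<ge>0. distr M borel (\<lambda>\<omega>. X (s + h) \<omega> - X s \<omega>) = distr M borel (X h)) \<and>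
     (\<forall>s\<ge>0. \<forall>e>0.
        ((\<lambda>t. measure M {\<omega> \<in> space M. norm (X t \<omega> - X s \<omega>) > e}) \<longlongrightarrow> 0) (at s within {0..}))"

definition prob_p :: "real \<Rightarrow> 'a::euclidean_space measure set" where
  "prob_p p = {\<nu>. prob_space \<nu> \<and> sets \<nu> = sets borel \<and> integrable \<nu> (\<lambda>x. norm x powr p)}"

definition couplings ::
  "'a::euclidean_space measure \<Rightarrow> 'a measure \<Rightarrow> ('a \<times> 'a) measure set" where
  "couplings \<mu> \<nu> = {\<gamma>. prob_space \<gamma> \<and> sets \<gamma> = sets borel \<and>
     distr \<gamma> borel fst = \<mu> \<and> distr \<gamma> borel snd = \<nu>}"

text \<open>Used for measures in \<^term>\<open>prob_p p\<close> only: there every coupling has finite cost and the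
  set of couplings is nonempty, so that the real-valued infimum is the usual one.\<close>

definition wasserstein :: "real \<Rightarrow> 'a::euclidean_space measure \<Rightarrow> 'a measure \<Rightarrow> real" where
  "wasserstein p \<mu> \<nu> =
     (INF \<gamma>\<in>couplings \<mu> \<nu>. (LINT z|\<gamma>. norm (snd z - fst z) powr p) powr (1 / p))"

section \<open>The penalty function\<close>

text \<open>Functions from \<open>[0,\<infinity>)\<close> to \<open>[0,\<infinity>]\<close> are represented by functions from real to ereal,
  whose values at negative arguments are irrelevant.\<close>

definition lsc_nonneg :: "(real \<Rightarrow> ereal) \<Rightarrow> bool" where
  "lsc_nonneg \<phi> \<longleftrightarrow> (\<forall>x\<ge>0. \<phi> x \<le> Liminf (at x within {0..}) \<phi>)"

text \<open>In ereal, zero times infinity is zero, so the cases \<open>s = 0\<close> and \<open>s = 1\<close> are harmless.\<close>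

definition convex_nonneg :: "(real \<Rightarrow> ereal) \<Rightarrow> bool" where
  "convex_nonneg \<phi> \<longleftrightarrow> (\<forall>x\<ge>0. \<forall>y\<ge>0. \<forall>s\<in>{0..1}.
     \<phi> ((1 - s) * x + s * y) \<le> ereal (1 - s) * \<phi> x + ereal s * \<phi> y)"

definition scaled :: "(real \<Rightarrow> ereal) \<Rightarrow> real \<Rightarrow> real \<Rightarrow> ereal" where
  "scaled \<phi> t a = (if t = 0 then (if a = 0 then 0 else \<infinity>) else ereal t * \<phi> (a / t))"

definition conjugate :: "(real \<Rightarrow> ereal) \<Rightarrow> real \<Rightarrow> ereal" where
  "conjugate \<phi> y = (SUP x\<in>{0..}. ereal (x * y) - \<phi> x)"

section \<open>The operators\<close>

text \<open>For \<open>\<mu> t\<close> in \<^term>\<open>prob_p p\<close> and bounded measurable \<open>f\<close> the supremum is finite: it is at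
  most the supremum of \<open>f\<close>, and at least the integral against \<open>\<mu> t\<close>, for which the penalty is 0.\<close>

definition one_step :: "real \<Rightarrow> (real \<Rightarrow> 'a::euclidean_space measure) \<Rightarrow> (real \<Rightarrow> ereal) \<Rightarrow>
    real \<Rightarrow> ('a \<Rightarrow> real) \<Rightarrow> 'a \<Rightarrow> real" where
  "one_step p \<mu> \<phi> t f x = real_of_ereal
     (SUP \<nu>\<in>prob_p p. ereal (LINT y|\<nu>. f (x + y)) - scaled \<phi> t (wasserstein p (\<mu> t) \<nu>))"

definition dyadic_step :: "real \<Rightarrow> (real \<Rightarrow> 'a::euclidean_space measure) \<Rightarrow> (real \<Rightarrow> ereal) \<Rightarrow>
    nat \<Rightarrow> real \<Rightarrow> ('a \<Rightarrow> real) \<Rightarrow> 'a \<Rightarrow> real" where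
  "dyadic_step p \<mu> \<phi> n t f =
     (let k = nat \<lfloor>2 ^ n * t\<rfloor>; tn = real k / 2 ^ n
      in (one_step p \<mu> \<phi> (1 / 2 ^ n) ^^ k) (one_step p \<mu> \<phi> (t - tn) f))"

definition limit_op :: "real \<Rightarrow> (real \<Rightarrow> 'a::euclidean_space measure) \<Rightarrow> (real \<Rightarrow> ereal) \<Rightarrow>
    real \<Rightarrow> ('a \<Rightarrow> real) \<Rightarrow> 'a \<Rightarrow> real" where
  "limit_op p \<mu> \<phi> t f x = lim (\<lambda>n. dyadic_step p \<mu> \<phi> n t f x)"

section \<open>The generator\<close>

definition levy_semigroup :: "(real \<Rightarrow> 'a::euclidean_space measure) \<Rightarrow> real \<Rightarrow>
    ('a \<Rightarrow>\<^sub>C real) \<Rightarrow> ('a \<Rightarrow>\<^sub>C real)" where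
  "levy_semigroup \<mu> t f = Bcontfun (\<lambda>x. LINT y|\<mu> t. f (x + y))"

lemma apply_levy_semigroup:
  fixes \<mu> :: "real \<Rightarrow> 'a::euclidean_space measure"
  assumes "prob_space (\<mu> t)" and [measurable_cong, simp]: "sets (\<mu> t) = sets borel"
  shows "apply_bcontfun (levy_semigroup \<mu> t f) x = (LINT y|\<mu> t. f (x + y))"
proof -
  interpret prob_space "\<mu> t" by fact
  have f_meas [measurable]: "(\<lambda>y. apply_bcontfun f (z + y)) \<in> borel_measurable (\<mu> t)" for z
    unfolding measurable_cong_sets[OF assms(2) refl]
    by (intro borel_measurable_continuous_onI
        continuous_on_compose2[OF continuous_on_apply_bcontfun[of UNIV]] continuous_intros) auto
  have bd: "norm (apply_bcontfun f z) \<le> norm f" for z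
    by (rule norm_bounded)
  have f_int: "integrable (\<mu> t) (\<lambda>y. apply_bcontfun f (z + y))" for z
    by (rule integrable_const_bound[where B = "norm f"]) (use bd in auto)
  have cont: "continuous_on UNIV (\<lambda>z. LINT y|\<mu> t. apply_bcontfun f (z + y))"
    unfolding continuous_on_sequentially
  proof (intro allI ballI impI, elim conjE)
    fix z :: "nat \<Rightarrow> 'a" and a assume lim: "z \<longlonglongrightarrow> a"
    have "(\<lambda>n. apply_bcontfun f (z n + y)) \<longlonglongrightarrow> apply_bcontfun f (a + y)" for y
      by (rule continuous_on_tendsto_compose[OF continuous_on_apply_bcontfun[of UNIV]])
        (auto intro: tendsto_intros lim)
    then show "((\<lambda>z. LINT y|\<mu> t. apply_bcontfun f (z + y)) \<circ> z)
        \<longlonglongrightarrow> (LINT y|\<mu> t. apply_bcontfun f (a + y))"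
      unfolding o_def
      by (intro integral_dominated_convergence[where w = "\<lambda>_. norm f"]) (use bd in auto)
  qed
  have "norm (LINT y|\<mu> t. apply_bcontfun f (z + y)) \<le> norm f" for z
  proof -
    have "norm (LINT y|\<mu> t. apply_bcontfun f (z + y)) \<le> (LINT y|\<mu> t. norm f)"
      by (rule order.trans[OF integral_norm_bound])
        (rule integral_mono, use f_int bd in auto)
    then show ?thesis by (simp add: prob_space)
  qed
  then have "bounded (range (\<lambda>z. LINT y|\<mu> t. apply_bcontfun f (z + y)))"
    by (auto simp: bounded_iff)
  with cont show ?thesis
    by (simp add: levy_semigroup_def Bcontfun_inverse bcontfun_def)
qed

text \<open>The limits are taken in the supremum norm.\<close>

definition generator_dom :: "(real \<Rightarrow> 'a::euclidean_space measure) \<Rightarrow> ('a \<Rightarrow>\<^sub>C real) set" where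
  "generator_dom \<mu> =
     {f \<in> C0. \<exists>g\<in>C0. ((\<lambda>t. (levy_semigroup \<mu> t f - f) /\<^sub>R t) \<longlongrightarrow> g) (at_right 0)}"

definition generator :: "(real \<Rightarrow> 'a::euclidean_space measure) \<Rightarrow> ('a \<Rightarrow>\<^sub>C real) \<Rightarrow> ('a \<Rightarrow>\<^sub>C real)" where
  "generator \<mu> f = Lim (at_right 0) (\<lambda>t. (levy_semigroup \<mu> t f - f) /\<^sub>R t)"

section \<open>Viscosity solutions\<close>

definition full_generator :: "(real \<Rightarrow> 'a::euclidean_space measure) \<Rightarrow> (real \<Rightarrow> ereal) \<Rightarrow>
    ('a \<Rightarrow>\<^sub>C real) \<Rightarrow> 'a \<Rightarrow> ereal" where
  "full_generator \<mu> \<phi> g x = ereal (generator \<mu> g x) + conjugate \<phi> (norm (grad g x))"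

definition test_function ::
  "(real \<Rightarrow> 'a::euclidean_space measure) \<Rightarrow> (real \<Rightarrow> ('a \<Rightarrow>\<^sub>C real)) \<Rightarrow> bool" where
  "test_function \<mu> v \<longleftrightarrow>
     (\<forall>t>0. v differentiable (at t) \<and> v t \<in> generator_dom \<mu> \<inter> C1_0)"

definition viscosity_subsolution :: "(real \<Rightarrow> 'a::euclidean_space measure) \<Rightarrow> (real \<Rightarrow> ereal) \<Rightarrow>
    ('a \<Rightarrow>\<^sub>C real) \<Rightarrow> (real \<Rightarrow> ('a \<Rightarrow>\<^sub>C real)) \<Rightarrow> bool" where
  "viscosity_subsolution \<mu> \<phi> f u \<longleftrightarrow>
     (\<forall>t\<ge>0. u t \<in> C0) \<and> continuous_on {0..} u \<and> u 0 = f \<and>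
     (\<forall>t>0. \<forall>x. \<forall>v. test_function \<mu> v \<and> (\<forall>s>0. \<forall>y. u s y \<le> v s y) \<and> v t x = u t x \<longrightarrow>
        ereal (vector_derivative v (at t) x) \<le> full_generator \<mu> \<phi> (v t) x)"

definition viscosity_supersolution :: "(real \<Rightarrow> 'a::euclidean_space measure) \<Rightarrow> (real \<Rightarrow> ereal) \<Rightarrow>
    ('a \<Rightarrow>\<^sub>C real) \<Rightarrow> (real \<Rightarrow> ('a \<Rightarrow>\<^sub>C real)) \<Rightarrow> bool" where
  "viscosity_supersolution \<mu> \<phi> f u \<longleftrightarrow>
     (\<forall>t\<ge>0. u t \<in> C0) \<and> continuous_on {0..} u \<and> u 0 = f \<and>
     (\<forall>t>0. \<forall>x. \<forall>v. test_function \<mu> v \<and> (\<forall>s>0. \<forall>y. u s y \<ge> v s y) \<and> v t x = u t x \<longrightarrow>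
        ereal (vector_derivative v (at t) x) \<ge> full_generator \<mu> \<phi> (v t) x)"

definition viscosity_solution :: "(real \<Rightarrow> 'a::euclidean_space measure) \<Rightarrow> (real \<Rightarrow> ereal) \<Rightarrow>
    ('a \<Rightarrow>\<^sub>C real) \<Rightarrow> (real \<Rightarrow> ('a \<Rightarrow>\<^sub>C real)) \<Rightarrow> bool" where
  "viscosity_solution \<mu> \<phi> f u \<longleftrightarrow>
     viscosity_subsolution \<mu> \<phi> f u \<and> viscosity_supersolution \<mu> \<phi> f u"

end

theory Submission
  imports Defs
begin

text \<open>Let \<open>S t\<close> be the semigroup of the process and \<open>H t\<close> the Hopf-Lax operator of the penalty, and
  put \<open>L t = H t \<circ> S t\<close>: the operator obtained by restricting the supremum to deterministic
  translates of \<open>\<mu> t\<close>. It satisfies \<open>L (s + t) \<le> L s \<circ> L t\<close>, so its dyadic iterates increase, and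
  \<open>H t \<circ> S t \<le> S t \<circ> H t\<close> bounds them by \<open>S t (H t f)\<close>. The operators of the theorem dominate \<open>L t\<close>,
  and on functions with Lipschitz gradient both differ by a uniform \<open>o(t)\<close>, because perturbing \<open>\<mu> t\<close>
  in Wasserstein distance then gains no more than a translation. As mollification \<open>A\<close> satisfies
  \<open>L t \<circ> A \<le> A \<circ> L t\<close>, this comparison survives iteration, and both families of dyadic iterates
  have the same limit \<open>u\<close>. In particular neither optimal couplings nor measurable selections are
  needed. Finally \<open>L h (u t) \<le> u (t + h) \<le> S h (H h (u t))\<close> for dyadic \<open>h\<close>, and
  expanding the two bounds at a touching test function gives the two viscosity inequalities.\<close>

section \<open>Monotone translation-invariant operators\<close>

text \<open>All operators act on bounded uniformly continuous functions: this class contains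
  \<open>C0\<close> and is closed under constants, translations and the perturbations of a test
  function that the viscosity argument forms; \<open>C0\<close> is recovered at the end by
  squeezing. The obstacle is the number of steps. A one-step error o(h) is summed over about t / h
  steps, so it must be uniform over the iterates, whereas the operators preserve bounds and moduli
  of continuity but are not known to preserve a Lipschitz gradient. Hence the iterates are kept in
  one class with fixed bound and modulus, and smoothness with a constant depending only on the bound
  and the mollification radius is put in before each comparison. The power p enters through growth:
  convexity of \<phi>(x^(1/p)) gives \<phi>(a) \<ge> c a^p - C, and this absorbs the part of the
  Taylor remainder that is controlled by the p-th power of the transport cost. For the limit u, the
  touching argument works with two inequalities over one short step, where h may tend to 0 through
  dyadic values.\<close>

definition ucb :: "('a::euclidean_space \<Rightarrow> real) \<Rightarrow> bool" where
  "ucb g \<longleftrightarrow> (\<exists>B. \<forall>x. \<bar>g x\<bar> \<le> B) \<and> (\<forall>e>0. \<exists>d>0. \<forall>x z. norm z < d \<longrightarrow> \<bar>g (x + z) - g x\<bar> < e)"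

text \<open>Bound and modulus are explicit data, with \<open>m\<close> a function of the
  displacement vector, because small-time and mollification errors have to be uniform over all
  iterates of one function, and these share one class.\<close>

definition mod_class :: "real \<Rightarrow> ('a::euclidean_space \<Rightarrow> real) \<Rightarrow> ('a \<Rightarrow> real) set" where
  "mod_class B m = {g. (\<forall>x. \<bar>g x\<bar> \<le> B) \<and> (\<forall>x z. \<bar>g (x + z) - g x\<bar> \<le> m z)}"

definition modulus :: "('a::euclidean_space \<Rightarrow> real) \<Rightarrow> bool" where
  "modulus m \<longleftrightarrow> (\<forall>e>0. \<exists>d>0. \<forall>z. norm z < d \<longrightarrow> m z < e)"

section \<open>Bounded uniformly continuous functions\<close>

lemma ucb_bound:
  assumes "ucb g"
  obtains B where "0 < B" "\<And>x. \<bar>g x\<bar> \<le> B"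
proof -
  obtain B where "\<And>x. \<bar>g x\<bar> \<le> B" using assms by (auto simp: ucb_def)
  then show ?thesis by (intro that[of "max B 1"]) (auto simp: le_max_iff_disj)
qed

lemma ucb_uniform:
  assumes "ucb g" "0 < e"
  obtains d where "0 < d" "\<And>x z. norm z < d \<Longrightarrow> \<bar>g (x + z) - g x\<bar> < e"
  using assms unfolding ucb_def by metis

lemma ucb_continuous: "continuous_on UNIV g" if "ucb g"
  unfolding continuous_on_iff
proof (intro ballI allI impI)
  fix x and e :: real assume "0 < e"
  from ucb_uniform[OF that this] obtain d where d: "0 < d" "\<And>x z. norm z < d \<Longrightarrow> \<bar>g (x + z) - g x\<bar> < e"
    by blast
  show "\<exists>d>0. \<forall>x'\<in>UNIV. dist x' x < d \<longrightarrow> dist (g x') (g x) < e"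
  proof (intro exI[of _ d] conjI ballI impI)
    fix y assume "dist y x < d"
    then show "dist (g y) (g x) < e"
      using d(2)[of "y - x" x] by (simp add: dist_norm)
  qed (fact d)
qed

lemma ucb_measurable [measurable_dest]: "ucb g \<Longrightarrow> g \<in> borel_measurable borel"
  using ucb_continuous borel_measurable_continuous_onI by blast

lemma ucb_mod_class:
  assumes "ucb g"
  obtains B m where "0 < B" "modulus m" "g \<in> mod_class B m"
proof -
  obtain B where B: "0 < B" "\<And>x. \<bar>g x\<bar> \<le> B" using ucb_bound[OF assms] by blast
  define m where "m z = (SUP x. \<bar>g (x + z) - g x\<bar>)" for z
  have b: "\<bar>g (x + z) - g x\<bar> \<le> 2 * B" for x z
    using B(2)[of "x + z"] B(2)[of x] by linarith
  have "modulus m"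
    unfolding modulus_def
  proof (intro allI impI)
    fix e :: real assume "0 < e"
    then obtain d where d: "0 < d" "\<And>x z. norm z < d \<Longrightarrow> \<bar>g (x + z) - g x\<bar> < e / 2"
      using ucb_uniform[OF assms, of "e / 2"] by auto
    have "m z < e" if "norm z < d" for z
    proof -
      have "m z \<le> e / 2"
        unfolding m_def using d(2)[OF that] by (intro cSUP_least) (auto intro: less_imp_le)
      then show ?thesis using \<open>0 < e\<close> by simp
    qed
    then show "\<exists>d>0. \<forall>z. norm z < d \<longrightarrow> m z < e" using d(1) by blast
  qed
  moreover have "\<bar>g (x + z) - g x\<bar> \<le> m z" for x z
    unfolding m_def by (intro cSUP_upper bdd_aboveI2[where M = "2 * B"]) (auto intro: b)
  ultimately show ?thesis using B that[of B m] by (auto simp: mod_class_def)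
qed

lemma mod_class_ucb: "g \<in> mod_class B m \<Longrightarrow> modulus m \<Longrightarrow> ucb g"
  unfolding ucb_def mod_class_def modulus_def mem_Collect_eq by (meson le_less_trans)

lemma ucb_const [simp, intro]: "ucb (\<lambda>_. c)"
  by (auto simp: ucb_def intro: exI[of _ 1])

lemma ucb_shift: assumes "ucb g" shows "ucb (\<lambda>x. g (x + z))"
proof -
  have *: "x + y + z = x + z + y" for x y by (simp add: ac_simps)
  show ?thesis
    unfolding ucb_def *
    using assms[unfolded ucb_def] by meson
qed

lemma ucb_add:
  assumes "ucb f" "ucb g" shows "ucb (\<lambda>x. f x + g x)"
proof -
  obtain B B' where B: "\<And>x. \<bar>f x\<bar> \<le> B" "\<And>x. \<bar>g x\<bar> \<le> B'"
    using ucb_bound[OF assms(1)] ucb_bound[OF assms(2)] by metis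
  have "\<bar>f x + g x\<bar> \<le> B + B'" for x
    using B(1)[of x] B(2)[of x] by linarith
  moreover have "\<exists>d>0. \<forall>x z. norm z < d \<longrightarrow> \<bar>f (x + z) + g (x + z) - (f x + g x)\<bar> < e" if e: "e > 0" for e
  proof -
    obtain d d' where d: "0 < d" "\<And>x z. norm z < d \<Longrightarrow> \<bar>f (x + z) - f x\<bar> < e / 2"
      and d': "0 < d'" "\<And>x z. norm z < d' \<Longrightarrow> \<bar>g (x + z) - g x\<bar> < e / 2"
      using ucb_uniform[OF assms(1), of "e / 2"] ucb_uniform[OF assms(2), of "e / 2"] e
      by (metis half_gt_zero)
    have "\<bar>f (x + z) + g (x + z) - (f x + g x)\<bar> < e" if "norm z < min d d'" for x z
    proof -
      have "\<bar>f (x + z) - f x\<bar> < e / 2" "\<bar>g (x + z) - g x\<bar> < e / 2"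
        using d(2) d'(2) that by auto
      then show ?thesis by linarith
    qed
    then show ?thesis using d(1) d'(1) by (intro exI[of _ "min d d'"]) auto
  qed
  ultimately show ?thesis unfolding ucb_def by blast
qed

lemma ucb_cmult:
  assumes "ucb f" shows "ucb (\<lambda>x. c * f x)"
proof (cases "c = 0")
  case False
  obtain B where B: "\<And>x. \<bar>f x\<bar> \<le> B"
    using ucb_bound[OF assms(1)] by metis
  have "\<bar>c * f x\<bar> \<le> \<bar>c\<bar> * B" for x
    using B[of x] by (simp add: abs_mult mult_left_mono)
  moreover have "\<exists>d>0. \<forall>x z. norm z < d \<longrightarrow> \<bar>c * f (x + z) - c * f x\<bar> < e" if e: "e > 0" for e
  proof -
    obtain d where d: "0 < d" "\<And>x z. norm z < d \<Longrightarrow> \<bar>f (x + z) - f x\<bar> < e / \<bar>c\<bar>"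
      using ucb_uniform[OF assms(1), of "e / \<bar>c\<bar>"] e False by auto
    have "\<bar>c * f (x + z) - c * f x\<bar> < e" if "norm z < d" for x z
    proof -
      have "\<bar>c * f (x + z) - c * f x\<bar> = \<bar>c\<bar> * \<bar>f (x + z) - f x\<bar>"
        by (simp add: abs_mult flip: right_diff_distrib)
      also have "\<dots> < e"
        using d(2)[OF that, of x] False by (simp add: field_simps)
      finally show ?thesis .
    qed
    then show ?thesis using d(1) by auto
  qed
  ultimately show ?thesis unfolding ucb_def by blast
qed auto

lemma ucb_diff: "ucb f \<Longrightarrow> ucb g \<Longrightarrow> ucb (\<lambda>x. f x - g x)"
  using ucb_add[of f "\<lambda>x. (-1) * g x"] ucb_cmult[of g "-1"] by simp

text \<open>The defining properties make such an operator nonexpansive and let it preserve every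
  bound and every modulus of continuity.\<close>

definition mono_op :: "(('a::euclidean_space \<Rightarrow> real) \<Rightarrow> 'a \<Rightarrow> real) \<Rightarrow> bool" where
  "mono_op T \<longleftrightarrow> T (\<lambda>_. 0) = (\<lambda>_. 0) \<and>
     (\<forall>f g. ucb f \<longrightarrow> ucb g \<longrightarrow> f \<le> g \<longrightarrow> T f \<le> T g) \<and>
     (\<forall>f c. ucb f \<longrightarrow> T (\<lambda>x. f x + c) = (\<lambda>x. T f x + c)) \<and>
     (\<forall>f z. ucb f \<longrightarrow> T (\<lambda>x. f (x + z)) = (\<lambda>x. T f (x + z)))"

lemma mono_op_mono:
  "mono_op T \<Longrightarrow> ucb f \<Longrightarrow> ucb g \<Longrightarrow> (\<And>x. f x \<le> g x) \<Longrightarrow> T f x \<le> T g x"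
  by (simp add: mono_op_def le_fun_def)

lemma mono_op_add: "mono_op T \<Longrightarrow> ucb f \<Longrightarrow> T (\<lambda>x. f x + c) x = T f x + c"
  by (auto simp: mono_op_def)

lemma mono_op_shift: "mono_op T \<Longrightarrow> ucb f \<Longrightarrow> T (\<lambda>x. f (x + z)) x = T f (x + z)"
  by (auto simp: mono_op_def)

lemma mono_op_le_add:
  assumes "mono_op T" "ucb f" "ucb g" "\<And>x. f x \<le> g x + c"
  shows "T f x \<le> T g x + c"
  using mono_op_mono[OF assms(1,2) ucb_add[OF assms(3) ucb_const] assms(4)]
    mono_op_add[OF assms(1,3)] by simp

lemma mono_op_const: assumes "mono_op T" shows "T (\<lambda>_. c) x = c"
proof -
  have "T (\<lambda>x. 0 + c) x = T (\<lambda>x. 0) x + c"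
    using mono_op_add[OF assms, of "\<lambda>_. 0"] by blast
  then show ?thesis using assms by (simp add: mono_op_def)
qed

text \<open>A translation by \<open>z\<close> changes \<open>f\<close> by at most the constant
  \<open>m z\<close>; monotonicity and compatibility with constants and translations carry this over
  to \<open>T f\<close>.\<close>

lemma mono_op_mod_class:
  assumes T: "mono_op T" and f: "ucb f" "f \<in> mod_class B m"
  shows "T f \<in> mod_class B m"
proof -
  have B: "- B \<le> f x" "f x \<le> B" for x
    using f(2) by (auto simp: mod_class_def abs_le_iff minus_le_iff)
  have "T f x \<le> B" for x
    using mono_op_mono[OF T f(1) ucb_const B(2)] mono_op_const[OF T] by simp
  moreover have "- B \<le> T f x" for x
    using mono_op_mono[OF T ucb_const f(1) B(1)] mono_op_const[OF T] by simp
  ultimately have 1: "\<bar>T f x\<bar> \<le> B" for x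
    by (simp add: abs_le_iff minus_le_iff)
  have 2: "\<bar>T f (x + z) - T f x\<bar> \<le> m z" for x z
  proof -
    have "f (y + z) \<le> f y + m z \<and> f y \<le> f (y + z) + m z" for y
      using f(2) by (auto simp: mod_class_def abs_le_iff) (smt (verit))+
    then have "T (\<lambda>x. f (x + z)) x \<le> T f x + m z" "T f x \<le> T (\<lambda>x. f (x + z)) x + m z"
      using mono_op_le_add[OF T] f(1) ucb_shift[OF f(1)] by blast+
    then show ?thesis
      unfolding mono_op_shift[OF T f(1)] by linarith
  qed
  from 1 2 show ?thesis by (simp add: mod_class_def)
qed

lemma mono_op_ucb: "mono_op T \<Longrightarrow> ucb f \<Longrightarrow> ucb (T f)"
  by (rule ucb_mod_class[of f]) (blast intro: mod_class_ucb mono_op_mod_class)+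

lemma mono_op_comp:
  assumes S: "mono_op S" and T: "mono_op T" shows "mono_op (\<lambda>f. S (T f))"
proof -
  note u = mono_op_ucb[OF T]
  show ?thesis
    unfolding mono_op_def
  proof (intro conjI allI impI)
    show "S (T (\<lambda>_. 0)) = (\<lambda>_. 0)"
      using assms by (simp add: mono_op_def)
    fix f g :: "'a \<Rightarrow> real" assume "ucb f" "ucb g" "f \<le> g"
    then show "S (T f) \<le> S (T g)"
      using u assms by (meson mono_op_def)
  next
    fix f :: "'a \<Rightarrow> real" and c assume f: "ucb f"
    then have "T (\<lambda>x. f x + c) = (\<lambda>x. T f x + c)" using T by (simp add: mono_op_def)
    then show "S (T (\<lambda>x. f x + c)) = (\<lambda>x. S (T f) x + c)"
      using mono_op_add[OF S u[OF f]] by auto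
  next
    fix f :: "'a \<Rightarrow> real" and z assume f: "ucb f"
    then have "T (\<lambda>x. f (x + z)) = (\<lambda>x. T f (x + z))" using T by (metis mono_op_def)
    then show "S (T (\<lambda>x. f (x + z))) = (\<lambda>x. S (T f) (x + z))"
      using mono_op_shift[OF S u[OF f]] by auto
  qed
qed

lemma mono_op_id: "mono_op (\<lambda>f. f)"
  unfolding mono_op_def by blast

lemma mono_op_funpow: "mono_op T \<Longrightarrow> mono_op (T ^^ k)"
proof (induction k)
  case 0
  show ?case unfolding funpow.simps id_def by (rule mono_op_id)
next
  case (Suc k)
  show ?case unfolding funpow.simps comp_def
    by (rule mono_op_comp[OF Suc.prems Suc.IH[OF Suc.prems]])
qed

lemma funpow_mono_op_le:
  assumes S: "mono_op S" and T: "mono_op T" and le: "\<And>f x. ucb f \<Longrightarrow> S f x \<le> T f x"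
    and f: "ucb f" "ucb g" "\<And>x. f x \<le> g x"
  shows "(S ^^ k) f x \<le> (T ^^ k) g x"
proof (induction k arbitrary: x)
  case (Suc k)
  have "S ((S ^^ k) f) x \<le> S ((T ^^ k) g) x"
    by (rule mono_op_mono[OF S mono_op_ucb[OF mono_op_funpow[OF S]] mono_op_ucb[OF mono_op_funpow[OF T]]])
      (use f Suc in auto)
  also have "\<dots> \<le> T ((T ^^ k) g) x"
    by (rule le[OF mono_op_ucb[OF mono_op_funpow[OF T] f(2)]])
  finally show ?case by simp
qed (use f in auto)

text \<open>Common source of the Hopf-Lax operator (translations) and of the one-step operator
  (averages). The supremum is finite since every \<open>A i g\<close> obeys the bound of
  \<open>g\<close> and costs are nonnegative; an index of zero cost makes it fix the zero
  function.\<close>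

lemma
  fixes A :: "'i \<Rightarrow> ('a::euclidean_space \<Rightarrow> real) \<Rightarrow> 'a \<Rightarrow> real"
  assumes A: "\<And>i. i \<in> I \<Longrightarrow> mono_op (A i)" and c: "\<And>i. i \<in> I \<Longrightarrow> 0 \<le> c i"
  shows mono_op_SUP_upper: "\<And>i. ucb g \<Longrightarrow> i \<in> I \<Longrightarrow> A i g x - c i \<le> (SUP i\<in>I. A i g x - c i)" (is "PROP ?U")
    and mono_op_SUP: "i0 \<in> I \<Longrightarrow> c i0 = 0 \<Longrightarrow> mono_op (\<lambda>g x. SUP i\<in>I. A i g x - c i)"
proof -
  have bdd: "bdd_above ((\<lambda>i. A i g x - c i) ` I)" if g: "ucb g" for g x
  proof -
    obtain B where B: "\<And>x. \<bar>g x\<bar> \<le> B" using ucb_bound[OF g] by metis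
    have "\<bar>g (x + z) - g x\<bar> \<le> 2 * B" for x z
      using B[of "x + z"] B[of x] by linarith
    \<comment> \<open>The constant \<open>2 * B\<close> is a trivial modulus: only the bound is to
      be transported.\<close>
    with B have "g \<in> mod_class B (\<lambda>z. 2 * B)"
      by (simp add: mod_class_def)
    then have "A i g \<in> mod_class B (\<lambda>z. 2 * B)" if "i \<in> I" for i
      using mono_op_mod_class[OF A[OF that] g] by blast
    then have "A i g x \<le> B" if "i \<in> I" for i
      using that by (simp add: mod_class_def abs_le_iff)
    then show ?thesis using c by (intro bdd_aboveI2[where M = B]) (meson add_increasing2 diff_le_eq)
  qed
  have upper: "A i g x - c i \<le> (SUP i\<in>I. A i g x - c i)" if "ucb g" "i \<in> I" for g i x
    using that bdd by (intro cSUP_upper)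
  then show "PROP ?U" .
  assume i0: "i0 \<in> I" "c i0 = 0"
  then have ne: "I \<noteq> {}" by auto
  show "mono_op (\<lambda>g x. SUP i\<in>I. A i g x - c i)"
    unfolding mono_op_def
  proof (intro conjI allI impI)
    show "(\<lambda>x. SUP i\<in>I. A i (\<lambda>_. 0) x - c i) = (\<lambda>_. 0)"
    proof
      fix x
      have *: "A i (\<lambda>_. 0) x = 0" if "i \<in> I" for i
        using mono_op_const[OF A[OF that], of 0] by simp
      then have "(SUP i\<in>I. A i (\<lambda>_. 0) x - c i) \<le> 0"
        using ne c by (intro cSUP_least) auto
      moreover have "0 \<le> (SUP i\<in>I. A i (\<lambda>_. 0) x - c i)"
        using upper[of "\<lambda>_. 0" i0 x] i0 * by auto
      ultimately show "(SUP i\<in>I. A i (\<lambda>_. 0) x - c i) = 0" by simp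
    qed
  next
    fix f g :: "'a \<Rightarrow> real" assume fg: "ucb f" "ucb g" "f \<le> g"
    show "(\<lambda>x. SUP i\<in>I. A i f x - c i) \<le> (\<lambda>x. SUP i\<in>I. A i g x - c i)"
    proof (rule le_funI, rule cSUP_least[OF ne])
      fix x i assume i: "i \<in> I"
      have "A i f x \<le> A i g x"
        using fg by (intro mono_op_mono[OF A[OF i]]) (auto simp: le_fun_def)
      then show "A i f x - c i \<le> (SUP i\<in>I. A i g x - c i)"
        using upper[OF fg(2) i, of x] by linarith
    qed
  next
    fix f :: "'a \<Rightarrow> real" and d assume f: "ucb f"
    show "(\<lambda>x. SUP i\<in>I. A i (\<lambda>x. f x + d) x - c i) = (\<lambda>x. (SUP i\<in>I. A i f x - c i) + d)"
    proof
      fix x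
      have "(SUP i\<in>I. A i (\<lambda>x. f x + d) x - c i) = (SUP i\<in>I. (A i f x - c i) + d)"
        using mono_op_add[OF A f] by (intro SUP_cong) auto
      also have "\<dots> = (SUP i\<in>I. A i f x - c i) + d"
        using Sup_add_eq[OF bdd[OF f] ne, of d x] by (simp add: add.commute)
      finally show "(SUP i\<in>I. A i (\<lambda>x. f x + d) x - c i) = (SUP i\<in>I. A i f x - c i) + d" .
    qed
  next
    fix f :: "'a \<Rightarrow> real" and z assume f: "ucb f"
    show "(\<lambda>x. SUP i\<in>I. A i (\<lambda>x. f (x + z)) x - c i) = (\<lambda>x. SUP i\<in>I. A i f (x + z) - c i)"
      using mono_op_shift[OF A f] by (auto intro!: SUP_cong)
  qed
qed

section \<open>Averaging against a probability measure\<close>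

definition avg :: "'a::euclidean_space measure \<Rightarrow> ('a \<Rightarrow> real) \<Rightarrow> 'a \<Rightarrow> real" where
  "avg \<nu> g x = (LINT y|\<nu>. g (x + y))"

lemma ucb_integrable:
  fixes \<nu> :: "'a::euclidean_space measure"
  assumes "prob_space \<nu>" "sets \<nu> = sets borel" "ucb g"
  shows "integrable \<nu> (\<lambda>y. g (x + y))"
proof -
  interpret prob_space \<nu> by fact
  note [measurable_cong, simp] = assms(2)
  note [measurable] = ucb_measurable[OF assms(3)]
  obtain B where "\<And>x. \<bar>g x\<bar> \<le> B" using ucb_bound[OF assms(3)] by metis
  then show ?thesis by (intro integrable_const_bound[where B = B]) auto
qed

lemma mono_op_avg:
  fixes \<nu> :: "'a::euclidean_space measure"
  assumes "prob_space \<nu>" "sets \<nu> = sets borel"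
  shows "mono_op (avg \<nu>)"
proof -
  interpret prob_space \<nu> by fact
  note int = ucb_integrable[OF assms]
  show ?thesis
    unfolding mono_op_def
  proof (intro conjI allI impI)
    show "avg \<nu> (\<lambda>_. 0) = (\<lambda>_. 0)" by (auto simp: avg_def)
    fix f g :: "'a \<Rightarrow> real" assume "ucb f" "ucb g" "f \<le> g"
    then show "avg \<nu> f \<le> avg \<nu> g"
      unfolding avg_def using int by (intro le_funI integral_mono) (auto simp: le_fun_def)
  next
    fix f :: "'a \<Rightarrow> real" and c assume "ucb f"
    then show "avg \<nu> (\<lambda>x. f x + c) = (\<lambda>x. avg \<nu> f x + c)"
      unfolding avg_def using int by (simp add: prob_space)
  next
    fix f :: "'a \<Rightarrow> real" and z assume "ucb f"
    then show "avg \<nu> (\<lambda>x. f (x + z)) = (\<lambda>x. avg \<nu> f (x + z))"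
      unfolding avg_def by (simp add: algebra_simps)
  qed
qed

text \<open>Averages serve as transition operators, as competitors in the one-step supremum and as
  mollifiers. The first identity gives the semigroup law for convolutions; the second lets
  mollification commute with the transition operators.\<close>

lemma avg_avg:
  fixes \<nu> \<nu>' :: "'a::euclidean_space measure"
  assumes \<nu>: "prob_space \<nu>" "sets \<nu> = sets borel" and \<nu>': "prob_space \<nu>'" "sets \<nu>' = sets borel"
    and g: "ucb g"
  shows "avg \<nu> (avg \<nu>' g) x = (LINT z|(\<nu> \<Otimes>\<^sub>M \<nu>'). g (x + (fst z + snd z)))"
    and "avg \<nu> (avg \<nu>' g) x = avg \<nu>' (avg \<nu> g) x"
proof -
  interpret a: prob_space \<nu> by fact
  interpret b: prob_space \<nu>' by fact
  interpret pair_prob_space \<nu> \<nu>' ..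
  note [measurable_cong, simp] = \<nu>(2) \<nu>'(2)
  note [measurable] = ucb_measurable[OF g]
  obtain B where B: "\<And>x. \<bar>g x\<bar> \<le> B" using ucb_bound[OF g] by metis
  have int: "integrable (\<nu> \<Otimes>\<^sub>M \<nu>') (\<lambda>(y, z). g (x + (y + z)))"
    by (rule integrable_const_bound[where B = B]) (auto simp: B)
  have "avg \<nu> (avg \<nu>' g) x = (LINT y|\<nu>. LINT z|\<nu>'. g (x + (y + z)))"
    by (simp add: avg_def add.assoc)
  also have "\<dots> = (LINT z|(\<nu> \<Otimes>\<^sub>M \<nu>'). g (x + (fst z + snd z)))"
    using integral_fst[OF int] by (simp add: case_prod_unfold)
  finally show 1: "avg \<nu> (avg \<nu>' g) x = (LINT z|(\<nu> \<Otimes>\<^sub>M \<nu>'). g (x + (fst z + snd z)))" .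
  have eq: "x + z + y = x + (y + z)" for y z by (simp only: add_ac)
  have "avg \<nu>' (avg \<nu> g) x = (LINT z|\<nu>'. LINT y|\<nu>. g (x + (y + z)))"
    unfolding avg_def eq ..
  also have "\<dots> = (LINT y|\<nu>. LINT z|\<nu>'. g (x + (y + z)))"
    by (rule Fubini_integral[OF int])
  finally show "avg \<nu> (avg \<nu>' g) x = avg \<nu>' (avg \<nu> g) x"
    unfolding avg_def add.assoc ..
qed

section \<open>Averages and Hopf-Lax operators\<close>

text \<open>Common form of the estimates that split at a radius: a good bound, plus a crude one
  weighted with the mass outside a ball.\<close>

lemma integral_le_tail:
  fixes \<nu> :: "'a::euclidean_space measure"
  assumes "prob_space \<nu>" "sets \<nu> = sets borel" "integrable \<nu> F"
    and le: "\<And>y. F y \<le> a + b * indicator {y. r < norm y} y"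
  shows "(LINT y|\<nu>. F y) \<le> a + b * measure \<nu> {y. r < norm y}"
proof -
  interpret prob_space \<nu> by fact
  note [measurable_cong, simp] = assms(2)
  have sp: "space \<nu> = UNIV" using sets_eq_imp_space_eq[OF assms(2)] by simp
  have m: "{y. r < norm y} \<in> sets \<nu>" by simp
  have "(LINT y|\<nu>. F y) \<le> (LINT y|\<nu>. a + b * indicator {y. r < norm y} y)"
    by (rule integral_mono) (use le assms(3) m in \<open>auto simp: less_top[symmetric]\<close>)
  also have "\<dots> = a + b * measure \<nu> {y. r < norm y}"
    using m by (simp add: prob_space less_top[symmetric])
  finally show ?thesis .
qed

lemma tail_tendsto_0:
  fixes \<nu> :: "'a::euclidean_space measure"
  assumes "prob_space \<nu>" "sets \<nu> = sets borel"
  shows "(\<lambda>n. measure \<nu> {y. real n < norm y}) \<longlonglongrightarrow> 0"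
proof -
  interpret prob_space \<nu> by fact
  note [measurable_cong, simp] = assms(2)
  have "(\<lambda>n. measure \<nu> {y. real n < norm y}) \<longlonglongrightarrow> measure \<nu> (\<Inter>n. {y. real n < norm y})"
    by (rule finite_Lim_measure_decseq) (auto simp: decseq_def intro: le_less_trans)
  also have "(\<Inter>n. {y::'a. real n < norm y}) = {}"
  proof -
    have "\<exists>n. \<not> real n < norm y" for y :: 'a
      using real_arch_simple[of "norm y"] by (auto simp: not_less)
    then show ?thesis by auto
  qed
  finally show ?thesis by simp
qed

definition vanishing :: "('a::euclidean_space \<Rightarrow> real) \<Rightarrow> bool" where
  "vanishing g \<longleftrightarrow> (\<forall>e>0. \<exists>R. \<forall>x. R < norm x \<longrightarrow> \<bar>g x\<bar> < e)"

lemma vanishing_iff: "vanishing g \<longleftrightarrow> (g \<longlongrightarrow> 0) at_infinity"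
proof -
  have "(\<exists>R. \<forall>x. R < norm x \<longrightarrow> \<bar>g x\<bar> < e) \<longleftrightarrow> (\<exists>R. \<forall>x. R \<le> norm x \<longrightarrow> \<bar>g x\<bar> < e)" for e
    by (meson less_imp_le less_le_trans gt_ex)
  then show ?thesis by (simp add: vanishing_def Lim_at_infinity)
qed

lemma vanishing_avg:
  assumes \<nu>: "prob_space \<nu>" "sets \<nu> = sets borel" and g: "ucb g" "vanishing g"
  shows "vanishing (avg \<nu> g)"
  unfolding vanishing_def
proof (intro allI impI)
  fix e :: real assume e: "0 < e"
  obtain B where B: "0 < B" "\<And>x. \<bar>g x\<bar> \<le> B" using ucb_bound[OF g(1)] by blast
  have "\<forall>\<^sub>F n in sequentially. measure \<nu> {y. real n < norm y} < e / 2 / B"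
    using tail_tendsto_0[OF \<nu>] by (rule order_tendstoD) (use e B in simp)
  then obtain n where n: "measure \<nu> {y. real n < norm y} < e / 2 / B"
    by (auto simp: eventually_sequentially)
  obtain R where R: "\<And>x. R < norm x \<Longrightarrow> \<bar>g x\<bar> < e / 2"
    using g(2) e unfolding vanishing_def by (meson half_gt_zero)
  have int: "integrable \<nu> (\<lambda>y. g (x + y))" for x by (rule ucb_integrable[OF \<nu> g(1)])
  have "\<bar>avg \<nu> g x\<bar> < e" if x: "R + n < norm x" for x
  proof -
    have "\<bar>avg \<nu> g x\<bar> \<le> (LINT y|\<nu>. \<bar>g (x + y)\<bar>)"
      unfolding avg_def by (rule integral_abs_bound)
    also have "\<dots> \<le> e / 2 + B * measure \<nu> {y. real n < norm y}"
    proof (rule integral_le_tail[OF \<nu> integrable_abs[OF int]])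
      fix y show "\<bar>g (x + y)\<bar> \<le> e / 2 + B * indicator {y. real n < norm y} y"
      proof (cases "real n < norm y")
        case True then show ?thesis using B(2)[of "x + y"] e by simp
      next
        case False
        then have "R < norm (x + y)"
          using x norm_diff_ineq[of x y] by simp
        then show ?thesis using R[of "x + y"] False by simp
      qed
    qed
    also have "\<dots> < e" using n B by (simp add: field_simps)
    finally show ?thesis .
  qed
  then show "\<exists>R. \<forall>x. R < norm x \<longrightarrow> \<bar>avg \<nu> g x\<bar> < e" by blast
qed

text \<open>What the analysis uses of the Levy process apart from moments. The semigroup laws are
  stated through averages, the only form in which the measures act on functions;
  \<open>small\<close> is stochastic continuity at time 0.\<close>

locale conv_semigroup =
  fixes \<mu> :: "real \<Rightarrow> 'a::euclidean_space measure"
  assumes prob: "0 \<le> t \<Longrightarrow> prob_space (\<mu> t)"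
    and sets_mu: "0 \<le> t \<Longrightarrow> sets (\<mu> t) = sets borel"
    and conv: "0 \<le> s \<Longrightarrow> 0 \<le> t \<Longrightarrow> ucb g \<Longrightarrow> avg (\<mu> (s + t)) g x = avg (\<mu> s) (avg (\<mu> t) g) x"
    and zero: "ucb g \<Longrightarrow> avg (\<mu> 0) g x = g x"
    and small: "0 < r \<Longrightarrow> ((\<lambda>t. measure (\<mu> t) {y. r < norm y}) \<longlongrightarrow> 0) (at_right 0)"
begin

abbreviation S :: "real \<Rightarrow> ('a \<Rightarrow> real) \<Rightarrow> 'a \<Rightarrow> real" where
  "S t \<equiv> avg (\<mu> t)"

lemma mono_op_S: "0 \<le> t \<Longrightarrow> mono_op (S t)"
  by (rule mono_op_avg[OF prob sets_mu])

lemma small_mass: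
  assumes "0 < r" "0 < e"
  obtains h0 where "0 < h0" "\<And>h. 0 < h \<Longrightarrow> h < h0 \<Longrightarrow> measure (\<mu> h) {y. r < norm y} < e"
proof -
  have "\<forall>\<^sub>F h in at_right 0. measure (\<mu> h) {y. r < norm y} < e"
    using small[OF assms(1)] by (rule order_tendstoD) fact
  then show ?thesis using that by (auto simp: eventually_at_right_field)
qed

text \<open>\<open>h0\<close> depends on the class alone. Increments longer than
  \<open>d / 2\<close> change \<open>g\<close> by at most \<open>2 * B\<close> and have mass below
  \<open>e / (4 * B)\<close>; on the others \<open>m\<close> is below \<open>e / 2\<close>.\<close>

lemma S_small_time:
  assumes m: "modulus m" and B: "0 < B" and e: "0 < e"
  obtains h0 where "0 < h0"
    "\<And>h g x. 0 \<le> h \<Longrightarrow> h < h0 \<Longrightarrow> g \<in> mod_class B m \<Longrightarrow> \<bar>S h g x - g x\<bar> \<le> e"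
proof -
  obtain d where d: "0 < d" "\<And>z. norm z < d \<Longrightarrow> m z < e / 2"
    using m e unfolding modulus_def by (meson half_gt_zero)
  obtain h0 where h0: "0 < h0" "\<And>h. 0 < h \<Longrightarrow> h < h0 \<Longrightarrow> measure (\<mu> h) {y. d / 2 < norm y} < e / (4 * B)"
    using small_mass[of "d / 2" "e / (4 * B)"] d e B by auto
  have "\<bar>S h g x - g x\<bar> \<le> e" if h: "0 \<le> h" "h < h0" and g: "g \<in> mod_class B m" for h g x
  proof (cases "h = 0")
    case True
    then show ?thesis using zero[OF mod_class_ucb[OF g m]] e by simp
  next
    case False
    interpret prob_space "\<mu> h" by (rule prob[OF h(1)])
    have int: "integrable (\<mu> h) (\<lambda>y. g (x + y))"
      by (rule ucb_integrable[OF prob[OF h(1)] sets_mu[OF h(1)] mod_class_ucb[OF g m]])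
    have "\<bar>S h g x - g x\<bar> = \<bar>LINT y|\<mu> h. g (x + y) - g x\<bar>"
      using int by (simp add: avg_def prob_space)
    also have "\<dots> \<le> (LINT y|\<mu> h. \<bar>g (x + y) - g x\<bar>)"
      by (rule integral_abs_bound)
    also have "\<dots> \<le> e / 2 + 2 * B * measure (\<mu> h) {y. d / 2 < norm y}"
    proof (rule integral_le_tail[OF prob[OF h(1)] sets_mu[OF h(1)]])
      show "integrable (\<mu> h) (\<lambda>y. \<bar>g (x + y) - g x\<bar>)" using int by auto
      fix y show "\<bar>g (x + y) - g x\<bar> \<le> e / 2 + 2 * B * indicator {y. d / 2 < norm y} y"
      proof (cases "d / 2 < norm y")
        case True
        have "\<bar>g (x + y)\<bar> \<le> B" "\<bar>g x\<bar> \<le> B" using g by (auto simp: mod_class_def)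
        then show ?thesis using True e by simp
      next
        case False
        then have "m y < e / 2" using d by auto
        moreover have "\<bar>g (x + y) - g x\<bar> \<le> m y" using g by (auto simp: mod_class_def)
        ultimately show ?thesis using False by simp
      qed
    qed
    also have "\<dots> \<le> e" using h0(2)[of h] h False B by (simp add: field_simps)
    finally show ?thesis .
  qed
  then show ?thesis using that[of h0] h0(1) by blast
qed

end

text \<open>\<open>W\<close> stands for the effective domain of the penalty and
  \<open>\<rho>\<close> for its real values there, so that all suprema are real and an infinite
  penalty becomes an excluded velocity. Superlinearity, for every slope \<open>N\<close>, confines
  the relevant velocities to a ball.\<close>

locale hopf_lax =
  fixes W :: "'a::euclidean_space set" and \<rho> :: "'a \<Rightarrow> real"
  assumes zero_W: "0 \<in> W" and rho_0: "\<rho> 0 = 0" and rho_nonneg: "w \<in> W \<Longrightarrow> 0 \<le> \<rho> w"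
    and convex_rho: "convex_on W \<rho>"
    and superlinear: "\<exists>C. \<forall>w\<in>W. N * norm w - C \<le> \<rho> w"
begin

text \<open>The Hopf-Lax formula in terms of velocities \<open>w\<close> instead of displacements,
  which makes sense at \<open>t = 0\<close> as well.\<close>

definition H :: "real \<Rightarrow> ('a \<Rightarrow> real) \<Rightarrow> 'a \<Rightarrow> real" where
  "H t g x = (SUP w\<in>W. g (x + t *\<^sub>R w) - t * \<rho> w)"

text \<open>Only the radial case, where \<open>legendre D\<close> is the conjugate at \<open>norm D\<close>, occurs below.\<close>

definition legendre :: "'a \<Rightarrow> real" where
  "legendre D = (SUP w\<in>W. D \<bullet> w - \<rho> w)"

lemma superlinearE:
  obtains C where "0 < C" "\<And>w. w \<in> W \<Longrightarrow> N * norm w - C \<le> \<rho> w"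
proof -
  obtain C where C: "\<And>w. w \<in> W \<Longrightarrow> N * norm w - C \<le> \<rho> w" using superlinear[of N] by blast
  have "N * norm w - max C 1 \<le> \<rho> w" if "w \<in> W" for w
    using C[OF that] by simp
  then show ?thesis by (intro that[of "max C 1"]) auto
qed

lemma mono_op_translate: "mono_op (\<lambda>g x. g (x + z))"
  unfolding mono_op_def
  by (intro conjI allI impI ext) (auto simp: le_fun_def add.assoc add.commute[of z])

lemma
  assumes "0 \<le> t"
  shows mono_op_H: "mono_op (H t)"
    and H_upper: "ucb g \<Longrightarrow> w \<in> W \<Longrightarrow> g (x + t *\<^sub>R w) - t * \<rho> w \<le> H t g x"
  using mono_op_SUP[of W "\<lambda>w g x. g (x + t *\<^sub>R w)" "\<lambda>w. t * \<rho> w" 0]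
    mono_op_SUP_upper[of W "\<lambda>w g x. g (x + t *\<^sub>R w)" "\<lambda>w. t * \<rho> w" g w x]
    mono_op_translate rho_nonneg zero_W rho_0 assms
  by (auto simp: H_def[abs_def])

lemma H_least: "(\<And>w. w \<in> W \<Longrightarrow> g (x + t *\<^sub>R w) - t * \<rho> w \<le> c) \<Longrightarrow> H t g x \<le> c"
  unfolding H_def using zero_W by (intro cSUP_least) auto

lemma H_ge: "0 \<le> t \<Longrightarrow> ucb g \<Longrightarrow> g x \<le> H t g x"
  using H_upper[of t g 0 x] zero_W rho_0 by simp

lemma H_0: "ucb g \<Longrightarrow> H 0 g x = g x"
  by (intro antisym H_ge H_least) auto

text \<open>Velocity \<open>w\<close> for time \<open>s\<close> followed by \<open>v\<close> for
  time \<open>t\<close> leads to the same point as their time-weighted mean during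
  \<open>s + t\<close>, whose cost is no larger by convexity.\<close>

lemma H_H:
  assumes st: "0 \<le> s" "0 \<le> t" and g: "ucb g"
  shows "H s (H t g) x \<le> H (s + t) g x"
proof (cases "s + t = 0")
  case True
  then have "s = 0" "t = 0" using st by auto
  then show ?thesis using H_0[OF g] H_0[OF mono_op_ucb[OF mono_op_H[of 0] g]] by simp
next
  case False
  then have pos: "0 < s + t" using st by simp
  show ?thesis
  proof (rule H_least)
    fix w assume w: "w \<in> W"
    have "H t g (x + s *\<^sub>R w) \<le> H (s + t) g x + s * \<rho> w"
    proof (rule H_least)
      fix v assume v: "v \<in> W"
      define a where "a = t / (s + t)"
      have a: "0 \<le> a" "0 \<le> 1 - a" "(s + t) * a = t" "(s + t) * (1 - a) = s"
        using st pos by (auto simp: a_def field_simps)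
      define y where "y = (1 - a) *\<^sub>R w + a *\<^sub>R v"
      have "convex W" using convex_rho by (simp add: convex_on_def)
      then have y: "y \<in> W" unfolding y_def using a w v by (intro convexD) auto
      have "(s + t) * \<rho> y \<le> (s + t) * ((1 - a) * \<rho> w + a * \<rho> v)"
        unfolding y_def using convex_onD[OF convex_rho, of a w v] a w v pos
        by (intro mult_left_mono) auto
      also have "\<dots> = ((s + t) * (1 - a)) * \<rho> w + ((s + t) * a) * \<rho> v" by (simp only: ring_distribs mult.assoc)
      also have "\<dots> = s * \<rho> w + t * \<rho> v" unfolding a ..
      finally have 1: "(s + t) * \<rho> y \<le> s * \<rho> w + t * \<rho> v" .
      have "(s + t) *\<^sub>R y = ((s + t) * (1 - a)) *\<^sub>R w + ((s + t) * a) *\<^sub>R v"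
        by (simp only: y_def scaleR_right_distrib scaleR_scaleR)
      then have "(s + t) *\<^sub>R y = s *\<^sub>R w + t *\<^sub>R v" unfolding a .
      then have "g (x + s *\<^sub>R w + t *\<^sub>R v) - (s + t) * \<rho> y \<le> H (s + t) g x"
        using H_upper[of "s + t" g y x] y pos g by (simp add: add.assoc)
      then show "g (x + s *\<^sub>R w + t *\<^sub>R v) - t * \<rho> v \<le> H (s + t) g x + s * \<rho> w"
        using 1 by linarith
    qed
    then show "H t g (x + s *\<^sub>R w) - s * \<rho> w \<le> H (s + t) g x" by simp
  qed
qed

text \<open>A shift that is chosen after the noise has been observed does at least as well.\<close>

lemma H_avg:
  assumes t: "0 \<le> t" and \<nu>: "prob_space \<nu>" "sets \<nu> = sets borel" and g: "ucb g"
  shows "H t (avg \<nu> g) x \<le> avg \<nu> (H t g) x"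
proof (rule H_least)
  fix w assume w: "w \<in> W"
  note A = mono_op_avg[OF \<nu>]
  have "avg \<nu> (\<lambda>y. g (y + t *\<^sub>R w)) x \<le> avg \<nu> (H t g) x + t * \<rho> w"
    using H_upper[OF t g w] mono_op_ucb[OF mono_op_H[OF t] g]
    by (intro mono_op_le_add[OF A ucb_shift[OF g]]) (auto simp: diff_le_eq)
  then show "avg \<nu> g (x + t *\<^sub>R w) - t * \<rho> w \<le> avg \<nu> (H t g) x"
    using mono_op_shift[OF A g] by simp
qed

lemma H_small_time:
  assumes m: "modulus m" and B: "0 < B" and e: "0 < e"
  obtains h0 where "0 < h0"
    "\<And>h g x. 0 \<le> h \<Longrightarrow> h < h0 \<Longrightarrow> g \<in> mod_class B m \<Longrightarrow> H h g x \<le> g x + e"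
proof -
  obtain d where d: "0 < d" "\<And>z. norm z < d \<Longrightarrow> m z < e"
    using m e unfolding modulus_def by meson
  \<comment> \<open>With slope \<open>3 * B / d\<close>, travelling a distance of at least
    \<open>d\<close> within time \<open>h\<close> costs at least \<open>3 * B - h * C\<close>, hence
    at least \<open>2 * B\<close> when \<open>h < B / C\<close>; the gain in \<open>g\<close> is at
    most \<open>2 * B\<close>.\<close>
  obtain C where C: "0 < C" "\<And>w. w \<in> W \<Longrightarrow> 3 * B / d * norm w - C \<le> \<rho> w"
    using superlinearE by metis
  have "H h g x \<le> g x + e" if h: "0 \<le> h" "h < B / C" and g: "g \<in> mod_class B m" for h g x
  proof (rule H_least)
    fix w assume w: "w \<in> W"
    show "g (x + h *\<^sub>R w) - h * \<rho> w \<le> g x + e"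
    proof (cases "norm (h *\<^sub>R w) < d")
      case True
      then have "m (h *\<^sub>R w) < e" by (rule d(2))
      moreover have "\<bar>g (x + h *\<^sub>R w) - g x\<bar> \<le> m (h *\<^sub>R w)"
        using g unfolding mod_class_def by blast
      ultimately have "\<bar>g (x + h *\<^sub>R w) - g x\<bar> \<le> e" by linarith
      moreover have "0 \<le> h * \<rho> w" using rho_nonneg[OF w] h by simp
      ultimately show ?thesis by linarith
    next
      case False
      then have "d \<le> h * norm w" using h by simp
      then have "3 * B / d * d \<le> 3 * B / d * (h * norm w)" using B d by (intro mult_left_mono) auto
      also have "\<dots> = h * (3 * B / d * norm w - C) + h * C" by (simp add: algebra_simps)
      also have "\<dots> \<le> h * \<rho> w + B"
        using C(2)[OF w] h C(1) by (intro add_mono mult_left_mono) (auto simp: field_simps)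
      finally have "2 * B \<le> h * \<rho> w" using d by simp
      moreover have "\<bar>g (x + h *\<^sub>R w)\<bar> \<le> B" "\<bar>g x\<bar> \<le> B" using g by (auto simp: mod_class_def)
      ultimately show ?thesis using e by linarith
    qed
  qed
  then show ?thesis using that[of "B / C"] B C by simp
qed

text \<open>A displacement of length at least \<open>B + t * C\<close> costs at least
  \<open>B\<close> and cannot pay; from a point far out, shorter ones stay where \<open>g\<close> is
  small.\<close>

lemma H_vanishing:
  assumes t: "0 \<le> t" and g: "ucb g" "vanishing g" and e: "0 < e"
  obtains R where "\<And>x. R < norm x \<Longrightarrow> \<bar>H t g x\<bar> < e"
proof -
  obtain B where B: "0 < B" "\<And>x. \<bar>g x\<bar> \<le> B" using ucb_bound[OF g(1)] by blast
  obtain C where C: "0 < C" "\<And>w. w \<in> W \<Longrightarrow> 1 * norm w - C \<le> \<rho> w"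
    using superlinearE by metis
  obtain R where R: "\<And>x. R < norm x \<Longrightarrow> \<bar>g x\<bar> < e / 2"
    using g(2) e unfolding vanishing_def by (meson half_gt_zero)
  have "\<bar>H t g x\<bar> < e" if x: "\<bar>R\<bar> + (B + t * C) < norm x" for x
  proof -
    have "H t g x \<le> e / 2"
    proof (rule H_least)
      fix w assume w: "w \<in> W"
      have r: "t * norm w - t * C \<le> t * \<rho> w"
        using mult_left_mono[OF C(2)[OF w] t] by (simp add: algebra_simps)
      show "g (x + t *\<^sub>R w) - t * \<rho> w \<le> e / 2"
      proof (cases "norm (t *\<^sub>R w) < B + t * C")
        case True
        then have "R < norm (x + t *\<^sub>R w)"
          using x norm_diff_ineq[of x "t *\<^sub>R w"] by linarith
        then show ?thesis using R[of "x + t *\<^sub>R w"] mult_nonneg_nonneg[OF t rho_nonneg[OF w]] by linarith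
      next
        case False
        then have "B + t * C \<le> t * norm w" using t by simp
        then show ?thesis using B(2)[of "x + t *\<^sub>R w"] e r by linarith
      qed
    qed
    moreover have "\<bar>g x\<bar> < e / 2"
      using x B C t by (intro R) (smt (verit) mult_nonneg_nonneg)
    ultimately show ?thesis using H_ge[OF t g(1), of x] e by linarith
  qed
  then show ?thesis using that by blast
qed

text \<open>Superlinearity with slope \<open>G + 1\<close>: the surplus \<open>norm w\<close> over
  the linear term pays for \<open>C + K\<close>, uniformly over all slopes bounded by
  \<open>G\<close>.\<close>

lemma rho_radius:
  obtains R where "0 < R"
    "\<And>D w. norm D \<le> G \<Longrightarrow> w \<in> W \<Longrightarrow> R \<le> norm w \<Longrightarrow> D \<bullet> w - \<rho> w \<le> - K"
proof -
  obtain C where C: "0 < C" "\<And>w. w \<in> W \<Longrightarrow> (G + 1) * norm w - C \<le> \<rho> w"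
    using superlinearE by metis
  have "D \<bullet> w - \<rho> w \<le> - K" if "norm D \<le> G" "w \<in> W" "max 1 (C + K) \<le> norm w" for D w
  proof -
    have "D \<bullet> w \<le> norm D * norm w" by (rule norm_cauchy_schwarz)
    also have "\<dots> \<le> G * norm w" using that by (intro mult_right_mono) auto
    finally show ?thesis using C(2)[OF that(2)] that(3) by (simp add: algebra_simps)
  qed
  then show ?thesis by (intro that[of "max 1 (C + K)"]) auto
qed

section \<open>The Legendre transform of the penalty\<close>

lemma legendre_upper: "w \<in> W \<Longrightarrow> D \<bullet> w - \<rho> w \<le> legendre D"
proof -
  assume w: "w \<in> W"
  obtain C where C: "0 < C" "\<And>w. w \<in> W \<Longrightarrow> norm D * norm w - C \<le> \<rho> w"
    using superlinearE by metis
  have "D \<bullet> w - \<rho> w \<le> C" if "w \<in> W" for w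
    using C(2)[OF that] norm_cauchy_schwarz[of D w] by linarith
  then show ?thesis unfolding legendre_def using w by (intro cSUP_upper bdd_aboveI2) auto
qed

lemma legendre_least: "(\<And>w. w \<in> W \<Longrightarrow> D \<bullet> w - \<rho> w \<le> c) \<Longrightarrow> legendre D \<le> c"
  unfolding legendre_def using zero_W by (intro cSUP_least) auto

lemma legendre_nonneg: "0 \<le> legendre D"
  using legendre_upper[OF zero_W, of D] rho_0 by simp

text \<open>Velocities outside the ball of radius \<open>R\<close> give values of at most 0, and the
  transform is nonnegative; the affine functions belonging to the remaining velocities have
  Lipschitz constant at most \<open>R\<close>.\<close>

lemma legendre_lipschitz:
  obtains R where "0 < R"
    "\<And>D E. norm D \<le> G \<Longrightarrow> norm E \<le> G \<Longrightarrow> legendre E \<le> legendre D + R * norm (E - D)"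
proof -
  obtain R where R: "0 < R" "\<And>D w. norm D \<le> G \<Longrightarrow> w \<in> W \<Longrightarrow> R \<le> norm w \<Longrightarrow> D \<bullet> w - \<rho> w \<le> - 0"
    using rho_radius by metis
  have "legendre E \<le> legendre D + R * norm (E - D)" if "norm D \<le> G" "norm E \<le> G" for D E
  proof (rule legendre_least)
    fix w assume w: "w \<in> W"
    show "E \<bullet> w - \<rho> w \<le> legendre D + R * norm (E - D)"
    proof (cases "R \<le> norm w")
      case True
      have "0 \<le> R * norm (E - D)" using R by simp
      then show ?thesis using R(2)[OF that(2) w True] legendre_nonneg[of D] by linarith
    next
      case False
      have "(E - D) \<bullet> w \<le> norm (E - D) * norm w" by (rule norm_cauchy_schwarz)
      also have "\<dots> \<le> norm (E - D) * R" using False by (intro mult_left_mono) auto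
      finally show ?thesis using legendre_upper[OF w, of D] by (simp add: algebra_simps)
    qed
  qed
  then show ?thesis using that R(1) by blast
qed

end

section \<open>Dyadic approximations\<close>

text \<open>The scheme \<open>dyadic_step\<close> with the one-step operator as a parameter, so that
  two families can be compared. The incomplete step is the one applied first.\<close>

definition dyadic :: "(real \<Rightarrow> 'b \<Rightarrow> 'b) \<Rightarrow> nat \<Rightarrow> real \<Rightarrow> 'b \<Rightarrow> 'b" where
  "dyadic T n t f = (T (1 / 2 ^ n) ^^ nat \<lfloor>2 ^ n * t\<rfloor>) (T (t - real (nat \<lfloor>2 ^ n * t\<rfloor>) / 2 ^ n) f)"

lemma dyadic_remainder:
  assumes "0 \<le> t"
  shows "0 \<le> t - real (nat \<lfloor>2 ^ n * t\<rfloor>) / 2 ^ n" "t - real (nat \<lfloor>2 ^ n * t\<rfloor>) / 2 ^ n < 1 / 2 ^ n"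
proof -
  have "0 \<le> (2::real) ^ n * t" using assms by simp
  moreover define k where "k = real (nat \<lfloor>2 ^ n * t\<rfloor>)"
  ultimately have "k \<le> 2 ^ n * t" "2 ^ n * t < k + 1"
    by linarith+
  then show "0 \<le> t - real (nat \<lfloor>2 ^ n * t\<rfloor>) / 2 ^ n" "t - real (nat \<lfloor>2 ^ n * t\<rfloor>) / 2 ^ n < 1 / 2 ^ n"
    unfolding k_def[symmetric]
    using pos_less_divide_eq[of "2 ^ n" t "k + 1"] pos_divide_le_eq[of "2 ^ n" k t]
    by (simp_all add: mult.commute add_divide_distrib)
qed

text \<open>As \<open>m \<le> n\<close>, the increment is a whole number of mesh steps: the floor
  moves by \<open>2 ^ (n - m)\<close> and the remainder stays. This is the source of the restriction
  to dyadic increments in the step estimates for \<open>U\<close>.\<close>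

lemma dyadic_add:
  assumes "0 \<le> t" "m \<le> n"
  shows "dyadic T n (t + 1 / 2 ^ m) f = (T (1 / 2 ^ n) ^^ (2 ^ (n - m))) (dyadic T n t f)"
proof -
  have "2 ^ n = (2::real) ^ (n - m) * 2 ^ m" using assms(2) by (simp flip: power_add)
  then have "2 ^ n * (t + 1 / 2 ^ m) = 2 ^ n * t + real_of_int (2 ^ (n - m))"
    by (simp add: distrib_left)
  then have "\<lfloor>2 ^ n * (t + 1 / 2 ^ m)\<rfloor> = \<lfloor>2 ^ n * t\<rfloor> + 2 ^ (n - m)"
    by (metis floor_add_int)
  moreover have "0 \<le> \<lfloor>2 ^ n * t\<rfloor>" using assms(1) by simp
  ultimately have k: "nat \<lfloor>2 ^ n * (t + 1 / 2 ^ m)\<rfloor> = 2 ^ (n - m) + nat \<lfloor>2 ^ n * t\<rfloor>"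
    by (simp add: nat_add_distrib nat_power_eq)
  have p: "(2::real) ^ (n - m) / 2 ^ n = 1 / 2 ^ m"
    using assms(2) by (simp add: field_simps flip: power_add)
  have r: "t + 1 / 2 ^ m - real (2 ^ (n - m) + nat \<lfloor>2 ^ n * t\<rfloor>) / 2 ^ n
      = t - real (nat \<lfloor>2 ^ n * t\<rfloor>) / 2 ^ n"
    by (simp add: add_divide_distrib p)
  show ?thesis
    unfolding dyadic_def k r by (simp add: funpow_add)
qed

lemma small_dyadic:
  assumes "0 < (h::real)"
  obtains n0 :: nat where "\<And>n. n0 \<le> n \<Longrightarrow> 1 / 2 ^ n < h"
proof -
  have "(\<lambda>n. (1 / 2 :: real) ^ n) \<longlonglongrightarrow> 0" by (rule LIMSEQ_power_zero) simp
  then have "\<forall>\<^sub>F n in sequentially. (1 / 2 :: real) ^ n < h" by (rule order_tendstoD) fact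
  then show ?thesis using that by (auto simp: eventually_sequentially power_divide)
qed

section \<open>The lower operators and their dyadic iterates\<close>

locale levy_hopf_lax = conv_semigroup \<mu> + hopf_lax W \<rho>
  for \<mu> :: "real \<Rightarrow> 'a::euclidean_space measure" and W :: "'a set" and \<rho> :: "'a \<Rightarrow> real"
begin

definition L :: "real \<Rightarrow> ('a \<Rightarrow> real) \<Rightarrow> 'a \<Rightarrow> real" where
  "L t g = H t (S t g)"

lemma ucb_S: "0 \<le> t \<Longrightarrow> ucb g \<Longrightarrow> ucb (S t g)"
  by (rule mono_op_ucb[OF mono_op_S])

lemma ucb_H: "0 \<le> t \<Longrightarrow> ucb g \<Longrightarrow> ucb (H t g)"
  by (rule mono_op_ucb[OF mono_op_H])

lemma mono_op_L: "0 \<le> t \<Longrightarrow> mono_op (L t)"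
  using mono_op_comp[OF mono_op_H mono_op_S] by (simp add: L_def[abs_def])

lemma ucb_L: "0 \<le> t \<Longrightarrow> ucb g \<Longrightarrow> ucb (L t g)"
  by (rule mono_op_ucb[OF mono_op_L])

lemma S_le_L: "0 \<le> t \<Longrightarrow> ucb g \<Longrightarrow> S t g x \<le> L t g x"
  unfolding L_def by (rule H_ge[OF _ ucb_S])

lemma L_le_S_H: "0 \<le> t \<Longrightarrow> ucb g \<Longrightarrow> L t g x \<le> S t (H t g) x"
  unfolding L_def by (rule H_avg[OF _ prob sets_mu])

lemma L_avg:
  assumes t: "0 \<le> t" and \<nu>: "prob_space \<nu>" "sets \<nu> = sets borel" and g: "ucb g"
  shows "L t (avg \<nu> g) x \<le> avg \<nu> (L t g) x"
proof -
  have "S t (avg \<nu> g) = avg \<nu> (S t g)"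
    using avg_avg(2)[OF prob[OF t] sets_mu[OF t] \<nu> g] by auto
  then show ?thesis
    unfolding L_def using H_avg[OF t \<nu> ucb_S[OF t g]] by simp
qed

text \<open>The shift chosen for the long step is split proportionally between the two short steps.\<close>

lemma L_add_le:
  assumes s: "0 \<le> s" and t: "0 \<le> t" and g: "ucb g"
  shows "L (s + t) g x \<le> L s (L t g) x"
  unfolding L_def[of "s + t"]
proof (rule H_least)
  fix w assume w: "w \<in> W"
  have 1: "S t g (y + t *\<^sub>R w) \<le> L t g y + t * \<rho> w" for y
    using H_upper[OF t ucb_S[OF t g] w, of y] by (simp add: L_def diff_le_eq)
  have "S (s + t) g (x + (s + t) *\<^sub>R w) = S s (S t g) (x + s *\<^sub>R w + t *\<^sub>R w)"
    using conv[OF s t g] by (simp add: scaleR_add_left add.assoc)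
  also have "\<dots> = S s (\<lambda>y. S t g (y + t *\<^sub>R w)) (x + s *\<^sub>R w)"
    by (rule mono_op_shift[OF mono_op_S[OF s] ucb_S[OF t g], symmetric])
  also have "\<dots> \<le> S s (L t g) (x + s *\<^sub>R w) + t * \<rho> w"
    by (rule mono_op_le_add[OF mono_op_S[OF s] ucb_shift[OF ucb_S[OF t g]] ucb_L[OF t g] 1])
  also have "S s (L t g) (x + s *\<^sub>R w) \<le> L s (L t g) x + s * \<rho> w"
    using H_upper[OF s ucb_S[OF s ucb_L[OF t g]] w, of x] by (simp add: L_def[of s] diff_le_eq)
  finally show "S (s + t) g (x + (s + t) *\<^sub>R w) - (s + t) * \<rho> w \<le> L s (L t g) x"
    by (simp add: algebra_simps)
qed

lemma mono_op_dyadic: "0 \<le> t \<Longrightarrow> mono_op (dyadic L n t)"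
  unfolding dyadic_def[abs_def]
  by (rule mono_op_comp[OF mono_op_funpow[OF mono_op_L] mono_op_L[OF dyadic_remainder(1)]]) auto

text \<open>In each step the averages merge by \<open>conv\<close>, then \<open>H_avg\<close> moves
  the new Hopf-Lax operator inside, where \<open>H_H\<close> merges it with the old one. The offset
  \<open>s\<close> accommodates the incomplete step of \<open>dyadic\<close>; \<open>s = 0\<close>
  treats pure iterates.\<close>

lemma funpow_L_upper:
  assumes s: "0 \<le> s" and h: "0 \<le> h" and f: "ucb f" and g: "ucb g" "\<And>x. g x \<le> S s (H s f) x"
  shows "(L h ^^ k) g x \<le> S (s + k * h) (H (s + k * h) f) x"
proof (induction k arbitrary: x)
  case (Suc k)
  let ?t = "s + k * h"
  have t: "0 \<le> ?t" using s h by simp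
  have "S h (S ?t (H ?t f)) y = S (h + ?t) (H ?t f) y" for y
    by (rule conv[OF h t ucb_H[OF t f], symmetric])
  then have eq: "S h (S ?t (H ?t f)) = S (h + ?t) (H ?t f)" by auto
  have "L h ((L h ^^ k) g) x \<le> L h (S ?t (H ?t f)) x"
    using Suc by (intro mono_op_mono[OF mono_op_L[OF h]] mono_op_ucb[OF mono_op_funpow[OF mono_op_L[OF h]]]
        g ucb_S ucb_H t f)
  also have "\<dots> \<le> S (h + ?t) (H h (H ?t f)) x"
    unfolding L_def eq using h t by (intro H_avg[OF h] prob sets_mu ucb_H f) auto
  also have "\<dots> \<le> S (h + ?t) (H (h + ?t) f) x"
    using h t by (intro mono_op_mono[OF mono_op_S] H_H ucb_H f) auto
  finally show ?case by (simp add: algebra_simps)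
qed (use g in auto)

lemma funpow_L_lower:
  assumes s: "0 \<le> s" and h: "0 \<le> h" and f: "ucb f" and g: "ucb g" "\<And>x. S s f x \<le> g x"
  shows "S (s + k * h) f x \<le> (L h ^^ k) g x"
proof (induction k arbitrary: x)
  case (Suc k)
  let ?t = "s + k * h"
  have t: "0 \<le> ?t" using s h by simp
  note u = mono_op_ucb[OF mono_op_funpow[OF mono_op_L[OF h]] g(1)]
  have "S (h + ?t) f x = S h (S ?t f) x"
    by (rule conv[OF h t f])
  also have "\<dots> \<le> S h ((L h ^^ k) g) x"
    using Suc by (intro mono_op_mono[OF mono_op_S[OF h]] u ucb_S t f)
  also have "\<dots> \<le> L h ((L h ^^ k) g) x"
    by (rule S_le_L[OF h u])
  finally show ?case by (simp add: algebra_simps)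
qed (use g in auto)

lemma dyadic_upper:
  assumes t: "0 \<le> t" and f: "ucb f" shows "dyadic L n t f x \<le> S t (H t f) x"
proof -
  note r = dyadic_remainder(1)[OF t, of n]
  show ?thesis
    unfolding dyadic_def
    using funpow_L_upper[OF r _ f ucb_L[OF r f] L_le_S_H[OF r f], of "1 / 2 ^ n" "nat \<lfloor>2 ^ n * t\<rfloor>" x]
    by simp
qed

lemma dyadic_lower:
  assumes t: "0 \<le> t" and f: "ucb f" shows "S t f x \<le> dyadic L n t f x"
proof -
  note r = dyadic_remainder(1)[OF t, of n]
  show ?thesis
    unfolding dyadic_def
    using funpow_L_lower[OF r _ f ucb_L[OF r f] S_le_L[OF r f], of "1 / 2 ^ n" "nat \<lfloor>2 ^ n * t\<rfloor>" x]
    by simp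
qed

lemma L_0: "ucb f \<Longrightarrow> L 0 f x = f x"
  unfolding L_def using H_0[OF ucb_S[of 0 f]] zero by simp

text \<open>Refinement replaces every \<open>L (h + h)\<close> by two steps \<open>L h\<close>,
  which is larger by \<open>L_add_le\<close>. A remainder \<open>r\<close> of at least
  \<open>h\<close> is split too, into one more full step and the remainder
  \<open>r - h\<close>.\<close>

lemma dyadic_Suc:
  assumes t: "0 \<le> t" and f: "ucb f"
  shows "dyadic L n t f x \<le> dyadic L (Suc n) t f x"
proof -
  define k where "k = nat \<lfloor>2 ^ n * t\<rfloor>"
  define r where "r = t - real k / 2 ^ n"
  define h :: real where "h = 1 / 2 ^ Suc n"
  have h: "0 < h" "1 / 2 ^ n = h + h" by (auto simp: h_def field_simps)
  have r: "0 \<le> r" "r < h + h"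
    using dyadic_remainder[OF t, of n] by (auto simp: r_def k_def h(2)[symmetric])
  have tk: "2 ^ Suc n * t = 2 * real k + r / h"
    by (simp add: r_def h_def field_simps)
  have step: "(L (1 / 2 ^ n) ^^ k) F x \<le> (L h ^^ (2 * k)) G x"
    if "ucb F" "ucb G" "\<And>x. F x \<le> G x" for F G
    unfolding funpow_mult[symmetric] h(2)
  proof (rule funpow_mono_op_le[OF mono_op_L mono_op_funpow[OF mono_op_L] _ that])
    show "L (h + h) g y \<le> (L h ^^ 2) g y" if "ucb g" for g y
      using L_add_le[OF _ _ that, of h h y] h(1) by (simp add: numeral_2_eq_2)
  qed (use h in auto)
  show ?thesis
  proof (cases "r < h")
    case True
    then have "\<lfloor>2 ^ Suc n * t\<rfloor> = 2 * int k"
      unfolding tk using r h(1) by (intro floor_unique) auto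
    then have k': "nat \<lfloor>2 ^ Suc n * t\<rfloor> = 2 * k" by simp
    have r': "t - real (2 * k) / 2 ^ Suc n = r" by (simp add: r_def)
    show ?thesis
      unfolding dyadic_def k' r' k_def[symmetric] r_def[symmetric] h_def[symmetric]
      using r by (intro step ucb_L f) auto
  next
    case False
    then have "\<lfloor>2 ^ Suc n * t\<rfloor> = 2 * int k + 1"
      unfolding tk using r h(1) by (intro floor_unique) (auto simp: field_simps)
    then have k': "nat \<lfloor>2 ^ Suc n * t\<rfloor> = Suc (2 * k)" by simp
    have r': "t - real (Suc (2 * k)) / 2 ^ Suc n = r - h" by (simp add: r_def h_def field_simps)
    have "L r f y \<le> L h (L (r - h) f) y" for y
      using L_add_le[of h "r - h" f y] False h f by simp
    then show ?thesis
      unfolding dyadic_def k' r' k_def[symmetric] r_def[symmetric] h_def[symmetric] funpow_Suc_right comp_def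
      using r False h by (intro step ucb_L f) auto
  qed
qed

section \<open>The increasing limit of the iterates\<close>

definition U :: "('a \<Rightarrow> real) \<Rightarrow> real \<Rightarrow> 'a \<Rightarrow> real" where
  "U f t x = lim (\<lambda>n. dyadic L n t f x)"

text \<open>The limit exists because the iterates of \<open>L\<close> increase by
  \<open>dyadic_Suc\<close> and are bounded by \<open>dyadic_upper\<close>. Its identification with
  \<open>limit_op\<close> is made in \<open>limit_op_eq\<close>.\<close>

lemma
  assumes t: "0 \<le> t" and f: "ucb f"
  shows dyadic_tendsto: "(\<lambda>n. dyadic L n t f x) \<longlonglongrightarrow> U f t x"
    and dyadic_le_U: "dyadic L n t f x \<le> U f t x"
proof -
  have inc: "incseq (\<lambda>n. dyadic L n t f x)"
    by (rule incseq_SucI) (rule dyadic_Suc[OF t f])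
  then show *: "(\<lambda>n. dyadic L n t f x) \<longlonglongrightarrow> U f t x"
    unfolding U_def using incseq_convergent[OF inc] dyadic_upper[OF t f]
    by (metis limI)
  show "dyadic L n t f x \<le> U f t x"
    by (rule incseq_le[OF inc *])
qed

lemma U_upper: "0 \<le> t \<Longrightarrow> ucb f \<Longrightarrow> U f t x \<le> S t (H t f) x"
  by (rule LIMSEQ_le_const2[OF dyadic_tendsto]) (auto intro: dyadic_upper)

lemma U_lower: "0 \<le> t \<Longrightarrow> ucb f \<Longrightarrow> S t f x \<le> U f t x"
  by (rule LIMSEQ_le_const[OF dyadic_tendsto]) (auto intro: dyadic_lower)

lemma U_0: "ucb f \<Longrightarrow> U f 0 x = f x"
  using U_upper[of 0 f x] U_lower[of 0 f x] zero H_0[of f] ucb_H[of 0 f] by simp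

lemma U_mod_class:
  assumes t: "0 \<le> t" and f: "ucb f" "f \<in> mod_class B m"
  shows "U f t \<in> mod_class B m"
proof -
  have d: "dyadic L n t f \<in> mod_class B m" for n
    by (rule mono_op_mod_class[OF mono_op_dyadic[OF t] f])
  have "\<bar>U f t x\<bar> \<le> B" for x
    by (rule LIMSEQ_le_const2[OF tendsto_rabs[OF dyadic_tendsto[OF t f(1)]]])
      (use d in \<open>auto simp: mod_class_def\<close>)
  moreover have "\<bar>U f t (x + z) - U f t x\<bar> \<le> m z" for x z
    by (rule LIMSEQ_le_const2[OF tendsto_rabs[OF tendsto_diff[OF dyadic_tendsto[OF t f(1)] dyadic_tendsto[OF t f(1)]]]])
      (use d in \<open>auto simp: mod_class_def\<close>)
  ultimately show ?thesis by (simp add: mod_class_def)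
qed

lemma ucb_U: "0 \<le> t \<Longrightarrow> ucb f \<Longrightarrow> ucb (U f t)"
  by (rule ucb_mod_class[of f]) (blast intro: mod_class_ucb U_mod_class)+

text \<open>\<open>U f t\<close> lies between \<open>S t f\<close> and \<open>S t (H t f)\<close>,
  both of which vanish at infinity.\<close>

lemma vanishing_U:
  assumes t: "0 \<le> t" and f: "ucb f" "vanishing f"
  shows "vanishing (U f t)"
proof -
  have H: "vanishing (H t f)"
    unfolding vanishing_def using H_vanishing[OF t f] by metis
  have 1: "vanishing (S t f)" by (rule vanishing_avg[OF prob[OF t] sets_mu[OF t] f])
  have 2: "vanishing (S t (H t f))" by (rule vanishing_avg[OF prob[OF t] sets_mu[OF t] ucb_H[OF t f(1)] H])
  show ?thesis
    unfolding vanishing_def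
  proof (intro allI impI)
    fix e :: real assume "0 < e"
    then obtain R R' where "\<And>x. R < norm x \<Longrightarrow> \<bar>S t f x\<bar> < e" "\<And>x. R' < norm x \<Longrightarrow> \<bar>S t (H t f) x\<bar> < e"
      using 1 2 unfolding vanishing_def by metis
    then have "\<bar>U f t x\<bar> < e" if "max R R' < norm x" for x
      using that U_upper[OF t f(1), of x] U_lower[OF t f(1), of x]
      by (smt (verit) max.strict_boundedE)
    then show "\<exists>R. \<forall>x. R < norm x \<longrightarrow> \<bar>U f t x\<bar> < e" by blast
  qed
qed

text \<open>From level \<open>m\<close> on, the additional time consists of exactly
  \<open>2 ^ (n - m)\<close> mesh steps, which \<open>funpow_L_upper\<close> collapses into one. The
  resulting bound is monotone in its argument, so \<open>dyadic L n t f\<close> is replaced by its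
  upper bound \<open>U f t\<close> before the limit is taken.\<close>

lemma U_step_upper:
  assumes t: "0 \<le> t" and f: "ucb f"
  shows "U f (t + 1 / 2 ^ m) x \<le> S (1 / 2 ^ m) (H (1 / 2 ^ m) (U f t)) x"
proof (rule LIMSEQ_le_const2[OF dyadic_tendsto[OF _ f]])
  let ?h = "1 / 2 ^ m :: real"
  show "0 \<le> t + ?h" using t by simp
  have "dyadic L n (t + ?h) f x \<le> S ?h (H ?h (U f t)) x" if "m \<le> n" for n
  proof -
    let ?g = "dyadic L n t f"
    have g: "ucb ?g" by (rule mono_op_ucb[OF mono_op_dyadic[OF t] f])
    have p: "real (2 ^ (n - m)) * (1 / 2 ^ n) = ?h"
      using that by (simp add: field_simps flip: power_add)
    have "dyadic L n (t + ?h) f x = (L (1 / 2 ^ n) ^^ (2 ^ (n - m))) ?g x"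
      using dyadic_add[OF t that] by metis
    also have "\<dots> \<le> S (0 + real (2 ^ (n - m)) * (1 / 2 ^ n)) (H (0 + real (2 ^ (n - m)) * (1 / 2 ^ n)) ?g) x"
      by (rule funpow_L_upper) (use g zero H_0 ucb_H[of 0] in auto)
    also have "\<dots> = S ?h (H ?h ?g) x" unfolding p by simp
    also have "\<dots> \<le> S ?h (H ?h (U f t)) x"
      using t f g by (intro mono_op_mono[OF mono_op_S] mono_op_mono[OF mono_op_H] ucb_H ucb_U dyadic_le_U) auto
    finally show ?thesis .
  qed
  then show "\<exists>N. \<forall>n\<ge>N. dyadic L n (t + 1 / 2 ^ m) f x \<le> S ?h (H ?h (U f t)) x" by blast
qed

text \<open>Stated for a single velocity instead of with \<open>H\<close>: for fixed
  \<open>w\<close> the limit in \<open>n\<close> passes through the average by dominated convergence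
  and does not meet a supremum.\<close>

lemma U_step_lower:
  assumes t: "0 \<le> t" and f: "ucb f" and w: "w \<in> W"
  shows "S (1 / 2 ^ m) (U f t) (x + (1 / 2 ^ m) *\<^sub>R w) - 1 / 2 ^ m * \<rho> w \<le> U f (t + 1 / 2 ^ m) x"
proof -
  define h :: real where "h = 1 / 2 ^ m"
  have h: "0 < h" by (simp add: h_def)
  then have h': "0 \<le> h" by simp
  let ?g = "\<lambda>n. dyadic L n t f"
  have g: "ucb (?g n)" for n by (rule mono_op_ucb[OF mono_op_dyadic[OF t] f])
  have le: "S h (?g n) (x + h *\<^sub>R w) - h * \<rho> w \<le> U f (t + h) x" if "m \<le> n" for n
  proof -
    have L0: "L 0 (?g n) = ?g n" using L_0[OF g] by auto
    have hn: "nat \<lfloor>2 ^ m * h\<rfloor> = 1" by (simp add: h_def)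
    have "S h (?g n) (x + h *\<^sub>R w) - h * \<rho> w \<le> L h (?g n) x"
      unfolding L_def[of h] by (rule H_upper[OF h' ucb_S[OF h' g] w])
    \<comment> \<open>At level \<open>m\<close> the time \<open>h = 1 / 2 ^ m\<close> is a single
      step, so refining to level \<open>n\<close> only increases the value.\<close>
    also have "\<dots> = dyadic L m h (?g n) x"
      using L0 by (simp add: dyadic_def[of L m] hn) (simp add: h_def)
    also have "\<dots> \<le> dyadic L n h (?g n) x"
      by (rule lift_Suc_mono_le[of "\<lambda>k. dyadic L k h (?g n) x", OF dyadic_Suc[OF h' g] that])
    also have "\<dots> = (L (1 / 2 ^ n) ^^ (2 ^ (n - m))) (dyadic L n 0 (?g n)) x"
      using dyadic_add[of 0 m n L] that by (simp add: h_def)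
    also have "dyadic L n 0 (?g n) = ?g n"
      using L0 by (simp add: dyadic_def[of L n 0])
    also have "(L (1 / 2 ^ n) ^^ (2 ^ (n - m))) (?g n) x = dyadic L n (t + h) f x"
      using dyadic_add[OF t that, of L f] by (simp add: h_def)
    also have "\<dots> \<le> U f (t + h) x"
      using t h f by (intro dyadic_le_U) auto
    finally show ?thesis .
  qed
  obtain B m where Bm: "0 < B" "modulus m" "f \<in> mod_class B m" using ucb_mod_class[OF f] by blast
  then have B: "\<bar>?g n x\<bar> \<le> B" for n x
    using mono_op_mod_class[OF mono_op_dyadic[OF t] f Bm(3)] by (simp add: mod_class_def)
  note [measurable_cong, simp] = sets_mu[OF h']
  note [measurable] = ucb_measurable[OF g] ucb_measurable[OF ucb_U[OF t f]]
  interpret prob_space "\<mu> h" by (rule prob[OF h'])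
  have "(\<lambda>n. S h (?g n) (x + h *\<^sub>R w)) \<longlonglongrightarrow> S h (U f t) (x + h *\<^sub>R w)"
    unfolding avg_def
    by (rule integral_dominated_convergence[where w = "\<lambda>_. B"])
      (auto simp: B intro: dyadic_tendsto[OF t f])
  then have "(\<lambda>n. S h (?g n) (x + h *\<^sub>R w) - h * \<rho> w) \<longlonglongrightarrow> S h (U f t) (x + h *\<^sub>R w) - h * \<rho> w"
    by (intro tendsto_intros)
  then have "S h (U f t) (x + h *\<^sub>R w) - h * \<rho> w \<le> U f (t + h) x"
    by (rule LIMSEQ_le_const2) (use le in blast)
  then show ?thesis by (simp add: h_def)
qed

text \<open>Uniform in the number of steps: the iterates lie between \<open>S\<close> and
  \<open>S\<close> after \<open>H\<close>, both taken at the total time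
  \<open>k * h\<close>.\<close>

lemma L_small_time:
  assumes m: "modulus m" and B: "0 < B" and e: "0 < e"
  obtains h0 where "0 < h0"
    "\<And>h k g x. 0 \<le> h \<Longrightarrow> real k * h < h0 \<Longrightarrow> g \<in> mod_class B m \<Longrightarrow> \<bar>(L h ^^ k) g x - g x\<bar> \<le> e"
proof -
  have e2: "0 < e / 2" using e by simp
  obtain h1 where h1: "0 < h1"
    "\<And>h g x. 0 \<le> h \<Longrightarrow> h < h1 \<Longrightarrow> g \<in> mod_class B m \<Longrightarrow> \<bar>S h g x - g x\<bar> \<le> e / 2"
    using S_small_time[OF m B e2] by metis
  obtain h2 where h2: "0 < h2"
    "\<And>h g x. 0 \<le> h \<Longrightarrow> h < h2 \<Longrightarrow> g \<in> mod_class B m \<Longrightarrow> H h g x \<le> g x + e / 2"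
    using H_small_time[OF m B e2] by metis
  have "\<bar>(L h ^^ k) g x - g x\<bar> \<le> e" if h: "0 \<le> h" "real k * h < min h1 h2" and g: "g \<in> mod_class B m" for h k g x
  proof -
    let ?t = "real k * h"
    have t: "0 \<le> ?t" using h by simp
    have ug: "ucb g" by (rule mod_class_ucb[OF g m])
    have "S (0 + ?t) g x \<le> (L h ^^ k) g x"
      using zero[OF ug] by (intro funpow_L_lower h ug) auto
    moreover have "g x - e / 2 \<le> S ?t g x"
      using h1(2)[OF t _ g, of x] h(2) unfolding abs_le_iff by linarith
    moreover have "(L h ^^ k) g x \<le> S (0 + ?t) (H (0 + ?t) g) x"
      using zero[OF ucb_H[OF _ ug]] H_0[OF ug] by (intro funpow_L_upper h ug) auto
    moreover have "S ?t (H ?t g) x \<le> S ?t g x + e / 2"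
      using h2(2)[OF t _ g] h(2) by (intro mono_op_le_add[OF mono_op_S[OF t] ucb_H[OF t ug] ug]) auto
    moreover have "S ?t g x \<le> g x + e / 2"
      using h1(2)[OF t _ g, of x] h(2) unfolding abs_le_iff by linarith
    ultimately show ?thesis unfolding abs_le_iff add_0 by linarith
  qed
  then show ?thesis using that[of "min h1 h2"] h1(1) h2(1) by simp
qed

text \<open>At a fine level, moving \<open>s\<close> and \<open>t\<close> to grid times costs
  \<open>e / 3\<close> each. The grid times differ by less than \<open>h0\<close>, since both
  \<open>t - s\<close> and the mesh are below \<open>h0 / 2\<close>. The bound holds uniformly in
  the level and therefore in the limit.\<close>

lemma U_time_continuity:
  assumes f: "ucb f" and e: "0 < e"
  obtains d where "0 < d" "\<And>s t x. 0 \<le> s \<Longrightarrow> s \<le> t \<Longrightarrow> t < s + d \<Longrightarrow> \<bar>U f t x - U f s x\<bar> \<le> e"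
proof -
  obtain B m where Bm: "0 < B" "modulus m" "f \<in> mod_class B m" using ucb_mod_class[OF f] by blast
  obtain h0 where h0: "0 < h0"
    "\<And>h k g x. 0 \<le> h \<Longrightarrow> real k * h < h0 \<Longrightarrow> g \<in> mod_class B m \<Longrightarrow> \<bar>(L h ^^ k) g x - g x\<bar> \<le> e / 3"
    using L_small_time[OF Bm(2,1), of "e / 3"] e by (metis divide_pos_pos zero_less_numeral)
  have "\<bar>U f t x - U f s x\<bar> \<le> e" if s: "0 \<le> s" and st: "s \<le> t" "t < s + h0 / 2" for s t x
  proof -
    have t: "0 \<le> t" using s st by simp
    obtain n0 where n0: "\<And>n. n0 \<le> n \<Longrightarrow> 1 / 2 ^ n < h0 / 2" using small_dyadic[of "h0 / 2"] h0(1) by auto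
    have *: "\<bar>dyadic L n t f x - dyadic L n s f x\<bar> \<le> e" if n: "n0 \<le> n" for n
    proof -
      define h :: real where "h = 1 / 2 ^ n"
      define T where "T = L h"
      define k where "k r = nat \<lfloor>2 ^ n * r\<rfloor>" for r :: real
      have h: "0 < h" "h < h0 / 2" using n0[OF n] by (auto simp: h_def)
      have T: "mono_op T" unfolding T_def using h by (intro mono_op_L) simp
      have rem: "0 \<le> r - real (k r) * h" "r - real (k r) * h < h" if "0 \<le> r" for r
        using dyadic_remainder[OF that, of n] by (simp_all add: k_def h_def)
      have kst: "k s \<le> k t" unfolding k_def using st by (intro nat_mono floor_mono) simp
      have near: "\<bar>dyadic L n r f y - (T ^^ k r) f y\<bar> \<le> e / 3" if r: "0 \<le> r" for r y
      proof -
        let ?r = "r - real (k r) * h"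
        have "\<bar>(L ?r ^^ 1) f y - f y\<bar> \<le> e / 3" for y
          by (rule h0(2)) (use rem[OF r] h h0(1) Bm in auto)
        then have le: "\<bar>L ?r f y - f y\<bar> \<le> e / 3" for y by simp
        have "L ?r f y \<le> f y + e / 3" "f y \<le> L ?r f y + e / 3" for y
          using le[of y] unfolding abs_le_iff by linarith+
        then have "(T ^^ k r) (L ?r f) y \<le> (T ^^ k r) f y + e / 3" "(T ^^ k r) f y \<le> (T ^^ k r) (L ?r f) y + e / 3"
          using ucb_L[OF rem(1)[OF r] f] f by (intro mono_op_le_add[OF mono_op_funpow[OF T]]; simp)+
        moreover have eq: "dyadic L n r f = (T ^^ k r) (L ?r f)"
          by (simp add: dyadic_def T_def h_def k_def)
        ultimately show ?thesis unfolding eq by linarith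
      qed
      have eq: "(T ^^ k t) f = (T ^^ (k t - k s)) ((T ^^ k s) f)"
        using kst funpow_add[of "k t - k s" "k s" T] by simp
      moreover have "\<bar>(T ^^ (k t - k s)) ((T ^^ k s) f) x - (T ^^ k s) f x\<bar> \<le> e / 3"
        unfolding T_def
      proof (rule h0(2))
        have "real (k t - k s) * h = real (k t) * h - real (k s) * h"
          using kst by (simp add: algebra_simps of_nat_diff)
        then show "real (k t - k s) * h < h0"
          using rem[OF s] rem[OF t] st h by linarith
        show "(L h ^^ k s) f \<in> mod_class B m"
          using mono_op_mod_class[OF mono_op_funpow[OF T] f Bm(3)] by (simp add: T_def)
      qed (use h in auto)
      ultimately show ?thesis
        using near[OF s, of x] near[OF t, of x] unfolding eq by linarith
    qed
    show ?thesis
      by (rule LIMSEQ_le_const2[OF tendsto_rabs[OF tendsto_diff[OF dyadic_tendsto[OF t f] dyadic_tendsto[OF s f]]]])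
        (use * in blast)
  qed
  then show ?thesis using that[of "h0 / 2"] h0(1) by simp
qed

end

section \<open>Wasserstein distance and penalty\<close>

lemma powr_above_tangent:
  fixes s a p :: real
  assumes p: "1 < p" and a: "0 < a" and s: "0 \<le> s"
  shows "p * a powr (p - 1) * (s - a) \<le> s powr p - a powr p"
proof (cases "s = 0")
  case True
  have "a powr p = a powr (p - 1) * a" using powr_mult_base[of a "p - 1"] a by (simp add: mult.commute)
  moreover have "0 \<le> (p - 1) * (a powr (p - 1) * a)" using p a by simp
  ultimately show ?thesis using True by (simp add: algebra_simps)
next
  case False
  then have s: "0 < s" using s by simp
  show ?thesis
  proof (rule convex_on_imp_above_tangent[where A = "{0<..}"])
    show "convex_on {0<..} (\<lambda>x. x powr p)" using p by (intro powr_convex) simp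
    show "((\<lambda>x. x powr p) has_real_derivative p * a powr (p - 1)) (at a within {0<..})"
      using a by (auto intro!: derivative_eq_intros)
  qed (use a s in \<open>auto simp: interior_open\<close>)
qed

text \<open>Jensen's inequality by integrating the tangent of the \<open>p\<close>-th power at
  \<open>a\<close>; the same tangent supplies integrability.\<close>

lemma (in prob_space) expectation_le_powr:
  fixes p a :: real
  assumes p: "1 < p" and a: "0 < a" and f: "\<And>x. 0 \<le> f x" "integrable M (\<lambda>x. f x powr p)"
    and m: "f \<in> borel_measurable M" and le: "expectation (\<lambda>x. f x powr p) \<le> a powr p"
  shows "integrable M f" "expectation f \<le> a"
proof -
  define c where "c = 1 / (p * a powr (p - 1))"
  have c: "0 < c" using p a by (simp add: c_def)
  have pt: "f x \<le> a + c * (f x powr p - a powr p)" for x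
    using powr_above_tangent[OF p a f(1)[of x]] p a by (simp add: c_def field_simps)
  have int: "integrable M (\<lambda>x. a + c * (f x powr p - a powr p))"
    using f(2) by simp
  show i: "integrable M f"
    by (rule Bochner_Integration.integrable_bound[OF int m]) (use pt f(1) in \<open>auto intro!: AE_I2 order.trans[OF _ abs_ge_self]\<close>)
  have "expectation f \<le> expectation (\<lambda>x. a + c * (f x powr p - a powr p))"
    by (rule integral_mono[OF i int pt])
  also have "\<dots> = a + c * (expectation (\<lambda>x. f x powr p) - a powr p)"
    using f(2) by (simp add: prob_space)
  also have "\<dots> \<le> a" using c le by (simp add: mult_le_0_iff)
  finally show "expectation f \<le> a" .
qed

text \<open>\<open>\<epsilon> powr (- 1 / (p - 1))\<close> is the point from which on
  \<open>\<epsilon> * s powr p\<close> dominates \<open>s\<close>. Linear terms are absorbed in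
  small multiples of the \<open>p\<close>-th power in this way.\<close>

lemma le_powr:
  fixes s \<epsilon> p :: real
  assumes p: "1 < p" and e: "0 < \<epsilon>" and s: "\<epsilon> powr (- 1 / (p - 1)) \<le> s"
  shows "s \<le> \<epsilon> * s powr p"
proof -
  have M: "0 < \<epsilon> powr (- 1 / (p - 1))" using e by simp
  then have s0: "0 < s" using s by linarith
  have "(\<epsilon> powr (- 1 / (p - 1))) powr (p - 1) \<le> s powr (p - 1)"
    using s M p by (intro powr_mono2) auto
  also have "(\<epsilon> powr (- 1 / (p - 1))) powr (p - 1) = \<epsilon> powr (- 1)"
    unfolding powr_powr using p by simp
  also have "\<dots> = 1 / \<epsilon>" using e by (simp add: powr_minus_divide)
  finally have "1 \<le> \<epsilon> * s powr (p - 1)" using e by (simp add: field_simps)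
  then have "1 * s \<le> \<epsilon> * s powr (p - 1) * s" using s0 by (intro mult_right_mono) auto
  also have "\<dots> = \<epsilon> * s powr p" using s0 by (simp add: powr_diff)
  finally show ?thesis by simp
qed

lemma norm_add_powr_le:
  fixes x y :: "'a::real_normed_vector"
  assumes "1 < p"
  shows "norm (x + y) powr p \<le> 2 powr p * (norm x powr p + norm y powr p)"
proof -
  have "norm (x + y) powr p \<le> (2 * max (norm x) (norm y)) powr p"
    using norm_triangle_ineq[of x y] assms by (intro powr_mono2) auto
  also have "\<dots> = 2 powr p * max (norm x) (norm y) powr p"
    by (simp add: powr_mult)
  also have "max (norm x) (norm y) powr p \<le> norm x powr p + norm y powr p"
    by (auto simp: max_def)
  finally show ?thesis by simp
qed

lemma prob_pD:
  assumes "\<nu> \<in> prob_p p"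
  shows "prob_space \<nu>" "sets \<nu> = sets borel" "integrable \<nu> (\<lambda>x. norm x powr p)"
  using assms by (auto simp: prob_p_def)

lemma couplingsD:
  fixes \<mu> \<nu> :: "'a::euclidean_space measure"
  assumes "\<gamma> \<in> couplings \<mu> \<nu>"
  shows "prob_space \<gamma>" "sets \<gamma> = sets borel" "distr \<gamma> borel fst = \<mu>" "distr \<gamma> borel snd = \<nu>"
    "fst \<in> borel_measurable \<gamma>" "snd \<in> borel_measurable \<gamma>"
proof -
  show "prob_space \<gamma>" and s: "sets \<gamma> = sets borel" and "distr \<gamma> borel fst = \<mu>" "distr \<gamma> borel snd = \<nu>"
    using assms by (auto simp: couplings_def)
  show "fst \<in> borel_measurable \<gamma>" "snd \<in> borel_measurable \<gamma>"
    unfolding measurable_cong_sets[OF s refl]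
    by (auto intro!: borel_measurable_continuous_onI continuous_intros)
qed

lemma couplings_nonempty:
  fixes \<mu> \<nu> :: "'a::euclidean_space measure"
  assumes "\<mu> \<in> prob_p p" "\<nu> \<in> prob_p p"
  shows "couplings \<mu> \<nu> \<noteq> {}"
proof -
  interpret a: prob_space \<mu> using prob_pD[OF assms(1)] by simp
  interpret b: prob_space \<nu> using prob_pD[OF assms(2)] by simp
  interpret pair_prob_space \<mu> \<nu> ..
  have s: "sets \<mu> = sets borel" "sets \<nu> = sets borel"
    using prob_pD(2)[OF assms(1)] prob_pD(2)[OF assms(2)] .
  have "sets (\<mu> \<Otimes>\<^sub>M \<nu>) = sets borel"
    using sets_pair_measure_cong[OF s] unfolding borel_prod .
  moreover have "distr (\<mu> \<Otimes>\<^sub>M \<nu>) borel fst = distr (\<mu> \<Otimes>\<^sub>M \<nu>) \<mu> fst"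
    "distr (\<mu> \<Otimes>\<^sub>M \<nu>) borel snd = distr (\<mu> \<Otimes>\<^sub>M \<nu>) \<nu> snd"
    using s by (auto intro: distr_cong)
  moreover have "distr (\<mu> \<Otimes>\<^sub>M \<nu>) \<nu> snd = \<nu>"
  proof -
    interpret ba: pair_prob_space \<nu> \<mu> ..
    have "distr (\<mu> \<Otimes>\<^sub>M \<nu>) \<nu> snd = distr (distr (\<nu> \<Otimes>\<^sub>M \<mu>) (\<mu> \<Otimes>\<^sub>M \<nu>) (\<lambda>(x, y). (y, x))) \<nu> snd"
      by (subst distr_pair_swap) simp
    also have "\<dots> = distr (\<nu> \<Otimes>\<^sub>M \<mu>) \<nu> fst"
      by (subst distr_distr) (auto simp: comp_def case_prod_beta')
    finally show ?thesis by (simp add: a.distr_pair_fst)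
  qed
  ultimately have "\<mu> \<Otimes>\<^sub>M \<nu> \<in> couplings \<mu> \<nu>"
    by (auto simp: couplings_def b.distr_pair_fst prob_space_axioms)
  then show ?thesis by blast
qed

lemma wasserstein_nonneg:
  assumes "\<mu> \<in> prob_p p" "\<nu> \<in> prob_p p"
  shows "0 \<le> wasserstein p \<mu> \<nu>"
  unfolding wasserstein_def by (intro cINF_greatest couplings_nonempty[OF assms]) simp

lemma wasserstein_le:
  assumes "\<gamma> \<in> couplings \<mu> \<nu>"
  shows "wasserstein p \<mu> \<nu> \<le> (LINT z|\<gamma>. norm (snd z - fst z) powr p) powr (1 / p)"
  unfolding wasserstein_def by (intro cINF_lower bdd_belowI2[of _ 0] assms) simp

lemma coupling_integrable:
  fixes \<mu> \<nu> :: "'a::euclidean_space measure"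
  assumes p: "1 < p" and "\<mu> \<in> prob_p p" "\<nu> \<in> prob_p p" "\<gamma> \<in> couplings \<mu> \<nu>"
  shows "integrable \<gamma> (\<lambda>z. norm (snd z - fst z) powr p)"
proof -
  note g = couplingsD[OF assms(4)]
  note [measurable] = g(5,6)
  have "integrable (distr \<gamma> borel fst) (\<lambda>x. norm x powr p)" "integrable (distr \<gamma> borel snd) (\<lambda>x. norm x powr p)"
    unfolding g(3,4) by (rule prob_pD(3)[OF assms(2)], rule prob_pD(3)[OF assms(3)])
  then have "integrable \<gamma> (\<lambda>z. norm (fst z) powr p)" "integrable \<gamma> (\<lambda>z. norm (snd z) powr p)"
    using integrable_distr_eq[OF g(5), of "\<lambda>x. norm x powr p"] integrable_distr_eq[OF g(6), of "\<lambda>x. norm x powr p"]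
    by simp_all
  then have "integrable \<gamma> (\<lambda>z. 2 powr p * (norm (snd z) powr p + norm (fst z) powr p))"
    by simp
  then show ?thesis
  proof (rule Bochner_Integration.integrable_bound)
    show "AE z in \<gamma>. norm (norm (snd z - fst z) powr p) \<le> norm (2 powr p * (norm (snd z) powr p + norm (fst z) powr p))"
      using norm_add_powr_le[OF p, of "snd _" "- fst _"] by (auto intro!: AE_I2)
  qed measurable
qed

text \<open>A coupling that is optimal up to \<open>\<theta>\<close> takes the place of an optimal
  one; the surplus disappears in a limit in \<open>one_step_taylor\<close>.\<close>

lemma wasserstein_coupling:
  fixes \<mu> \<nu> :: "'a::euclidean_space measure"
  assumes p: "1 < p" and \<mu>: "\<mu> \<in> prob_p p" and \<nu>: "\<nu> \<in> prob_p p" and \<theta>: "0 < \<theta>"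
  obtains \<gamma> where "\<gamma> \<in> couplings \<mu> \<nu>"
    "(LINT z|\<gamma>. norm (snd z - fst z) powr p) \<le> (wasserstein p \<mu> \<nu> + \<theta>) powr p"
proof -
  have "\<exists>x\<in>(\<lambda>\<gamma>. (LINT z|\<gamma>. norm (snd z - fst z) powr p) powr (1 / p)) ` couplings \<mu> \<nu>.
      x < wasserstein p \<mu> \<nu> + \<theta>"
    using couplings_nonempty[OF \<mu> \<nu>] \<theta> by (intro cInf_lessD) (auto simp: wasserstein_def)
  then obtain \<gamma> where \<gamma>: "\<gamma> \<in> couplings \<mu> \<nu>"
    and l: "(LINT z|\<gamma>. norm (snd z - fst z) powr p) powr (1 / p) < wasserstein p \<mu> \<nu> + \<theta>" by blast
  let ?I = "LINT z|\<gamma>. norm (snd z - fst z) powr p"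
  have "0 \<le> ?I" by simp
  then have "?I = (?I powr (1 / p)) powr p" using p by (simp add: powr_powr)
  also have "\<dots> \<le> (wasserstein p \<mu> \<nu> + \<theta>) powr p"
    using l p by (intro powr_mono2) auto
  finally show ?thesis using \<gamma> that by blast
qed

text \<open>The coupling that moves every point by the same \<open>z\<close> has cost
  \<open>norm z\<close>. This turns shifts of \<open>\<mu> t\<close> into competitors in the
  one-step supremum.\<close>

lemma
  fixes \<mu> :: "'a::euclidean_space measure" and z :: 'a
  assumes p: "1 < p" and \<mu>: "\<mu> \<in> prob_p p"
  defines "\<nu> \<equiv> distr \<mu> borel (\<lambda>y. y + z)"
  shows translate_prob_p: "\<nu> \<in> prob_p p"
    and wasserstein_translate: "wasserstein p \<mu> \<nu> \<le> norm z"
    and avg_translate: "ucb g \<Longrightarrow> avg \<nu> g x = avg \<mu> g (x + z)"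
proof -
  note m = prob_pD[OF \<mu>]
  interpret prob_space \<mu> by (rule m)
  note [measurable_cong, simp] = m(2)
  have "integrable \<mu> (\<lambda>y. 2 powr p * (norm y powr p + norm z powr p))"
    using m(3) by simp
  then have "integrable \<mu> (\<lambda>y. norm (y + z) powr p)"
    by (rule Bochner_Integration.integrable_bound) (auto intro!: AE_I2 norm_add_powr_le[OF p])
  then show "\<nu> \<in> prob_p p"
    by (auto simp: \<nu>_def prob_p_def integrable_distr_eq intro!: prob_space_distr)
  show "avg \<nu> g x = avg \<mu> g (x + z)" if "ucb g"
    using ucb_measurable[OF that] by (simp add: avg_def \<nu>_def integral_distr add_ac)
  define \<gamma> where "\<gamma> = distr \<mu> borel (\<lambda>y. (y, y + z))"
  have pair [measurable]: "(\<lambda>y. (y, y + z)) \<in> measurable \<mu> borel"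
    unfolding measurable_cong_sets[OF m(2) refl]
    by (auto intro!: borel_measurable_continuous_onI continuous_intros)
  have [measurable]: "fst \<in> borel_measurable (borel :: ('a \<times> 'a) measure)" "snd \<in> borel_measurable (borel :: ('a \<times> 'a) measure)"
    by (auto intro!: borel_measurable_continuous_onI continuous_intros)
  have "distr \<mu> borel (\<lambda>y. y) = \<mu>" by (rule distr_id2) simp
  then have "\<gamma> \<in> couplings \<mu> \<nu>"
    by (auto simp: couplings_def \<gamma>_def \<nu>_def distr_distr comp_def intro!: prob_space_distr)
  then have "wasserstein p \<mu> \<nu> \<le> (LINT z|\<gamma>. norm (snd z - fst z) powr p) powr (1 / p)"
    by (rule wasserstein_le)
  also have "(LINT z|\<gamma>. norm (snd z - fst z) powr p) = norm z powr p"
    unfolding \<gamma>_def by (subst integral_distr) (auto simp: prob_space)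
  also have "\<dots> powr (1 / p) = norm z" using p by (simp add: powr_powr)
  finally show "wasserstein p \<mu> \<nu> \<le> norm z" .
qed

text \<open>The remainder is quadratic for small and linear for large increments, so that bounded kernels
  produce such functions and the error is integrable against every coupling in the class.\<close>

definition taylor :: "real \<Rightarrow> ('a::euclidean_space \<Rightarrow> real) \<Rightarrow> ('a \<Rightarrow> 'a) \<Rightarrow> bool" where
  "taylor C g D \<longleftrightarrow> (\<forall>x. norm (D x) \<le> C) \<and>
     (\<forall>x y z. \<bar>g (x + y + z) - g (x + y) - D x \<bullet> z\<bar> \<le> C * norm z * min 1 (norm y + norm z))"

text \<open>In the variable \<open>x = a powr p\<close> the penalty is convex and 0 at the origin,
  so beyond a point with a positive value it lies above the line through the origin determined by
  any smaller positive value there. Nonconstancy supplies the point.\<close>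

lemma convex_power_growth:
  fixes \<phi> :: "real \<Rightarrow> ereal"
  assumes p: "1 < p" and nn: "\<And>x. 0 \<le> x \<Longrightarrow> 0 \<le> \<phi> x" and nc: "\<not> \<phi> constant_on {0..}" and z: "\<phi> 0 = 0"
    and cv: "convex_nonneg (\<lambda>x. \<phi> (x powr (1 / p)))"
  obtains c C where "0 < c" "0 \<le> C" "\<And>a. 0 \<le> a \<Longrightarrow> ereal (c * a powr p - C) \<le> \<phi> a"
proof -
  obtain a0 where a0: "0 \<le> a0" "\<phi> a0 \<noteq> 0"
    using nc z unfolding constant_on_def by (metis atLeast_iff)
  \<comment> \<open>Truncated at 1, since \<open>\<phi> a0\<close> may be infinite.\<close>
  define m where "m = real_of_ereal (min 1 (\<phi> a0))"
  have m: "0 < m" "ereal m \<le> \<phi> a0"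
    using nn[OF a0(1)] a0(2) unfolding m_def by (cases "\<phi> a0"; auto simp: min_def one_ereal_def)+
  define x0 where "x0 = a0 powr p"
  have x0: "0 < x0" using a0 z by (auto simp: x0_def)
  have "ereal (m / x0 * a powr p - m) \<le> \<phi> a" if a: "0 \<le> a" for a
  proof (cases "a powr p \<le> x0")
    case True
    then have "m / x0 * a powr p \<le> m / x0 * x0" using m x0 by (intro mult_left_mono) auto
    then have "ereal (m / x0 * a powr p - m) \<le> 0" using x0 by (simp add: zero_ereal_def)
    then show ?thesis using nn[OF a] by (rule order.trans)
  next
    case False
    define X where "X = a powr p"
    have X: "x0 < X" using False by (simp add: X_def)
    have e1: "X powr (1 / p) = a" "x0 powr (1 / p) = a0"
      using p a a0 by (simp_all add: X_def x0_def powr_powr)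
    have "\<phi> (((1 - x0 / X) * 0 + x0 / X * X) powr (1 / p))
      \<le> ereal (1 - x0 / X) * \<phi> (0 powr (1 / p)) + ereal (x0 / X) * \<phi> (X powr (1 / p))"
      by (rule cv[unfolded convex_nonneg_def, rule_format]) (use X x0 in auto)
    then have "\<phi> a0 \<le> ereal (x0 / X) * \<phi> a" using X x0 z e1 by simp
    then have "ereal m \<le> ereal (x0 / X) * \<phi> a" using m(2) by simp
    then have "ereal (m / x0 * X - m) \<le> \<phi> a"
    proof (cases "\<phi> a")
      case (real r)
      then have "m \<le> x0 / X * r" using \<open>ereal m \<le> ereal (x0 / X) * \<phi> a\<close> by simp
      then have "m / x0 * X \<le> r" using X x0 by (simp add: field_simps)
      then show ?thesis using real m(1) by simp
    qed (use \<open>ereal m \<le> ereal (x0 / X) * \<phi> a\<close> X x0 in auto)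
    then show ?thesis by (simp add: X_def)
  qed
  then show ?thesis using that[of "m / x0" m] m x0 by simp
qed

text \<open>\<open>growth\<close> with the constants of \<open>convex_power_growth\<close> is the
  form in which convexity in the \<open>p\<close>-th power enters the estimates.\<close>

locale wasserstein_perturbation = conv_semigroup \<mu>
  for \<mu> :: "real \<Rightarrow> 'a::euclidean_space measure" +
  fixes p :: real and \<phi> :: "real \<Rightarrow> ereal" and c0 k0 :: real
  assumes p: "1 < p"
    and moments: "0 \<le> t \<Longrightarrow> \<mu> t \<in> prob_p p"
    and phi_nonneg: "0 \<le> a \<Longrightarrow> 0 \<le> \<phi> a"
    and phi_convex: "convex_nonneg \<phi>"
    and phi_mono: "mono_on {0..} \<phi>"
    and phi_0: "\<phi> 0 = 0"
    and growth: "0 < c0" "0 \<le> k0" "0 \<le> a \<Longrightarrow> ereal (c0 * a powr p - k0) \<le> \<phi> a"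
begin

definition W :: "'a set" where "W = {w. \<phi> (norm w) < \<infinity>}"

definition \<rho> :: "'a \<Rightarrow> real" where "\<rho> w = real_of_ereal (\<phi> (norm w))"

lemma phi_norm: "w \<in> W \<Longrightarrow> \<phi> (norm w) = ereal (\<rho> w)"
  using phi_nonneg[of "norm w"] by (cases "\<phi> (norm w)") (auto simp: W_def \<rho>_def)

lemma phi_norm_convex:
  assumes "x \<in> W" "y \<in> W" "0 \<le> s" "s \<le> 1"
  shows "(1 - s) *\<^sub>R x + s *\<^sub>R y \<in> W" "\<rho> ((1 - s) *\<^sub>R x + s *\<^sub>R y) \<le> (1 - s) * \<rho> x + s * \<rho> y"
proof -
  let ?z = "(1 - s) *\<^sub>R x + s *\<^sub>R y"
  have "norm ?z \<le> (1 - s) * norm x + s * norm y"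
    using norm_triangle_ineq[of "(1 - s) *\<^sub>R x" "s *\<^sub>R y"] assms by simp
  then have "\<phi> (norm ?z) \<le> \<phi> ((1 - s) * norm x + s * norm y)"
    by (intro mono_onD[OF phi_mono]) (auto intro: order.trans[OF norm_ge_zero])
  also have "\<dots> \<le> ereal (1 - s) * \<phi> (norm x) + ereal s * \<phi> (norm y)"
    using phi_convex assms unfolding convex_nonneg_def by auto
  also have "\<dots> = ereal ((1 - s) * \<rho> x + s * \<rho> y)"
    using phi_norm assms by simp
  finally have *: "\<phi> (norm ?z) \<le> ereal ((1 - s) * \<rho> x + s * \<rho> y)" .
  then show z: "?z \<in> W" by (auto simp: W_def intro: order.strict_trans1)
  show "\<rho> ?z \<le> (1 - s) * \<rho> x + s * \<rho> y"
    using * unfolding phi_norm[OF z] by simp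
qed

lemma growth_rho: "w \<in> W \<Longrightarrow> c0 * norm w powr p - k0 \<le> \<rho> w"
  using growth(3)[of "norm w"] phi_norm by simp

lemma hopf_lax_W: "hopf_lax W \<rho>"
proof
  show "0 \<in> W" "\<rho> 0 = 0" by (auto simp: W_def \<rho>_def phi_0)
  show "0 \<le> \<rho> w" if "w \<in> W" for w
    using phi_nonneg[of "norm w"] phi_norm[OF that] by simp
  have "convex W" using phi_norm_convex(1) by (simp add: convex_alt)
  then show "convex_on W \<rho>"
    by (rule convex_onI[rotated]) (use phi_norm_convex(2) in auto)
  fix N :: real
  \<comment> \<open>Here \<open>(\<bar>N\<bar> + 1) * e = c0\<close>, so that from the threshold
    \<open>M\<close> on the growth term \<open>c0 * norm w powr p\<close> dominates the linear
    one.\<close>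
  define e where "e = c0 / (\<bar>N\<bar> + 1)"
  define M where "M = e powr (- 1 / (p - 1))"
  have e: "0 < e" using growth by (simp add: e_def)
  have "N * norm w - (k0 + (\<bar>N\<bar> + 1) * M) \<le> \<rho> w" if w: "w \<in> W" for w
  proof -
    have M: "0 \<le> M" by (simp add: M_def)
    have "(\<bar>N\<bar> + 1) * norm w \<le> c0 * norm w powr p + (\<bar>N\<bar> + 1) * M"
    proof (cases "M \<le> norm w")
      case True
      then have "norm w \<le> e * norm w powr p" using le_powr[OF p e] by (simp add: M_def)
      then have "(\<bar>N\<bar> + 1) * norm w \<le> (\<bar>N\<bar> + 1) * (e * norm w powr p)" by (intro mult_left_mono) auto
      also have "\<dots> = c0 * norm w powr p" by (simp add: e_def)
      finally show ?thesis using mult_nonneg_nonneg[OF _ M, of "\<bar>N\<bar> + 1"] by linarith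
    next
      case False
      then have "(\<bar>N\<bar> + 1) * norm w \<le> (\<bar>N\<bar> + 1) * M" by (intro mult_left_mono) auto
      moreover have "0 \<le> c0 * norm w powr p" using growth by simp
      ultimately show ?thesis by linarith
    qed
    moreover have "N * norm w \<le> (\<bar>N\<bar> + 1) * norm w" by (intro mult_right_mono) auto
    ultimately show ?thesis using growth_rho[OF w] by linarith
  qed
  then show "\<exists>C. \<forall>w\<in>W. N * norm w - C \<le> \<rho> w" by blast
qed

sublocale levy_hopf_lax \<mu> W \<rho>
  using hopf_lax_W conv_semigroup_axioms by (simp add: levy_hopf_lax_def)

lemma ex_direction:
  assumes "0 \<le> a"
  obtains w :: 'a where "norm w = a" "D \<bullet> w = norm D * a"
proof (cases "D = 0")
  case True
  obtain u :: 'a where "norm u = a" using vector_choose_size[OF assms] by blast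
  then show ?thesis using True that by simp
next
  case False
  then show ?thesis using that[of "(a / norm D) *\<^sub>R D"] assms
    by (simp add: power2_norm_eq_inner[symmetric] power2_eq_square)
qed

text \<open>The penalty is radial, and among velocities of given length one parallel to
  \<open>D\<close> maximises \<open>D \<bullet> w\<close>, so the transform on the state space
  reduces to the scalar conjugate. In particular the latter is finite.\<close>

lemma conjugate_norm: "conjugate \<phi> (norm D) = ereal (legendre D)"
proof (rule antisym)
  show "conjugate \<phi> (norm D) \<le> ereal (legendre D)"
    unfolding conjugate_def
  proof (rule SUP_least)
    fix a :: real assume "a \<in> {0..}"
    then obtain w where w: "norm w = a" "D \<bullet> w = norm D * a" using ex_direction by (metis atLeast_iff)
    show "ereal (a * norm D) - \<phi> a \<le> ereal (legendre D)"
    proof (cases "w \<in> W")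
      case True
      have "\<phi> a = ereal (\<rho> w)" using phi_norm[OF True] w by simp
      then show ?thesis using legendre_upper[OF True, of D] w by (simp add: mult.commute)
    next
      case False
      then have "\<phi> a = \<infinity>" using w by (auto simp: W_def)
      then show ?thesis by simp
    qed
  qed
  have le: "ereal (D \<bullet> w - \<rho> w) \<le> conjugate \<phi> (norm D)" if "w \<in> W" for w
  proof -
    have "ereal (D \<bullet> w - \<rho> w) \<le> ereal (norm w * norm D) - \<phi> (norm w)"
      using norm_cauchy_schwarz[of D w] phi_norm[OF that] by (simp add: mult.commute)
    also have "\<dots> \<le> conjugate \<phi> (norm D)"
      unfolding conjugate_def by (rule SUP_upper) simp
    finally show ?thesis .
  qed
  show "ereal (legendre D) \<le> conjugate \<phi> (norm D)"
  proof (cases "conjugate \<phi> (norm D)")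
    case (real r)
    then have "legendre D \<le> r" using le by (intro legendre_least) simp
    then show ?thesis using real by simp
  qed (use le[OF zero_W] in auto)
qed

end

section \<open>One-step estimates\<close>

text \<open>\<open>mono_op\<close> only tests an operator on \<open>ucb\<close> functions, and on
  these \<open>one_step\<close> is identified with a real supremum.\<close>

lemma mono_op_cong:
  assumes T: "mono_op T" and eq: "\<And>g x. ucb g \<Longrightarrow> T' g x = T g x"
  shows "mono_op T'"
proof -
  have eq: "T' g = T g" if "ucb g" for g using eq[OF that] by auto
  show ?thesis
    unfolding mono_op_def
  proof (intro conjI allI impI)
    show "T' (\<lambda>_. 0) = (\<lambda>_. 0)" using T by (simp add: mono_op_def eq)
  next
    fix f g :: "'a \<Rightarrow> real" assume "ucb f" "ucb g" "f \<le> g"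
    then show "T' f \<le> T' g" using T by (simp add: mono_op_def eq)
  next
    fix f :: "'a \<Rightarrow> real" and c assume f: "ucb f"
    then show "T' (\<lambda>x. f x + c) = (\<lambda>x. T' f x + c)"
      using T eq[OF ucb_add[OF f ucb_const]] eq[OF f] by (simp add: mono_op_def)
  next
    fix f :: "'a \<Rightarrow> real" and z assume f: "ucb f"
    then show "T' (\<lambda>x. f (x + z)) = (\<lambda>x. T' f (x + z))"
      unfolding eq[OF ucb_shift[OF f]] eq[OF f] using mono_op_shift[OF T f] by auto
  qed
qed

section \<open>The one-step operator as a supremum over measures of finite penalty\<close>

context wasserstein_perturbation
begin

abbreviation P :: "real \<Rightarrow> ('a \<Rightarrow> real) \<Rightarrow> 'a \<Rightarrow> real" where
  "P \<equiv> one_step p \<mu> \<phi>"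

definition feasible :: "real \<Rightarrow> 'a measure set" where
  "feasible t = {\<nu> \<in> prob_p p. scaled \<phi> t (wasserstein p (\<mu> t) \<nu>) < \<infinity>}"

definition cost :: "real \<Rightarrow> 'a measure \<Rightarrow> real" where
  "cost t \<nu> = real_of_ereal (scaled \<phi> t (wasserstein p (\<mu> t) \<nu>))"

lemma scaled_nonneg:
  assumes "0 \<le> t" "\<nu> \<in> prob_p p"
  shows "0 \<le> scaled \<phi> t (wasserstein p (\<mu> t) \<nu>)"
  using assms wasserstein_nonneg[OF moments assms(2)] phi_nonneg by (auto simp: scaled_def)

lemma cost_eq:
  assumes "0 \<le> t" "\<nu> \<in> feasible t"
  shows "scaled \<phi> t (wasserstein p (\<mu> t) \<nu>) = ereal (cost t \<nu>)" "0 \<le> cost t \<nu>"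
  using scaled_nonneg[of t \<nu>] assms
  by (cases "scaled \<phi> t (wasserstein p (\<mu> t) \<nu>)"; auto simp: feasible_def cost_def)+

lemma translate_feasible:
  assumes t: "0 \<le> t" and w: "w \<in> W"
  shows "distr (\<mu> t) borel (\<lambda>y. y + t *\<^sub>R w) \<in> feasible t"
    "cost t (distr (\<mu> t) borel (\<lambda>y. y + t *\<^sub>R w)) \<le> t * \<rho> w"
proof -
  let ?\<nu> = "distr (\<mu> t) borel (\<lambda>y. y + t *\<^sub>R w)"
  note m = moments[OF t]
  have \<nu>: "?\<nu> \<in> prob_p p" by (rule translate_prob_p[OF p m])
  have Wle: "wasserstein p (\<mu> t) ?\<nu> \<le> t * norm w"
    using wasserstein_translate[OF p m, of "t *\<^sub>R w"] t by simp
  have W0: "0 \<le> wasserstein p (\<mu> t) ?\<nu>" by (rule wasserstein_nonneg[OF m \<nu>])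
  have le: "scaled \<phi> t (wasserstein p (\<mu> t) ?\<nu>) \<le> ereal (t * \<rho> w)"
  proof (cases "t = 0")
    case True
    then show ?thesis using Wle W0 by (simp add: scaled_def)
  next
    case False
    then have "\<phi> (wasserstein p (\<mu> t) ?\<nu> / t) \<le> \<phi> (norm w)"
      using Wle W0 t by (intro mono_onD[OF phi_mono]) (auto simp: field_simps)
    then have "ereal t * \<phi> (wasserstein p (\<mu> t) ?\<nu> / t) \<le> ereal t * ereal (\<rho> w)"
      using t unfolding phi_norm[OF w] by (intro ereal_mult_left_mono) auto
    then show ?thesis using False by (simp add: scaled_def)
  qed
  then show f: "?\<nu> \<in> feasible t" using \<nu> by (auto simp: feasible_def intro: order.strict_trans1)
  show "cost t ?\<nu> \<le> t * \<rho> w" using le unfolding cost_eq(1)[OF t f] by simp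
qed

lemma mu_feasible:
  assumes t: "0 \<le> t"
  shows "\<mu> t \<in> feasible t" "cost t (\<mu> t) = 0"
proof -
  have "distr (\<mu> t) borel (\<lambda>y. y + t *\<^sub>R 0) = \<mu> t"
    using distr_id2[OF sets_mu[OF t, symmetric]] by simp
  then show f: "\<mu> t \<in> feasible t" and "cost t (\<mu> t) = 0"
    using translate_feasible[OF t zero_W] cost_eq(2)[OF t, of "\<mu> t"] rho_0 by simp_all
qed

lemma feasibleD:
  assumes "\<nu> \<in> feasible t"
  shows "prob_space \<nu>" "sets \<nu> = sets borel" "\<nu> \<in> prob_p p"
  using assms by (auto simp: feasible_def prob_p_def)

text \<open>An infinite penalty contributes the value minus infinity to the extended supremum and
  drops out. What remains is a real supremum over a family containing the free competitor
  \<open>\<mu> t\<close>, so \<open>mono_op_SUP\<close> applies.\<close>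

lemma
  assumes t: "0 \<le> t"
  shows avg_le_one_step: "ucb g \<Longrightarrow> \<nu> \<in> feasible t \<Longrightarrow> avg \<nu> g x - cost t \<nu> \<le> P t g x"
    and one_step_eq: "ucb g \<Longrightarrow> P t g x = (SUP \<nu>\<in>feasible t. avg \<nu> g x - cost t \<nu>)"
    and mono_op_one_step: "mono_op (P t)"
proof -
  have A: "mono_op (avg \<nu>)" if "\<nu> \<in> feasible t" for \<nu>
    using mono_op_avg feasibleD[OF that] by blast
  note c = cost_eq(2)[OF t]
  let ?T = "\<lambda>g x. SUP \<nu>\<in>feasible t. avg \<nu> g x - cost t \<nu>"
  have upper: "avg \<nu> g x - cost t \<nu> \<le> ?T g x" if "ucb g" "\<nu> \<in> feasible t" for \<nu> g x
    by (rule mono_op_SUP_upper[OF A c that])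
  show eq: "P t g x = ?T g x" if g: "ucb g" for g x
  proof -
    let ?F = "\<lambda>\<nu>. ereal (LINT y|\<nu>. g (x + y)) - scaled \<phi> t (wasserstein p (\<mu> t) \<nu>)"
    have F: "?F \<nu> = ereal (avg \<nu> g x - cost t \<nu>)" if "\<nu> \<in> feasible t" for \<nu>
      using cost_eq(1)[OF t that] by (simp add: avg_def)
    have "(SUP \<nu>\<in>prob_p p. ?F \<nu>) = ereal (?T g x)"
    proof (rule antisym)
      show "(SUP \<nu>\<in>prob_p p. ?F \<nu>) \<le> ereal (?T g x)"
      proof (rule SUP_least)
        fix \<nu> :: "'a measure" assume \<nu>: "\<nu> \<in> prob_p p"
        show "?F \<nu> \<le> ereal (?T g x)"
        proof (cases "\<nu> \<in> feasible t")
          case True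
          then show ?thesis using F upper[OF g True] by simp
        next
          case False
          then have "scaled \<phi> t (wasserstein p (\<mu> t) \<nu>) = \<infinity>" using \<nu> by (auto simp: feasible_def)
          then show ?thesis by simp
        qed
      qed
      have le: "ereal (avg \<nu> g x - cost t \<nu>) \<le> (SUP \<nu>\<in>prob_p p. ?F \<nu>)" if "\<nu> \<in> feasible t" for \<nu>
        unfolding F[OF that, symmetric] by (rule SUP_upper) (rule feasibleD(3)[OF that])
      show "ereal (?T g x) \<le> (SUP \<nu>\<in>prob_p p. ?F \<nu>)"
      proof (cases "SUP \<nu>\<in>prob_p p. ?F \<nu>")
        case (real r)
        then have "?T g x \<le> r" using le mu_feasible(1)[OF t] by (intro cSUP_least) auto
        then show ?thesis using real by simp
      qed (use le[OF mu_feasible(1)[OF t]] in auto)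
    qed
    then show ?thesis by (simp add: one_step_def)
  qed
  then show "avg \<nu> g x - cost t \<nu> \<le> P t g x" if "ucb g" "\<nu> \<in> feasible t" for \<nu> g x
    using upper[OF that] that by simp
  have "mono_op ?T"
    by (rule mono_op_SUP[where A = avg and c = "cost t" and ?i0.0 = "\<mu> t", OF A c mu_feasible[OF t]])
  then show "mono_op (P t)"
    by (rule mono_op_cong) (rule eq)
qed

lemma L_le_one_step:
  assumes t: "0 \<le> t" and g: "ucb g"
  shows "L t g x \<le> P t g x"
  unfolding L_def
proof (rule H_least)
  fix w assume w: "w \<in> W"
  show "S t g (x + t *\<^sub>R w) - t * \<rho> w \<le> P t g x"
    using avg_le_one_step[OF t g translate_feasible(1)[OF t w], of x] translate_feasible(2)[OF t w]
      avg_translate[OF p moments[OF t] g, of "t *\<^sub>R w" x] by linarith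
qed

text \<open>\<open>g\<close> is expanded along the coupling with the slope \<open>D x\<close> frozen
  at the base point, so the first-order gain is at most \<open>norm (D x) * b\<close>. The error is
  a small multiple of \<open>(b / t) powr p\<close>, plus terms governed by \<open>r\<close> and by
  the mass outside the ball of radius \<open>r\<close>. The first, crude claim serves
  \<open>t = 0\<close>.\<close>

lemma taylor_step_coupling:
  assumes t: "0 \<le> t" and \<nu>: "\<nu> \<in> prob_p p" and \<gamma>: "\<gamma> \<in> couplings (\<mu> t) \<nu>"
    and cst: "(LINT z|\<gamma>. norm (snd z - fst z) powr p) \<le> b powr p" and b: "0 < b"
    and g: "ucb g" and T: "taylor C g D" and C: "0 < C"
  shows "avg \<nu> g x \<le> avg (\<mu> t) g x + 2 * C * b"
    and "0 < r \<Longrightarrow> 0 < \<epsilon> \<Longrightarrow> 0 < t \<Longrightarrow> t * \<epsilon> powr (- 1 / (p - 1)) \<le> r \<Longrightarrow> avg \<nu> g x \<le> avg (\<mu> t) g x +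
      t * (norm (D x) * (b / t) + (2 * C * r + C * \<epsilon>) * (b / t) powr p + 2 * C * r
        + C * \<epsilon> powr (- 1 / (p - 1)) * measure (\<mu> t) {y. r < norm y})"
proof -
  note gm = couplingsD[OF \<gamma>]
  note [measurable] = gm(5,6) ucb_measurable[OF g]
  interpret prob_space \<gamma> by (rule gm)
  let ?d = "\<lambda>z. norm (snd z - fst z)"
  have dp: "integrable \<gamma> (\<lambda>z. ?d z powr p)" by (rule coupling_integrable[OF p moments[OF t] \<nu> \<gamma>])
  have d: "integrable \<gamma> ?d" "(LINT z|\<gamma>. ?d z) \<le> b"
    by (rule expectation_le_powr[OF p b _ dp _ cst]; simp)+
  obtain B where B: "\<And>x. \<bar>g x\<bar> \<le> B" using ucb_bound[OF g] by metis
  have i1: "integrable \<gamma> (\<lambda>z. g (x + fst z))" "integrable \<gamma> (\<lambda>z. g (x + snd z))"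
    by (rule integrable_const_bound[where B = B]; simp add: B)+
  have "avg \<nu> g x = (LINT z|\<gamma>. g (x + snd z))" "avg (\<mu> t) g x = (LINT z|\<gamma>. g (x + fst z))"
    unfolding avg_def gm(3)[symmetric] gm(4)[symmetric] by (subst integral_distr; simp)+
  then have diff: "avg \<nu> g x - avg (\<mu> t) g x = (LINT z|\<gamma>. g (x + snd z) - g (x + fst z))"
    using i1 by simp
  have pt: "g (x + snd z) - g (x + fst z) \<le> norm (D x) * ?d z + C * ?d z * min 1 (norm (fst z) + ?d z)" for z :: "'a \<times> 'a"
  proof -
    have "\<bar>g (x + fst z + (snd z - fst z)) - g (x + fst z) - D x \<bullet> (snd z - fst z)\<bar>
        \<le> C * ?d z * min 1 (norm (fst z) + ?d z)"
      using T unfolding taylor_def by blast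
    moreover have "D x \<bullet> (snd z - fst z) \<le> norm (D x) * ?d z" by (rule norm_cauchy_schwarz)
    ultimately show ?thesis by simp
  qed
  have DC: "norm (D x) \<le> C" using T by (simp add: taylor_def)
  have "avg \<nu> g x - avg (\<mu> t) g x \<le> (LINT z|\<gamma>. 2 * C * ?d z)"
    unfolding diff
  proof (rule integral_mono)
    fix z :: "'a \<times> 'a"
    have "norm (D x) * ?d z \<le> C * ?d z" using DC by (intro mult_right_mono) auto
    moreover have "C * ?d z * min 1 (norm (fst z) + ?d z) \<le> C * ?d z * 1"
      using C by (intro mult_left_mono) auto
    ultimately show "g (x + snd z) - g (x + fst z) \<le> 2 * C * ?d z" using pt[of z] by linarith
  qed (use i1 d in auto)
  also have "\<dots> \<le> 2 * C * b" using d C by simp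
  finally show "avg \<nu> g x \<le> avg (\<mu> t) g x + 2 * C * b" by simp
  assume r: "0 < r" and e: "0 < \<epsilon>" and tp: "0 < t" and tr: "t * \<epsilon> powr (- 1 / (p - 1)) \<le> r"
  define M where "M = \<epsilon> powr (- 1 / (p - 1))"
  have M: "0 < M" using e by (simp add: M_def)
  define q where "q = 2 * C * r + C * \<epsilon>"
  let ?G = "\<lambda>z. norm (D x) * ?d z + t * (q * (?d z / t) powr p + 2 * C * r + C * M * indicator {y. r < norm y} (fst z))"
  \<comment> \<open>Three cases, with the speed \<open>s = ?d z / t\<close>. If the noise
    \<open>fst z\<close> exceeds \<open>r\<close>, the indicator pays for \<open>M\<close>. If only
    the displacement exceeds \<open>r\<close>, then \<open>tr\<close> gives
    \<open>M \<le> s\<close>, and the power absorbs the linear term. Otherwise the minimum is at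
    most \<open>2 * r\<close>.\<close>
  have key: "C * ?d z * min 1 (norm (fst z) + ?d z)
      \<le> t * (q * (?d z / t) powr p + 2 * C * r + C * M * indicator {y. r < norm y} (fst z))" for z :: "'a \<times> 'a"
  proof -
    define s where "s = ?d z / t"
    have s: "0 \<le> s" "?d z = t * s" using tp by (auto simp: s_def)
    have sp: "0 \<le> s powr p" by simp
    have young: "s \<le> \<epsilon> * s powr p + M"
    proof (cases "M \<le> s")
      case True
      then have "s \<le> \<epsilon> * s powr p" using le_powr[OF p e, of s] by (simp add: M_def)
      then show ?thesis using M by linarith
    next
      case False
      moreover have "0 \<le> \<epsilon> * s powr p" using e by simp
      ultimately show ?thesis by linarith
    qed
    have "C * s * min 1 (norm (fst z) + ?d z) \<le> q * s powr p + 2 * C * r + C * M * indicator {y. r < norm y} (fst z)"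
    proof (cases "r < norm (fst z)")
      case True
      have "C * s * min 1 (norm (fst z) + ?d z) \<le> C * s * 1"
        using C s by (intro mult_left_mono) auto
      also have "\<dots> \<le> C * (\<epsilon> * s powr p + M)" using C young by simp
      also have "\<dots> \<le> C * (\<epsilon> * s powr p + M) + 2 * C * r * s powr p + 2 * C * r" using C r by simp
      finally show ?thesis using True by (simp add: q_def algebra_simps)
    next
      case F: False
      show ?thesis
      proof (cases "r < ?d z")
        case True
        then have "t * M \<le> t * s" using tr unfolding M_def[symmetric] s(2) by simp
        then have "s \<le> \<epsilon> * s powr p" using le_powr[OF p e, of s] tp by (simp add: M_def)
        then have "C * s \<le> C * (\<epsilon> * s powr p)" using C by (intro mult_left_mono) auto
        moreover have "C * s * min 1 (norm (fst z) + ?d z) \<le> C * s * 1"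
          using C s by (intro mult_left_mono) auto
        moreover have "0 \<le> 2 * C * r * s powr p" "0 \<le> 2 * C * r" using C r by auto
        ultimately show ?thesis using F by (simp add: q_def algebra_simps)
      next
        case False
        have "s \<le> 1 + s powr p"
        proof (cases "1 \<le> s")
          case True then show ?thesis using powr_mono[of 1 p s] p by simp
        qed (use sp in linarith)
        have "C * s * min 1 (norm (fst z) + ?d z) \<le> C * s * (2 * r)"
          using C s F False by (intro mult_left_mono) auto
        also have "\<dots> = 2 * C * r * s" by simp
        also have "\<dots> \<le> 2 * C * r * (1 + s powr p)" using C r \<open>s \<le> 1 + s powr p\<close> by (intro mult_left_mono) auto
        also have "\<dots> \<le> 2 * C * r * (1 + s powr p) + C * \<epsilon> * s powr p" using C e by simp
        finally show ?thesis using F by (simp add: q_def algebra_simps)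
      qed
    qed
    then have "t * (C * s * min 1 (norm (fst z) + ?d z)) \<le>
       t * (q * s powr p + 2 * C * r + C * M * indicator {y. r < norm y} (fst z))"
      using tp by (intro mult_left_mono) auto
    moreover have "t * (C * s * min 1 (norm (fst z) + ?d z)) = C * ?d z * min 1 (norm (fst z) + ?d z)"
      unfolding s(2) by simp
    ultimately show ?thesis by (simp add: s_def)
  qed
  have G1: "(?d z / t) powr p = ?d z powr p / t powr p" for z :: "'a \<times> 'a"
    using tp by (simp add: powr_divide)
  have G2: "integrable \<gamma> (\<lambda>z. indicator {y. r < norm y} (fst z) :: real)"
    by (rule integrable_const_bound[where B = 1]) (auto simp: indicator_def)
  have "measure (\<mu> t) {y. r < norm y} = (LINT y|\<mu> t. indicator {y. r < norm y} y)"
    using prob_pD(2)[OF moments[OF t]] sets_eq_imp_space_eq[OF prob_pD(2)[OF moments[OF t]]] by simp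
  also have "\<dots> = (LINT z|\<gamma>. indicator {y. r < norm y} (fst z))"
    unfolding gm(3)[symmetric] by (subst integral_distr) auto
  finally have mass: "(LINT z|\<gamma>. indicator {y. r < norm y} (fst z)) = measure (\<mu> t) {y. r < norm y}" ..
  have "avg \<nu> g x - avg (\<mu> t) g x \<le> (LINT z|\<gamma>. ?G z)"
    unfolding diff
  proof (rule integral_mono)
    show "integrable \<gamma> ?G" unfolding G1 using d dp G2 by auto
    show "g (x + snd z) - g (x + fst z) \<le> ?G z" for z :: "'a \<times> 'a" using pt[of z] key[of z] by linarith
  qed (use i1 in auto)
  also have "\<dots> = norm (D x) * (LINT z|\<gamma>. ?d z) + t * (q * ((LINT z|\<gamma>. ?d z powr p) / t powr p) + 2 * C * r
       + C * M * measure (\<mu> t) {y. r < norm y})"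
    unfolding G1 using d dp G2 by (simp add: prob_space mass)
  also have "\<dots> \<le> norm (D x) * b + t * (q * (b powr p / t powr p) + 2 * C * r
       + C * M * measure (\<mu> t) {y. r < norm y})"
    using d cst C r e tp M by (intro add_mono mult_left_mono divide_right_mono) (auto simp: q_def)
  also have "\<dots> = t * (norm (D x) * (b / t) + q * (b / t) powr p + 2 * C * r
       + C * M * measure (\<mu> t) {y. r < norm y})"
  proof -
    have "t * (norm (D x) * (b / t)) = norm (D x) * b" "(b / t) powr p = b powr p / t powr p"
      using tp b by (simp_all add: powr_divide)
    then show ?thesis by (simp only: distrib_left)
  qed
  finally show "avg \<nu> g x \<le> avg (\<mu> t) g x +
      t * (norm (D x) * (b / t) + (2 * C * r + C * \<epsilon>) * (b / t) powr p + 2 * C * r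
        + C * \<epsilon> powr (- 1 / (p - 1)) * measure (\<mu> t) {y. r < norm y})"
    by (simp add: q_def M_def)
qed


text \<open>The speed \<open>a = V / t\<close> of a competitor is realised by a velocity
  \<open>w\<close> of length \<open>a\<close> parallel to \<open>D x\<close>: the penalty is then
  exactly \<open>t * \<rho> w\<close> and the first-order gain is
  \<open>t * (D x \<bullet> w)\<close>. The error \<open>\<kappa> * a powr p\<close> is at most
  \<open>e / 4\<close> for \<open>a \<le> R\<close> and is absorbed by the growth of the penalty for
  larger \<open>a\<close>.\<close>

lemma one_step_taylor:
  assumes C: "0 < C" and e: "0 < e"
  obtains h0 where "0 < h0" "\<And>t g D x. 0 \<le> t \<Longrightarrow> t < h0 \<Longrightarrow> ucb g \<Longrightarrow> taylor C g D \<Longrightarrow>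
    P t g x \<le> S t g x + t * (legendre (D x) + e)"
proof -
  \<comment> \<open>Here \<open>(C + k0) * e2 = c0 / 2\<close>: for speeds above \<open>R\<close>
    one half of the growth pays for the slope and for \<open>k0\<close>, the other half for
    \<open>\<kappa> * a powr p\<close>.\<close>
  define e2 where "e2 = (c0 / 2) / (C + k0)"
  define R where "R = max 1 (e2 powr (- 1 / (p - 1)))"
  define \<kappa> where "\<kappa> = min (c0 / 2) (min (e / (4 * R powr p)) (e / 2))"
  \<comment> \<open>\<open>2 * C * r\<close> and \<open>C * \<epsilon>\<close> are each
    \<open>\<kappa> / 2\<close>, so the coefficient of the power in
    \<open>taylor_step_coupling\<close> is exactly \<open>\<kappa>\<close>.\<close>
  define r where "r = \<kappa> / (4 * C)"
  define \<epsilon> where "\<epsilon> = \<kappa> / (2 * C)"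
  define M where "M = \<epsilon> powr (- 1 / (p - 1))"
  have e2: "0 < e2" using growth C by (simp add: e2_def)
  have R: "1 \<le> R" by (simp add: R_def)
  have "0 < R powr p" using R by simp
  then have \<kappa>: "0 < \<kappa>" "\<kappa> \<le> c0 / 2" "\<kappa> \<le> e / (4 * R powr p)" "\<kappa> \<le> e / 2"
    using growth e by (auto simp: \<kappa>_def)
  then have \<kappa>R: "\<kappa> * R powr p \<le> e / 4" using \<open>0 < R powr p\<close> by (simp add: field_simps)
  have r: "0 < r" and \<epsilon>: "0 < \<epsilon>" using \<kappa> C by (auto simp: r_def \<epsilon>_def)
  have q: "2 * C * r + C * \<epsilon> = \<kappa>" "2 * C * r \<le> e / 4" using \<kappa> C by (auto simp: r_def \<epsilon>_def field_simps)
  have M: "0 < M" using \<epsilon> by (simp add: M_def)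
  obtain h1 where h1: "0 < h1" "\<And>h. 0 < h \<Longrightarrow> h < h1 \<Longrightarrow> measure (\<mu> h) {y. r < norm y} < e / (4 * C * M)"
    using small_mass[OF r, of "e / (4 * C * M)"] e C M by auto
  have "P t g x \<le> S t g x + t * (legendre (D x) + e)"
    if t: "0 \<le> t" "t < min h1 (r / M)" and g: "ucb g" and T: "taylor C g D" for t g D x
    unfolding one_step_eq[OF t(1) g]
  proof (rule cSUP_least)
    show "feasible t \<noteq> {}" using mu_feasible[OF t(1)] by blast
    fix \<nu> assume \<nu>: "\<nu> \<in> feasible t"
    define V where "V = wasserstein p (\<mu> t) \<nu>"
    have V: "0 \<le> V" unfolding V_def by (rule wasserstein_nonneg[OF moments[OF t(1)] feasibleD(3)[OF \<nu>]])
    have fin: "scaled \<phi> t V = ereal (cost t \<nu>)" unfolding V_def by (rule cost_eq(1)[OF t(1) \<nu>])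
    show "avg \<nu> g x - cost t \<nu> \<le> S t g x + t * (legendre (D x) + e)"
    proof (cases "t = 0")
      case True
      then have V0: "V = 0" using fin by (auto simp: scaled_def split: if_splits)
      \<comment> \<open>A finite penalty at \<open>t = 0\<close> forces distance 0; couplings of
        arbitrarily small cost replace one of cost 0.\<close>
      have "avg \<nu> g x \<le> S t g x + \<eta>" if \<eta>: "0 < \<eta>" for \<eta>
      proof -
        have b: "0 < \<eta> / (2 * C)" using \<eta> C by simp
        obtain \<gamma> where \<gamma>: "\<gamma> \<in> couplings (\<mu> t) \<nu>"
          "(LINT z|\<gamma>. norm (snd z - fst z) powr p) \<le> (wasserstein p (\<mu> t) \<nu> + \<eta> / (2 * C)) powr p"
          using wasserstein_coupling[OF p moments[OF t(1)] feasibleD(3)[OF \<nu>] b] by blast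
        then have "(LINT z|\<gamma>. norm (snd z - fst z) powr p) \<le> (\<eta> / (2 * C)) powr p"
          using V0 by (simp add: V_def)
        from taylor_step_coupling(1)[OF t(1) feasibleD(3)[OF \<nu>] \<gamma>(1) this b g T C, of x]
        show ?thesis using C by simp
      qed
      then have "avg \<nu> g x \<le> S t g x" by (rule field_le_epsilon)
      then show ?thesis using cost_eq(2)[OF t(1) \<nu>] True by simp
    next
      case False
      then have tp: "0 < t" using t by simp
      define m where "m = measure (\<mu> t) {y. r < norm y}"
      have m: "C * M * m \<le> e / 4"
        using h1(2)[OF tp] t C M by (simp add: m_def field_simps)
      define a where "a = V / t"
      have a: "0 \<le> a" using V tp by (simp add: a_def)
      have tr: "t * \<epsilon> powr (- 1 / (p - 1)) \<le> r" unfolding M_def[symmetric] using t M by (simp add: field_simps)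
      let ?F = "\<lambda>b. S t g x + t * (norm (D x) * (b / t) + \<kappa> * (b / t) powr p + 2 * C * r + C * M * m)"
      have le: "avg \<nu> g x \<le> ?F (V + \<theta>)" if \<theta>: "0 < \<theta>" for \<theta>
      proof -
        obtain \<gamma> where \<gamma>: "\<gamma> \<in> couplings (\<mu> t) \<nu>"
          "(LINT z|\<gamma>. norm (snd z - fst z) powr p) \<le> (V + \<theta>) powr p"
          using wasserstein_coupling[OF p moments[OF t(1)] feasibleD(3)[OF \<nu>] \<theta>] unfolding V_def by blast
        have "0 < V + \<theta>" using V \<theta> by simp
        from taylor_step_coupling(2)[OF t(1) feasibleD(3)[OF \<nu>] \<gamma> this g T C r \<epsilon> tp tr, of x]
        show ?thesis unfolding q(1) M_def[symmetric] m_def[symmetric] .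
      qed
      have "(\<lambda>n. V + inverse (real (Suc n))) \<longlonglongrightarrow> V + 0"
        by (intro tendsto_intros LIMSEQ_inverse_real_of_nat)
      then have "(\<lambda>n. ?F (V + inverse (real (Suc n)))) \<longlonglongrightarrow> ?F V"
        using V tp p by (intro tendsto_intros tendsto_powr2) (auto intro!: always_eventually)
      then have 1: "avg \<nu> g x \<le> ?F V"
        by (rule LIMSEQ_le_const) (use le in auto)
      obtain w where w: "norm w = a" "D x \<bullet> w = norm (D x) * a" using ex_direction[OF a] by metis
      have sc: "ereal t * \<phi> (norm w) = ereal (cost t \<nu>)" using fin False by (simp add: scaled_def w a_def)
      have wW: "w \<in> W"
      proof (rule ccontr)
        assume "w \<notin> W"
        then have "\<phi> (norm w) = \<infinity>" by (auto simp: W_def)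
        then show False using sc tp by simp
      qed
      have cst: "cost t \<nu> = t * \<rho> w" using sc phi_norm[OF wW] by simp
      have "D x \<bullet> w - \<rho> w + \<kappa> * a powr p \<le> legendre (D x) + e / 4"
      proof (cases "a \<le> R")
        case True
        then have "\<kappa> * a powr p \<le> \<kappa> * R powr p"
          using a \<kappa> p by (intro mult_left_mono powr_mono2) auto
        then show ?thesis using \<kappa>R legendre_upper[OF wW, of "D x"] by linarith
      next
        case False
        then have a1: "1 < a" "e2 powr (- 1 / (p - 1)) \<le> a" by (auto simp: R_def)
        have "(C + k0) * a \<le> (C + k0) * (e2 * a powr p)"
          using le_powr[OF p e2 a1(2)] C growth by (intro mult_left_mono) auto
        also have "\<dots> = c0 / 2 * a powr p" using C growth(2) by (simp add: e2_def field_simps add_nonneg_eq_0_iff)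
        finally have "(C + k0) * a \<le> c0 / 2 * a powr p" .
        moreover have "k0 * 1 \<le> k0 * a" using a1 growth by (intro mult_left_mono) auto
        moreover have "norm (D x) * a \<le> C * a" using T a by (intro mult_right_mono) (auto simp: taylor_def)
        moreover have "\<kappa> * a powr p \<le> c0 / 2 * a powr p" using \<kappa> by (intro mult_right_mono) auto
        moreover have "c0 * a powr p - k0 \<le> \<rho> w" using growth_rho[OF wW] w by simp
        ultimately have "D x \<bullet> w - \<rho> w + \<kappa> * a powr p \<le> 0" using w by (simp add: algebra_simps)
        then show ?thesis using legendre_nonneg[of "D x"] e by linarith
      qed
      then have "norm (D x) * a + \<kappa> * a powr p + 2 * C * r + C * M * m - \<rho> w \<le> legendre (D x) + e"
        using q(2) m e unfolding w by linarith
      then have "t * (norm (D x) * a + \<kappa> * a powr p + 2 * C * r + C * M * m - \<rho> w) \<le> t * (legendre (D x) + e)"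
        using tp by (intro mult_left_mono) auto
      then show ?thesis
        using 1 unfolding cst a_def[symmetric] by (simp add: right_diff_distrib)
    qed
  qed
  then show ?thesis using that[of "min h1 (r / M)"] h1(1) r M by simp
qed

text \<open>Velocities of length at least \<open>R\<close> give values of at most 0 in the Legendre
  transform. For the others the shift \<open>t *\<^sub>R w\<close> is no longer than
  \<open>t * R\<close>, and the Taylor error is o(t) uniformly.\<close>

lemma L_taylor:
  assumes C: "0 < C" and e: "0 < e"
  obtains h0 where "0 < h0" "\<And>t g D x. 0 \<le> t \<Longrightarrow> t < h0 \<Longrightarrow> ucb g \<Longrightarrow> taylor C g D \<Longrightarrow>
    S t g x + t * (legendre (D x) - e) \<le> L t g x"
proof -
  obtain R where R: "0 < R" "\<And>D w. norm D \<le> C \<Longrightarrow> w \<in> W \<Longrightarrow> R \<le> norm w \<Longrightarrow> D \<bullet> w - \<rho> w \<le> - 0"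
    using rho_radius by metis
  \<comment> \<open>One third is for the tail mass; the other two are for
    \<open>norm y + norm z \<le> 2 * d\<close> off the tail.\<close>
  define d where "d = e / (3 * C * R)"
  have d: "0 < d" "3 * C * R * d = e" using R C e by (auto simp: d_def)
  obtain h1 where h1: "0 < h1" "\<And>h. 0 < h \<Longrightarrow> h < h1 \<Longrightarrow> measure (\<mu> h) {y. d < norm y} < d"
    using small_mass[OF d(1) d(1)] by auto
  have "S t g x + t * (legendre (D x) - e) \<le> L t g x"
    if t: "0 \<le> t" "t < min h1 (d / R)" and g: "ucb g" and T: "taylor C g D" for t g D x
  proof (cases "t = 0")
    case True
    then show ?thesis using S_le_L[OF t(1) g] by simp
  next
    case False
    then have tp: "0 < t" using t by simp
    interpret prob_space "\<mu> t" by (rule prob[OF t(1)])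
    have DC: "norm (D x) \<le> C" using T by (simp add: taylor_def)
    have "D x \<bullet> w - \<rho> w \<le> (L t g x - S t g x) / t + e" if w: "w \<in> W" for w
    proof (cases "R \<le> norm w")
      case True
      have "0 \<le> (L t g x - S t g x) / t" using S_le_L[OF t(1) g, of x] tp by simp
      then show ?thesis using R(2)[OF DC w True] e by linarith
    next
      case F: False
      define z where "z = t *\<^sub>R w"
      have z: "norm z \<le> t * R" "norm z \<le> d"
        using F t R by (auto simp: z_def field_simps intro: mult_mono order.trans[OF mult_mono[of t t "norm w" R]])
      have i: "integrable (\<mu> t) (\<lambda>y. g (x + y))" for x
        by (rule ucb_integrable[OF prob[OF t(1)] sets_mu[OF t(1)] g])
      have i2: "integrable (\<mu> t) (\<lambda>y. g (x + y + z))"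
        using i[of "x + z"] by (simp add: add_ac)
      have "S t g x - S t g (x + z) = (LINT y|\<mu> t. g (x + y) - g (x + y + z))"
        unfolding Bochner_Integration.integral_diff[OF i i2] by (simp add: avg_def add_ac)
      also have "\<dots> \<le> (- (D x \<bullet> z) + C * norm z * (2 * d)) + C * norm z * measure (\<mu> t) {y. d < norm y}"
      proof (rule integral_le_tail[OF prob[OF t(1)] sets_mu[OF t(1)]])
        show "integrable (\<mu> t) (\<lambda>y. g (x + y) - g (x + y + z))" using i i2 by simp
        fix y
        have 1: "\<bar>g (x + y + z) - g (x + y) - D x \<bullet> z\<bar> \<le> C * norm z * min 1 (norm y + norm z)"
          using T by (simp add: taylor_def)
        have "min 1 (norm y + norm z) \<le> 2 * d + indicator {y. d < norm y} y"
          using z d by (auto simp: indicator_def)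
        then have "C * norm z * min 1 (norm y + norm z) \<le> C * norm z * (2 * d + indicator {y. d < norm y} y)"
          using C by (intro mult_left_mono) auto
        then show "g (x + y) - g (x + y + z)
          \<le> - (D x \<bullet> z) + C * norm z * (2 * d) + C * norm z * indicator {y. d < norm y} y"
          using 1 by (simp add: abs_le_iff algebra_simps)
      qed
      also have "\<dots> \<le> (- (D x \<bullet> z) + C * norm z * (2 * d)) + C * norm z * d"
        using h1(2)[OF tp] t C by (intro add_left_mono mult_left_mono) auto
      also have "\<dots> = - (D x \<bullet> z) + 3 * C * d * norm z" by simp
      also have "\<dots> \<le> - (D x \<bullet> z) + 3 * C * d * (t * R)"
        using z C d by (intro add_left_mono mult_left_mono) auto
      also have "\<dots> = - t * (D x \<bullet> w) + t * (3 * C * R * d)" by (simp add: z_def)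
      also have "\<dots> = - t * (D x \<bullet> w) + t * e" unfolding d(2) ..
      finally have "t * (D x \<bullet> w) \<le> S t g (x + z) - S t g x + t * e" by simp
      moreover have "S t g (x + z) - t * \<rho> w \<le> L t g x"
        unfolding L_def z_def by (rule H_upper[OF t(1) ucb_S[OF t(1) g] w])
      ultimately have "t * (D x \<bullet> w - \<rho> w) \<le> L t g x - S t g x + t * e" by (simp add: right_diff_distrib)
      then show ?thesis using tp by (simp add: field_simps)
    qed
    then have "legendre (D x) \<le> (L t g x - S t g x) / t + e" by (rule legendre_least)
    then show ?thesis using tp by (simp add: field_simps)
  qed
  then show ?thesis using that[of "min h1 (d / R)"] h1(1) d R by simp
qed

end

section \<open>Mollification and convergence\<close>

lemma pos_part_square_taylor:
  fixes s t :: real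
  shows "\<bar>(max 0 t)\<^sup>2 - (max 0 s)\<^sup>2 - 2 * max 0 s * (t - s)\<bar> \<le> (t - s)\<^sup>2"
proof (cases "0 \<le> s"; cases "0 \<le> t")
  assume "0 \<le> s" "0 \<le> t"
  then have "(max 0 t)\<^sup>2 - (max 0 s)\<^sup>2 - 2 * max 0 s * (t - s) = (t - s)\<^sup>2"
    by (simp add: power2_eq_square algebra_simps)
  then show ?thesis by simp
next
  assume "0 \<le> s" "\<not> 0 \<le> t"
  then have "(max 0 t)\<^sup>2 - (max 0 s)\<^sup>2 - 2 * max 0 s * (t - s) = s * s - 2 * (s * t)"
    by (simp add: power2_eq_square algebra_simps)
  moreover have "s * t \<le> 0" using \<open>0 \<le> s\<close> \<open>\<not> 0 \<le> t\<close> by (simp add: mult_nonneg_nonpos)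
  moreover have "(t - s)\<^sup>2 = s * s - 2 * (s * t) + t * t" by (simp add: power2_eq_square algebra_simps)
  ultimately show ?thesis by (simp add: abs_le_iff) (smt (verit) zero_le_square)
next
  assume "\<not> 0 \<le> s" "0 \<le> t"
  then have "t\<^sup>2 \<le> (t - s)\<^sup>2" by (intro power_mono) auto
  then show ?thesis using \<open>\<not> 0 \<le> s\<close> \<open>0 \<le> t\<close> by simp
qed auto

text \<open>The squared positive part is once differentiable with Lipschitz derivative, which is all the
  smoothness that the mollification has to provide.\<close>

definition bump :: "real \<Rightarrow> 'a::euclidean_space \<Rightarrow> real" where
  "bump d u = (max 0 (d\<^sup>2 - (norm u)\<^sup>2))\<^sup>2"

lemma bump_zero: "0 < d \<Longrightarrow> d \<le> norm u \<Longrightarrow> bump d u = 0"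
  using power_mono[of d "norm u" 2] by (simp add: bump_def)

lemma bump_bounds: "0 \<le> bump d u" "bump d u \<le> d ^ 4"
proof -
  have "(max 0 (d\<^sup>2 - (norm u)\<^sup>2))\<^sup>2 \<le> (d\<^sup>2)\<^sup>2" by (intro power_mono) auto
  then show "bump d u \<le> d ^ 4" by (simp add: bump_def flip: power_mult)
qed (simp add: bump_def)

text \<open>The slope is taken at \<open>u\<close> although the increment starts at
  \<open>u - y\<close>, as \<open>taylor\<close> demands; this produces the mixed term in
  \<open>norm y\<close>. The coefficient of \<open>z\<close> is minus the gradient of the bump at
  \<open>u\<close>. Beyond radius \<open>d + 2\<close> all terms vanish.\<close>

lemma bump_taylor:
  fixes u y z :: "'a::euclidean_space"
  assumes d: "0 < d" and yz: "norm y + norm z \<le> 1"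
  shows "\<bar>bump d (u - y - z) - bump d (u - y) - 4 * max 0 (d\<^sup>2 - (norm u)\<^sup>2) * (u \<bullet> z)\<bar>
    \<le> 23 * (d + 3)\<^sup>2 * (norm z * (norm y + norm z)) * indicator (cball 0 (d + 2)) u"
proof (cases "norm u \<le> d + 2")
  case False
  have nn: "norm y \<le> 1" "norm z \<le> 1" using yz norm_ge_zero[of y] norm_ge_zero[of z] by linarith+
  have "norm u - norm y \<le> norm (u - y)" "norm (u - y) - norm z \<le> norm (u - y - z)" by (rule norm_triangle_ineq2)+
  then have "d \<le> norm (u - y - z)" "d \<le> norm (u - y)" "d \<le> norm u"
    using nn False by linarith+
  moreover have "max 0 (d\<^sup>2 - (norm u)\<^sup>2) = 0"
    using power_mono[of d "norm u" 2] d \<open>d \<le> norm u\<close> by simp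
  ultimately show ?thesis using d False by (simp add: bump_zero)
next
  case True
  define Q where "Q = d + 3"
  define a where "a = u - y"
  define Y where "Y = norm y"
  define Z where "Z = norm z"
  have YZ: "0 \<le> Y" "0 \<le> Z" "Y \<le> 1" "Z \<le> 1" using yz norm_ge_zero[of y] norm_ge_zero[of z] unfolding Y_def Z_def by linarith+
  define up where "up = max 0 (d\<^sup>2 - (norm u)\<^sup>2)"
  define sp where "sp = max 0 (d\<^sup>2 - (norm a)\<^sup>2)"
  have u: "norm u \<le> Q" using True by (simp add: Q_def)
  have a: "norm a \<le> Q" using norm_triangle_ineq4[of u y] True YZ by (simp add: a_def Q_def Y_def)
  have Q: "1 \<le> Q" "0 \<le> Q" using d by (simp_all add: Q_def)
  have dQ: "d\<^sup>2 \<le> Q\<^sup>2" using d by (intro power_mono) (auto simp: Q_def)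
  have up: "0 \<le> up" "up \<le> Q\<^sup>2" and sp: "0 \<le> sp" "sp \<le> Q\<^sup>2"
    using dQ by (auto simp: up_def sp_def intro: order.trans[of _ "d\<^sup>2"])
  have az: "\<bar>a \<bullet> z\<bar> \<le> Q * Z" "\<bar>y \<bullet> z\<bar> \<le> Y * Z"
    using Cauchy_Schwarz_ineq2[of a z] Cauchy_Schwarz_ineq2[of y z] mult_right_mono[OF a, of Z] YZ
    by (auto simp: Y_def Z_def)
  define D where "D = 2 * (a \<bullet> z) - Z\<^sup>2"
  have D: "(d\<^sup>2 - (norm (a - z))\<^sup>2) - (d\<^sup>2 - (norm a)\<^sup>2) = D"
    by (simp add: D_def Z_def power2_norm_eq_inner inner_diff_left inner_diff_right inner_commute)
  have Z2: "Z * Z \<le> Z * (Y + Z)" "Z * Y \<le> Z * (Y + Z)" using YZ by (auto intro: mult_left_mono)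
  have "\<bar>D\<bar> \<le> 2 * (Q * Z) + Z * Z" using az(1) by (simp add: D_def power2_eq_square abs_le_iff) (use zero_le_square[of Z] in linarith)
  also have "\<dots> \<le> 2 * (Q * Z) + Q * Z" using YZ Q by (intro add_left_mono mult_right_mono) auto
  finally have Dle: "\<bar>D\<bar> \<le> 3 * (Q * Z)" by simp
  then have "D\<^sup>2 \<le> (3 * (Q * Z))\<^sup>2" using power_mono[of "\<bar>D\<bar>" "3 * (Q * Z)" 2] by simp
  then have e1: "D\<^sup>2 \<le> 9 * Q\<^sup>2 * (Z * Z)" by (simp add: power2_eq_square algebra_simps)
  have m: "\<bar>bump d (a - z) - bump d a - 2 * sp * D\<bar> \<le> D\<^sup>2"
    using pos_part_square_taylor[of "d\<^sup>2 - (norm (a - z))\<^sup>2" "d\<^sup>2 - (norm a)\<^sup>2"] unfolding D bump_def sp_def .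
  have "sp - up \<le> \<bar>(norm u)\<^sup>2 - (norm a)\<^sup>2\<bar>" "up - sp \<le> \<bar>(norm u)\<^sup>2 - (norm a)\<^sup>2\<bar>"
    by (auto simp: sp_def up_def max_def)
  moreover have "(norm u)\<^sup>2 - (norm a)\<^sup>2 = (norm u + norm a) * (norm u - norm a)"
    by (simp add: power2_eq_square algebra_simps)
  moreover have "\<bar>norm u - norm a\<bar> \<le> Y"
    using norm_triangle_ineq3[of u a] by (simp add: a_def Y_def)
  then have "\<bar>(norm u + norm a) * (norm u - norm a)\<bar> \<le> (2 * Q) * Y"
    unfolding abs_mult using u a YZ Q by (intro mult_mono) auto
  ultimately have su: "\<bar>sp - up\<bar> \<le> 2 * Q * Y" by linarith
  have "\<bar>(sp - up) * (a \<bullet> z)\<bar> \<le> (2 * Q * Y) * (Q * Z)"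
    unfolding abs_mult using su az Q YZ by (intro mult_mono) auto
  then have e2: "\<bar>4 * ((sp - up) * (a \<bullet> z))\<bar> \<le> 8 * Q\<^sup>2 * (Z * Y)" by (simp add: power2_eq_square algebra_simps)
  have "\<bar>up * (y \<bullet> z)\<bar> \<le> Q\<^sup>2 * (Y * Z)"
    unfolding abs_mult using up az YZ by (intro mult_mono) auto
  then have e3: "\<bar>4 * (up * (y \<bullet> z))\<bar> \<le> 4 * Q\<^sup>2 * (Z * Y)" by (simp add: algebra_simps)
  have "sp * (Z * Z) \<le> Q\<^sup>2 * (Z * Z)" using sp by (intro mult_right_mono) auto
  then have e4: "\<bar>2 * (sp * (Z * Z))\<bar> \<le> 2 * Q\<^sup>2 * (Z * Z)" using sp by (simp add: abs_mult)
  have ua: "u \<bullet> z = a \<bullet> z + y \<bullet> z" by (simp add: a_def inner_diff_left)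
  have "bump d (a - z) - bump d a - 4 * up * (u \<bullet> z)
    = (bump d (a - z) - bump d a - 2 * sp * D) + 4 * ((sp - up) * (a \<bullet> z)) - 4 * (up * (y \<bullet> z)) - 2 * (sp * (Z * Z))"
    unfolding ua D_def by (simp add: power2_eq_square algebra_simps)
  \<comment> \<open>The coefficients are 9 + 2 from \<open>e1\<close> and \<open>e4\<close>, and 8 +
    4 from \<open>e2\<close> and \<open>e3\<close>; together they make the 23 of the
    statement.\<close>
  then have "\<bar>bump d (a - z) - bump d a - 4 * up * (u \<bullet> z)\<bar>
      \<le> 11 * (Q\<^sup>2 * (Z * Z)) + 12 * (Q\<^sup>2 * (Z * Y))"
    using m e1 e2 e3 e4 by linarith
  also have "\<dots> \<le> 23 * (Q\<^sup>2 * (Z * (Y + Z)))"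
    using mult_left_mono[OF Z2(1), of "Q\<^sup>2"] mult_left_mono[OF Z2(2), of "Q\<^sup>2"] by simp
  finally show ?thesis using True by (simp add: a_def up_def Q_def Y_def Z_def mult.assoc)
qed

lemma
  fixes F :: "'a::euclidean_space \<Rightarrow> 'b::{banach, second_countable_topology}"
  assumes [measurable]: "F \<in> borel_measurable borel"
    and le: "\<And>u. norm (F u) \<le> K * indicator (cball 0 r) u"
  shows integrable_compact_support: "integrable lborel F"
    and integral_compact_support_le: "norm (LINT u|lborel. F u) \<le> K * measure lborel (cball 0 r :: 'a set)"
proof -
  have fin: "emeasure lborel (cball 0 r :: 'a set) < \<infinity>"
    by (rule emeasure_bounded_finite) simp
  have i: "integrable lborel (\<lambda>u::'a. K * indicator (cball 0 r) u)"
    using fin by (intro integrable_mult_right) (auto simp: integrable_indicator_iff)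
  show I: "integrable lborel F"
    by (rule Bochner_Integration.integrable_bound[OF i]) (auto intro!: AE_I2 order.trans[OF le])
  have "norm (LINT u|lborel. F u) \<le> (LINT u|lborel. norm (F u))"
    by (rule integral_norm_bound)
  also have "\<dots> \<le> (LINT u|lborel. K * indicator (cball 0 r) (u::'a))"
    by (rule integral_mono[OF integrable_norm[OF I] i le])
  finally show "norm (LINT u|lborel. F u) \<le> K * measure lborel (cball 0 r :: 'a set)" by simp
qed

lemma lborel_integral_translate:
  fixes F :: "'a::euclidean_space \<Rightarrow> real"
  assumes [measurable]: "F \<in> borel_measurable borel"
  shows "(LINT u|lborel. F (c + u)) = (LINT u|lborel. F u)"
proof -
  have "(LINT u|lborel. F u) = (LINT u|distr lborel borel ((+) c). F u)"
    by (simp add: lborel_distr_plus)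
  also have "\<dots> = (LINT u|lborel. F (c + u))" by (subst integral_distr) auto
  finally show ?thesis ..
qed

text \<open>Differentiation falls on the kernel, so a bound on \<open>g\<close> alone controls the
  Taylor remainder: with \<open>d\<close> fixed, \<open>C\<close> depends on \<open>B\<close> only
  and serves all iterates at once.\<close>

lemma mollifier:
  assumes d: "0 < d"
  obtains \<nu> :: "'a::euclidean_space measure" where "prob_space \<nu>" "sets \<nu> = sets borel"
    "\<And>g x e. ucb g \<Longrightarrow> (\<And>z. norm z \<le> d \<Longrightarrow> \<bar>g (x + z) - g x\<bar> \<le> e) \<Longrightarrow> \<bar>avg \<nu> g x - g x\<bar> \<le> e"
    "\<And>B. 0 < B \<Longrightarrow> \<exists>C>0. \<forall>g. ucb g \<longrightarrow> (\<forall>x. \<bar>g x\<bar> \<le> B) \<longrightarrow> (\<exists>D. taylor C (avg \<nu> g) D)"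
proof -
  let ?k = "bump d :: 'a \<Rightarrow> real"
  have km [measurable]: "?k \<in> borel_measurable borel" unfolding bump_def[abs_def] by measurable
  define Z where "Z = (LINT u|lborel. ?k u)"
  have kle: "\<bar>?k u\<bar> \<le> d ^ 4 * indicator (cball 0 d) u" for u
    using bump_bounds[of d u] bump_zero[OF d, of u] by (auto simp: indicator_def)
  have ki: "integrable lborel ?k" by (rule integrable_compact_support) (use kle in auto)
  have Z: "0 < Z"
  proof -
    define c where "c = (d\<^sup>2 - (d / 2)\<^sup>2)\<^sup>2"
    have "(d / 2)\<^sup>2 < d\<^sup>2" using d by (intro power_strict_mono) auto
    then have c: "0 < c" by (simp add: c_def)
    have fin: "emeasure lborel (ball 0 (d / 2) :: 'a set) < \<infinity>"
      by (rule emeasure_bounded_finite) simp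
    have "0 < c * measure lborel (ball 0 (d / 2) :: 'a set)" using c content_ball_pos[of "d / 2" "0::'a"] d by simp
    also have "\<dots> = (LINT u|lborel. c * indicator (ball 0 (d / 2)) (u::'a))" by simp
    also have "\<dots> \<le> Z"
      unfolding Z_def
    proof (rule integral_mono)
      show "integrable lborel (\<lambda>u::'a. c * indicator (ball 0 (d / 2)) u)"
        using fin by (intro integrable_mult_right) (auto simp: integrable_indicator_iff)
      fix u :: 'a
      show "c * indicator (ball 0 (d / 2)) u \<le> ?k u"
      proof (cases "norm u < d / 2")
        case True
        then have "(norm u)\<^sup>2 \<le> (d / 2)\<^sup>2" by (intro power_mono) auto
        then have "c \<le> ?k u" unfolding c_def bump_def using \<open>(d / 2)\<^sup>2 < d\<^sup>2\<close> by (intro power_mono) auto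
        then show ?thesis using True by simp
      qed (simp add: bump_bounds)
    qed (fact ki)
    finally show ?thesis .
  qed
  have knn: "0 \<le> ?k u / Z" for u using bump_bounds(1)[of d u] Z by simp
  define \<nu> where "\<nu> = density lborel (\<lambda>u. ennreal (?k u / Z))"
  have sets: "sets \<nu> = sets borel" by (simp add: \<nu>_def)
  have prob: "prob_space \<nu>"
  proof
    have "emeasure \<nu> (space \<nu>) = (\<integral>\<^sup>+u. ennreal (?k u / Z) \<partial>lborel)"
      by (simp add: \<nu>_def emeasure_density)
    also have "\<dots> = ennreal (LINT u|lborel. ?k u / Z)"
      using ki knn by (intro nn_integral_eq_integral) auto
    also have "\<dots> = 1" using Z by (simp add: Z_def[symmetric])
    finally show "emeasure \<nu> (space \<nu>) = 1" .
  qed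
  interpret prob_space \<nu> by (rule prob)
  have avg1: "avg \<nu> g x = (LINT u|lborel. ?k u / Z * g (x + u))" if g: "ucb g" for g x
    unfolding avg_def \<nu>_def using ucb_measurable[OF g] knn
    by (subst integral_density) auto
  show ?thesis
  proof (rule that[of \<nu>])
    fix g :: "'a \<Rightarrow> real" and x e assume g: "ucb g" and le: "\<And>z. norm z \<le> d \<Longrightarrow> \<bar>g (x + z) - g x\<bar> \<le> e"
    note [measurable] = ucb_measurable[OF g]
    obtain B where B: "0 < B" "\<And>x. \<bar>g x\<bar> \<le> B" using ucb_bound[OF g] by blast
    have i1: "integrable lborel (\<lambda>u. ?k u / Z * g (x + u))"
    proof (rule integrable_compact_support)
      fix u
      have "\<bar>?k u\<bar> * \<bar>g (x + u)\<bar> \<le> d ^ 4 * indicator (cball 0 d) u * B"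
        using kle B by (intro mult_mono) auto
      then show "norm (?k u / Z * g (x + u)) \<le> d ^ 4 * B / Z * indicator (cball 0 d) u"
        using Z by (simp add: abs_mult field_simps)
    qed measurable
    have "\<bar>avg \<nu> g x - g x\<bar> = \<bar>(LINT u|lborel. ?k u / Z * (g (x + u) - g x))\<bar>"
      using i1 ki Z by (simp add: avg1[OF g] right_diff_distrib Z_def[symmetric])
    also have "\<dots> \<le> (LINT u|lborel. ?k u / Z * e)"
    proof (rule integral_abs_bound_integral)
      show "integrable lborel (\<lambda>u. ?k u / Z * (g (x + u) - g x))"
        using i1 ki by (simp add: right_diff_distrib)
      fix u show "\<bar>?k u / Z * (g (x + u) - g x)\<bar> \<le> ?k u / Z * e"
      proof (cases "norm u \<le> d")
        case True
        then show ?thesis using le[of u] bump_bounds(1)[of d u] Z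
          by (auto simp: abs_mult intro!: mult_left_mono divide_right_mono)
      next
        case False then show ?thesis using bump_zero[OF d, of u] by simp
      qed
    qed (use ki in auto)
    also have "\<dots> = e" using Z by (simp add: Z_def[symmetric])
    finally show "\<bar>avg \<nu> g x - g x\<bar> \<le> e" .
  next
    fix B :: real assume B: "0 < B"
    define V where "V r = measure lborel (cball 0 r :: 'a set)" for r
    have V: "0 \<le> V r" for r by (simp add: V_def)
    define K where "K = B / Z * (23 * (d + 3)\<^sup>2) * V (d + 2)"
    define G where "G = B / Z * (4 * d ^ 3) * V d"
    have KG: "0 \<le> K" "0 \<le> G" using B Z V d by (auto simp: K_def G_def)
    \<comment> \<open>\<open>K\<close> controls the quadratic remainder, \<open>G\<close> the slope
      and \<open>2 * B\<close> the long increments. \<open>G\<close> counts twice: in the Lipschitz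
      bound and in the term \<open>D x \<bullet> z\<close>.\<close>
    define C where "C = K + 2 * G + 2 * B"
    have "\<exists>D. taylor C (avg \<nu> g) D" if g: "ucb g" and gB: "\<forall>x. \<bar>g x\<bar> \<le> B" for g
    proof -
      note [measurable] = ucb_measurable[OF g]
      \<comment> \<open>Translation invariance of Lebesgue measure moves the shift from
        \<open>g\<close> to the kernel, which is the smooth factor.\<close>
      have avg2: "avg \<nu> g (x + v) = (LINT u|lborel. ?k (u - v) / Z * g (x + u))" for x v
      proof -
        have "avg \<nu> g (x + v) = (LINT u|lborel. ?k ((v + u) - v) / Z * g (x + (v + u)))"
          by (simp add: avg1[OF g] add.assoc)
        also have "\<dots> = (LINT u|lborel. ?k (u - v) / Z * g (x + u))"
          by (rule lborel_integral_translate[of "\<lambda>u. ?k (u - v) / Z * g (x + u)"]) measurable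
        finally show ?thesis .
      qed
      have i2: "integrable lborel (\<lambda>u. ?k (u - v) / Z * g (x + u))" for x v
      proof (rule integrable_compact_support)
        fix u
        have "\<bar>?k (u - v)\<bar> \<le> d ^ 4 * indicator (cball 0 (d + norm v)) u"
        proof (cases "norm u \<le> d + norm v")
          case True then show ?thesis using bump_bounds[of d "u - v"] by simp
        next
          case False
          then have "d \<le> norm (u - v)" using norm_triangle_ineq2[of u v] by linarith
          then have "?k (u - v) = 0" by (rule bump_zero[OF d])
          then show ?thesis using d by simp
        qed
        then have "\<bar>?k (u - v)\<bar> * \<bar>g (x + u)\<bar> \<le> d ^ 4 * indicator (cball 0 (d + norm v)) u * B"
          using gB B by (intro mult_mono) auto
        then show "norm (?k (u - v) / Z * g (x + u)) \<le> d ^ 4 * B / Z * indicator (cball 0 (d + norm v)) u"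
          using Z by (simp add: abs_mult field_simps)
      qed measurable
      define D where "D x = (LINT u|lborel. (g (x + u) / Z * (4 * max 0 (d\<^sup>2 - (norm u)\<^sup>2))) *\<^sub>R u)" for x
      have Db: "norm ((g (x + u) / Z * (4 * max 0 (d\<^sup>2 - (norm u)\<^sup>2))) *\<^sub>R u) \<le> B / Z * (4 * d ^ 3) * indicator (cball 0 d) u" for x u
      proof (cases "norm u \<le> d")
        case True
        have "\<bar>g (x + u)\<bar> / Z * (4 * max 0 (d\<^sup>2 - (norm u)\<^sup>2)) * norm u \<le> B / Z * (4 * d\<^sup>2) * d"
          using gB B Z True d by (intro mult_mono divide_right_mono) auto
        also have "\<dots> = B / Z * (4 * d ^ 3)" by (simp add: power2_eq_square power3_eq_cube)
        finally show ?thesis using True Z by (simp add: abs_mult)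
      next
        case False
        then have "d\<^sup>2 \<le> (norm u)\<^sup>2" using d by (intro power_mono) auto
        then show ?thesis using False by simp
      qed
      have Di: "integrable lborel (\<lambda>u. (g (x + u) / Z * (4 * max 0 (d\<^sup>2 - (norm u)\<^sup>2))) *\<^sub>R u)" for x
        by (rule integrable_compact_support[OF _ Db]) measurable
      have DG: "norm (D x) \<le> G" for x
        unfolding D_def G_def V_def by (rule integral_compact_support_le[OF _ Db]) measurable
      have near: "\<bar>avg \<nu> g (x + y + z) - avg \<nu> g (x + y) - D x \<bullet> z\<bar> \<le> K * (norm z * (norm y + norm z))"
        if yz: "norm y + norm z \<le> 1" for x y z
      proof -
        let ?E = "\<lambda>u. ?k (u - y - z) - ?k (u - y) - 4 * max 0 (d\<^sup>2 - (norm u)\<^sup>2) * (u \<bullet> z)"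
        have Dz: "D x \<bullet> z = (LINT u|lborel. ((g (x + u) / Z * (4 * max 0 (d\<^sup>2 - (norm u)\<^sup>2))) *\<^sub>R u) \<bullet> z)"
          unfolding D_def using Di by (simp only: integral_inner_left)
        have Dzi: "integrable lborel (\<lambda>u. ((g (x + u) / Z * (4 * max 0 (d\<^sup>2 - (norm u)\<^sup>2))) *\<^sub>R u) \<bullet> z)"
          by (rule integrable_inner_left) (rule Di)
        have "avg \<nu> g (x + y + z) - avg \<nu> g (x + y) - D x \<bullet> z
          = (LINT u|lborel. ?k (u - (y + z)) / Z * g (x + u)) - (LINT u|lborel. ?k (u - y) / Z * g (x + u)) - D x \<bullet> z"
          using avg2[of x "y + z"] avg2[of x y] by (simp add: add.assoc)
        also have "\<dots> = (LINT u|lborel. ?k (u - (y + z)) / Z * g (x + u) - ?k (u - y) / Z * g (x + u)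
            - ((g (x + u) / Z * (4 * max 0 (d\<^sup>2 - (norm u)\<^sup>2))) *\<^sub>R u) \<bullet> z)"
          unfolding Dz using i2 Dzi by (simp add: Bochner_Integration.integral_diff Bochner_Integration.integrable_diff)
        also have "\<dots> = (LINT u|lborel. g (x + u) / Z * ?E u)"
          by (intro Bochner_Integration.integral_cong refl)
            (simp add: diff_diff_eq right_diff_distrib distrib_left diff_divide_distrib add_divide_distrib mult_ac)
        finally have eq: "avg \<nu> g (x + y + z) - avg \<nu> g (x + y) - D x \<bullet> z = (LINT u|lborel. g (x + u) / Z * ?E u)" .
        have "norm (LINT u|lborel. g (x + u) / Z * ?E u)
          \<le> (B / Z * (23 * (d + 3)\<^sup>2 * (norm z * (norm y + norm z)))) * measure lborel (cball 0 (d + 2) :: 'a set)"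
        proof (rule integral_compact_support_le)
          fix u
          have "norm (g (x + u) / Z * ?E u) = \<bar>g (x + u)\<bar> / Z * \<bar>?E u\<bar>" using Z by (simp add: abs_mult)
          also have "\<dots> \<le> B / Z * (23 * (d + 3)\<^sup>2 * (norm z * (norm y + norm z)) * indicator (cball 0 (d + 2)) u)"
            using gB B Z by (intro mult_mono divide_right_mono bump_taylor[OF d yz]) auto
          finally show "norm (g (x + u) / Z * ?E u)
            \<le> B / Z * (23 * (d + 3)\<^sup>2 * (norm z * (norm y + norm z))) * indicator (cball 0 (d + 2)) u"
            by (simp only: mult.assoc)
        qed measurable
        then show ?thesis unfolding eq K_def V_def by (simp add: mult_ac)
      qed
      \<comment> \<open>\<open>near\<close> is limited to short increments; the Lipschitz bound
        covers the linear branch of \<open>taylor\<close>.\<close>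
      have lip: "\<bar>avg \<nu> g (x + z) - avg \<nu> g x\<bar> \<le> (K + G + 2 * B) * norm z" for x z
      proof (cases "norm z \<le> 1")
        case True
        have "\<bar>avg \<nu> g (x + z) - avg \<nu> g x - D x \<bullet> z\<bar> \<le> K * (norm z * norm z)"
          using near[of 0 z x] True by simp
        also have "\<dots> \<le> K * (1 * norm z)" using True KG by (intro mult_left_mono mult_right_mono) auto
        finally have "\<bar>avg \<nu> g (x + z) - avg \<nu> g x - D x \<bullet> z\<bar> \<le> K * norm z" by simp
        moreover have "\<bar>D x \<bullet> z\<bar> \<le> G * norm z"
          using Cauchy_Schwarz_ineq2[of "D x" z] mult_right_mono[OF DG[of x], of "norm z"] by simp
        moreover have "0 \<le> B * norm z" using B by simp
        ultimately show ?thesis by (simp add: algebra_simps)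
      next
        case False
        have "avg \<nu> g \<in> mod_class B (\<lambda>_. 2 * B)"
        proof (rule mono_op_mod_class[OF mono_op_avg[OF prob sets] g])
          have "\<bar>g (x + z) - g x\<bar> \<le> 2 * B" for x z using gB[rule_format, of "x + z"] gB[rule_format, of x] by linarith
          then show "g \<in> mod_class B (\<lambda>_. 2 * B)" using gB by (simp add: mod_class_def)
        qed
        then have "\<bar>avg \<nu> g (x + z) - avg \<nu> g x\<bar> \<le> 2 * B * 1" by (simp add: mod_class_def)
        also have "\<dots> \<le> 2 * B * norm z" using False B by (intro mult_left_mono) auto
        also have "\<dots> \<le> (K + G + 2 * B) * norm z" using KG by (intro mult_right_mono) auto
        finally show ?thesis .
      qed
      have "taylor C (avg \<nu> g) D"
        unfolding taylor_def
      proof (intro conjI allI)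
        fix x show "norm (D x) \<le> C" using DG[of x] KG B by (simp add: C_def)
      next
        fix x y z
        show "\<bar>avg \<nu> g (x + y + z) - avg \<nu> g (x + y) - D x \<bullet> z\<bar> \<le> C * norm z * min 1 (norm y + norm z)"
        proof (cases "norm y + norm z \<le> 1")
          case True
          have "K * (norm z * (norm y + norm z)) \<le> C * (norm z * (norm y + norm z))"
            using KG B by (intro mult_right_mono) (auto simp: C_def)
          then show ?thesis using near[OF True, of x] True by (simp add: mult.assoc min_absorb2)
        next
          case False
          have "\<bar>D x \<bullet> z\<bar> \<le> G * norm z"
            using Cauchy_Schwarz_ineq2[of "D x" z] mult_right_mono[OF DG[of x], of "norm z"] by simp
          then show ?thesis using lip[of "x + y" z] False by (simp add: C_def algebra_simps min_absorb1)
        qed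
      qed
      then show ?thesis by blast
    qed
    moreover have "0 < C" using KG B by (simp add: C_def)
    ultimately show "\<exists>C>0. \<forall>g. ucb g \<longrightarrow> (\<forall>x. \<bar>g x\<bar> \<le> B) \<longrightarrow> (\<exists>D. taylor C (avg \<nu> g) D)" by blast
  qed (fact prob sets)+
qed

section \<open>Agreement of the two families of dyadic iterates\<close>

context wasserstein_perturbation
begin

lemma mono_op_dyadic_one_step: "0 \<le> t \<Longrightarrow> mono_op (dyadic P n t)"
  unfolding dyadic_def[abs_def]
  by (rule mono_op_comp[OF mono_op_funpow[OF mono_op_one_step] mono_op_one_step[OF dyadic_remainder(1)]]) auto

text \<open>Since \<^term>\<open>L h\<close> of a mollified function is dominated by the mollification of \<^term>\<open>L h g\<close>,
  the one-step comparison is only ever needed for functions of uniform smoothness, although the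
  iterates themselves are merely uniformly continuous.\<close>

theorem dyadic_one_step_tendsto:
  assumes t: "0 \<le> t" and f: "ucb f"
  shows "(\<lambda>n. dyadic P n t f x) \<longlonglongrightarrow> U f t x"
proof -
  have *: "\<exists>N. \<forall>n\<ge>N. \<bar>dyadic P n t f x - dyadic L n t f x\<bar> \<le> e" if e: "0 < e" for e
  proof -
    obtain B m where Bm: "0 < B" "modulus m" "f \<in> mod_class B m" using ucb_mod_class[OF f] by blast
    obtain d' where d': "0 < d'" "\<And>z. norm z < d' \<Longrightarrow> m z < e / 4"
      using Bm(2)[unfolded modulus_def, rule_format, of "e / 4"] e by auto
    define d where "d = d' / 2"
    have d: "0 < d" "\<And>z. norm z \<le> d \<Longrightarrow> m z \<le> e / 4" using d' by (auto simp: d_def intro!: less_imp_le)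
    obtain \<nu> :: "'a measure" where \<nu>: "prob_space \<nu>" "sets \<nu> = sets borel"
      and near: "\<And>g x e. ucb g \<Longrightarrow> (\<And>z. norm z \<le> d \<Longrightarrow> \<bar>g (x + z) - g x\<bar> \<le> e) \<Longrightarrow> \<bar>avg \<nu> g x - g x\<bar> \<le> e"
      and smooth: "\<And>B. 0 < B \<Longrightarrow> \<exists>C>0. \<forall>g. ucb g \<longrightarrow> (\<forall>x. \<bar>g x\<bar> \<le> B) \<longrightarrow> (\<exists>D. taylor C (avg \<nu> g) D)"
      using mollifier[OF d(1)] by blast
    obtain C where C: "0 < C" "\<And>g. ucb g \<Longrightarrow> (\<forall>x. \<bar>g x\<bar> \<le> B) \<Longrightarrow> \<exists>D. taylor C (avg \<nu> g) D"
      using smooth[OF Bm(1)] by blast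
    note A = mono_op_avg[OF \<nu>]
    have close: "\<bar>avg \<nu> g x - g x\<bar> \<le> e / 4" if g: "g \<in> mod_class B m" for g x
    proof (rule near[OF mod_class_ucb[OF g Bm(2)]])
      fix z :: 'a assume "norm z \<le> d"
      moreover have "\<bar>g (x + z) - g x\<bar> \<le> m z" using g by (simp add: mod_class_def)
      ultimately show "\<bar>g (x + z) - g x\<bar> \<le> e / 4" using d(2)[of z] by linarith
    qed
    \<comment> \<open>Summed over all steps, the one-step errors amount to
      \<open>2 * t * \<epsilon> \<le> e / 2\<close>; mollifying \<open>f\<close> and removing the
      mollification at the end cost \<open>e / 4\<close> each.\<close>
    define \<epsilon> where "\<epsilon> = e / (4 * (t + 1))"
    have \<epsilon>: "0 < \<epsilon>" "2 * t * \<epsilon> \<le> e / 2" using e t by (auto simp: \<epsilon>_def field_simps)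
    obtain h1 where h1: "0 < h1" "\<And>t g D x. 0 \<le> t \<Longrightarrow> t < h1 \<Longrightarrow> ucb g \<Longrightarrow> taylor C g D \<Longrightarrow>
        P t g x \<le> S t g x + t * (legendre (D x) + \<epsilon>)"
      using one_step_taylor[OF C(1) \<epsilon>(1)] by blast
    obtain h2 where h2: "0 < h2" "\<And>t g D x. 0 \<le> t \<Longrightarrow> t < h2 \<Longrightarrow> ucb g \<Longrightarrow> taylor C g D \<Longrightarrow>
        S t g x + t * (legendre (D x) - \<epsilon>) \<le> L t g x"
      using L_taylor[OF C(1) \<epsilon>(1)] by blast
    have step: "P h (avg \<nu> g) x \<le> avg \<nu> (L h g) x + h * (2 * \<epsilon>)"
      if h: "0 \<le> h" "h < h1" "h < h2" and g: "g \<in> mod_class B m" for h g x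
    proof -
      have ug: "ucb g" by (rule mod_class_ucb[OF g Bm(2)])
      obtain D where D: "taylor C (avg \<nu> g) D" using C(2)[OF ug] g by (auto simp: mod_class_def)
      have ua: "ucb (avg \<nu> g)" by (rule mono_op_ucb[OF A ug])
      have "P h (avg \<nu> g) x \<le> L h (avg \<nu> g) x + h * (2 * \<epsilon>)"
        using h1(2)[OF h(1,2) ua D, of x] h2(2)[OF h(1,3) ua D, of x] by (simp add: algebra_simps)
      then show ?thesis using L_avg[OF h(1) \<nu> ug, of x] by linarith
    qed
    obtain n0 where n0: "\<And>n. n0 \<le> n \<Longrightarrow> 1 / 2 ^ n < min h1 h2" using small_dyadic[of "min h1 h2"] h1(1) h2(1) by auto
    have "\<bar>dyadic P n t f x - dyadic L n t f x\<bar> \<le> e" if n: "n0 \<le> n" for n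
    proof -
      define h :: real where "h = 1 / 2 ^ n"
      define k where "k = nat \<lfloor>2 ^ n * t\<rfloor>"
      define r where "r = t - real k / 2 ^ n"
      have h: "0 < h" "h < h1" "h < h2" using n0[OF n] by (auto simp: h_def)
      have h': "0 \<le> h" using h by simp
      have r: "0 \<le> r" "r < h" using dyadic_remainder[OF t, of n] by (auto simp: r_def k_def h_def)
      have Lm: "(L h ^^ j) (L r f) \<in> mod_class B m" for j
        by (intro mono_op_mod_class[OF mono_op_funpow[OF mono_op_L[OF h']]] ucb_L[OF r(1) f]
            mono_op_mod_class[OF mono_op_L[OF r(1)] f Bm(3)])
      have Pu: "ucb ((P h ^^ j) (P r (avg \<nu> f)))" for j
        by (intro mono_op_ucb[OF mono_op_funpow[OF mono_op_one_step[OF h']]] mono_op_ucb[OF mono_op_one_step[OF r(1)]] mono_op_ucb[OF A] f)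
      \<comment> \<open>The iterates of \<open>P\<close> enter through monotonicity. The mollified
        functions are iterates of \<open>L\<close>, which stay in \<open>mod_class B m\<close>, so
        \<open>step\<close> applies to them with one constant.\<close>
      have "(P h ^^ j) (P r (avg \<nu> f)) x \<le> avg \<nu> ((L h ^^ j) (L r f)) x + (j * h + r) * (2 * \<epsilon>)" for j x
      proof (induction j arbitrary: x)
        case 0
        then show ?case using step[OF r(1) _ _ Bm(3), of x] r h by simp
      next
        case (Suc j)
        let ?g = "(L h ^^ j) (L r f)"
        have "P h ((P h ^^ j) (P r (avg \<nu> f))) x \<le> P h (avg \<nu> ?g) x + (j * h + r) * (2 * \<epsilon>)"
          by (rule mono_op_le_add[OF mono_op_one_step[OF h'] Pu mono_op_ucb[OF A mod_class_ucb[OF Lm Bm(2)]] Suc])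
        also have "\<dots> \<le> avg \<nu> (L h ?g) x + h * (2 * \<epsilon>) + (j * h + r) * (2 * \<epsilon>)"
          using step[OF h' h(2,3) Lm] by simp
        finally show ?case by (simp add: algebra_simps)
      qed
      from this[of k x] have 1: "dyadic P n t (avg \<nu> f) x \<le> avg \<nu> (dyadic L n t f) x + t * (2 * \<epsilon>)"
        by (simp add: dyadic_def k_def[symmetric] r_def[symmetric] h_def[symmetric]) (simp add: r_def h_def)
      have "f y \<le> avg \<nu> f y + e / 4" for y using close[OF Bm(3), of y] by linarith
      then have 2: "dyadic P n t f x \<le> dyadic P n t (avg \<nu> f) x + e / 4"
        by (rule mono_op_le_add[OF mono_op_dyadic_one_step[OF t] f mono_op_ucb[OF A f]])
      have 3: "avg \<nu> (dyadic L n t f) x \<le> dyadic L n t f x + e / 4"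
        using close[OF mono_op_mod_class[OF mono_op_dyadic[OF t] f Bm(3)], of n x] by linarith
      have "dyadic L n t f x \<le> dyadic P n t f x"
        unfolding dyadic_def k_def[symmetric] r_def[symmetric] h_def[symmetric]
        by (intro funpow_mono_op_le[OF mono_op_L[OF h'] mono_op_one_step[OF h']] L_le_one_step h' r(1) f
            ucb_L mono_op_ucb[OF mono_op_one_step[OF r(1)]])
      then show ?thesis using 1 2 3 \<epsilon>(2) by linarith
    qed
    then show ?thesis by blast
  qed
  then have "(\<lambda>n. dyadic P n t f x - dyadic L n t f x) \<longlonglongrightarrow> 0"
  proof (intro LIMSEQ_I)
    fix r :: real assume "0 < r"
    moreover from this obtain N where "\<And>n. N \<le> n \<Longrightarrow> \<bar>dyadic P n t f x - dyadic L n t f x\<bar> \<le> r / 2"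
      using *[of "r / 2"] by auto
    ultimately show "\<exists>N. \<forall>n\<ge>N. norm (dyadic P n t f x - dyadic L n t f x - 0) < r"
      by (intro exI[of _ N]) fastforce
  qed
  from tendsto_add[OF this dyadic_tendsto[OF t f, of x]] show ?thesis by simp
qed

lemma limit_op_eq:
  assumes t: "0 \<le> t" and f: "ucb f"
  shows "limit_op p \<mu> \<phi> t f x = U f t x"
proof -
  have "dyadic_step p \<mu> \<phi> n t f = dyadic P n t f" for n
    by (simp add: dyadic_step_def dyadic_def Let_def)
  then show ?thesis
    unfolding limit_op_def using limI[OF dyadic_one_step_tendsto[OF t f]] by simp
qed

end

section \<open>Marginals of Levy processes\<close>

locale levy =
  fixes M :: "'w measure" and X :: "real \<Rightarrow> 'w \<Rightarrow> 'a::euclidean_space" and \<mu> :: "real \<Rightarrow> 'a measure" and p :: real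
  assumes levy: "levy_process M X" and law: "0 \<le> t \<Longrightarrow> \<mu> t = distr M borel (X t)"
    and moment: "integrable (\<mu> 1) (\<lambda>x. norm x powr p)" and p: "1 < p"
begin

sublocale prob_space M
  using levy by (simp add: levy_process_def)

lemma X_measurable [measurable]: "0 \<le> t \<Longrightarrow> X t \<in> borel_measurable M"
  using levy by (simp add: levy_process_def)

lemma X_0: "AE \<omega> in M. X 0 \<omega> = 0"
  using levy by (simp add: levy_process_def)

lemma increment_law: "0 \<le> s \<Longrightarrow> 0 \<le> h \<Longrightarrow> distr M borel (\<lambda>\<omega>. X (s + h) \<omega> - X s \<omega>) = \<mu> h"
  using levy law by (simp add: levy_process_def)

lemma law_prob: "0 \<le> t \<Longrightarrow> prob_space (\<mu> t)" and law_sets: "0 \<le> t \<Longrightarrow> sets (\<mu> t) = sets borel"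
  using law prob_space_distr[OF X_measurable] by simp_all

text \<open>Independence and stationarity of the two increments. Both times are positive because the
  partition points in \<open>levy_process\<close> increase strictly.\<close>

lemma law_add:
  assumes s: "0 < s" and t: "0 < t"
  shows "\<mu> (s + t) = distr (\<mu> s \<Otimes>\<^sub>M \<mu> t) borel (\<lambda>z. fst z + snd z)"
proof -
  have [measurable]: "X 0 \<in> borel_measurable M" "X s \<in> borel_measurable M" "X (s + t) \<in> borel_measurable M"
    using s t by auto
  define \<sigma> :: "nat \<Rightarrow> real" where "\<sigma> i = (if i = 0 then 0 else if i = 1 then s else s + t)" for i
  let ?Y = "\<lambda>i \<omega>. X (\<sigma> (Suc i)) \<omega> - X (\<sigma> i) \<omega>"
  have "0 \<le> \<sigma> 0 \<and> (\<forall>i<2. \<sigma> i < \<sigma> (Suc i))"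
    using s t by (auto simp: \<sigma>_def less_2_cases_iff)
  then have iv: "indep_vars (\<lambda>_. borel) ?Y {..<2}"
    using levy unfolding levy_process_def by blast
  \<comment> \<open>Restricting the independent family to singletons and then evaluating the
    coordinate yields independence of a pair.\<close>
  have "indep_var (PiM {0} (\<lambda>_. borel)) (\<lambda>\<omega>. restrict (\<lambda>i. ?Y i \<omega>) {0})
      (PiM {1} (\<lambda>_. borel)) (\<lambda>\<omega>. restrict (\<lambda>i. ?Y i \<omega>) {1})"
    by (rule indep_var_restrict[OF iv]) auto
  then have "indep_var borel ((\<lambda>f. f 0) \<circ> (\<lambda>\<omega>. restrict (\<lambda>i. ?Y i \<omega>) {0}))
      borel ((\<lambda>f. f 1) \<circ> (\<lambda>\<omega>. restrict (\<lambda>i. ?Y i \<omega>) {1}))"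
    by (rule indep_var_compose) auto
  then have "indep_var borel (\<lambda>\<omega>. X s \<omega> - X 0 \<omega>) borel (\<lambda>\<omega>. X (s + t) \<omega> - X s \<omega>)"
    by (simp add: comp_def \<sigma>_def)
  then have "distr M borel (\<lambda>\<omega>. X s \<omega> - X 0 \<omega>) \<Otimes>\<^sub>M distr M borel (\<lambda>\<omega>. X (s + t) \<omega> - X s \<omega>)
      = distr M (borel \<Otimes>\<^sub>M borel) (\<lambda>\<omega>. (X s \<omega> - X 0 \<omega>, X (s + t) \<omega> - X s \<omega>))"
    by (simp add: indep_var_distribution_eq)
  moreover have "distr M borel (\<lambda>\<omega>. X s \<omega> - X 0 \<omega>) = \<mu> s" "distr M borel (\<lambda>\<omega>. X (s + t) \<omega> - X s \<omega>) = \<mu> t"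
    using increment_law[of 0 s] increment_law[of s t] s t by simp_all
  ultimately have "distr (\<mu> s \<Otimes>\<^sub>M \<mu> t) borel (\<lambda>z. fst z + snd z)
      = distr M borel (\<lambda>\<omega>. X s \<omega> - X 0 \<omega> + (X (s + t) \<omega> - X s \<omega>))"
    by (simp add: distr_distr comp_def)
  also have "\<dots> = distr M borel (X (s + t))"
    by (rule distr_cong_AE) (use X_0 in auto)
  finally show ?thesis using law[of "s + t"] s t by simp
qed

lemma law_zero:
  assumes g: "ucb g" shows "avg (\<mu> 0) g x = g x"
proof -
  note [measurable] = ucb_measurable[OF g]
  have "avg (\<mu> 0) g x = (LINT \<omega>|M. g (x + X 0 \<omega>))"
    by (simp add: avg_def law integral_distr)
  also have "\<dots> = (LINT \<omega>|M. g x)"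
    by (rule integral_cong_AE) (use X_0 in auto)
  finally show ?thesis by (simp add: prob_space)
qed

lemma law_conv:
  assumes s: "0 \<le> s" and t: "0 \<le> t" and g: "ucb g"
  shows "avg (\<mu> (s + t)) g x = avg (\<mu> s) (avg (\<mu> t) g) x"
proof -
  have u: "ucb (avg (\<mu> t) g)" by (rule mono_op_ucb[OF mono_op_avg[OF law_prob[OF t] law_sets[OF t]] g])
  consider "s = 0" | "t = 0" | "0 < s" "0 < t" using s t by linarith
  then show ?thesis
  proof cases
    case 1 then show ?thesis using law_zero[OF u] by simp
  next
    case 2
    then have "avg (\<mu> t) g = g" using law_zero[OF g] by auto
    then show ?thesis using 2 by simp
  next
    case 3
    note [measurable] = ucb_measurable[OF g]
    note [measurable_cong] = law_sets[OF s] law_sets[OF t]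
    have "avg (\<mu> (s + t)) g x = (LINT z|(\<mu> s \<Otimes>\<^sub>M \<mu> t). g (x + (fst z + snd z)))"
      unfolding law_add[OF 3] avg_def by (subst integral_distr) auto
    then show ?thesis using avg_avg(1)[OF law_prob[OF s] law_sets[OF s] law_prob[OF t] law_sets[OF t] g] by simp
  qed
qed

lemma law_small:
  assumes r: "0 < r" shows "((\<lambda>t. measure (\<mu> t) {y. r < norm y}) \<longlongrightarrow> 0) (at_right 0)"
proof -
  have "((\<lambda>t. measure M {\<omega> \<in> space M. norm (X t \<omega> - X 0 \<omega>) > r}) \<longlongrightarrow> 0) (at 0 within {0..})"
    using levy r unfolding levy_process_def by blast
  then have lim: "((\<lambda>t. measure M {\<omega> \<in> space M. norm (X t \<omega> - X 0 \<omega>) > r}) \<longlongrightarrow> 0) (at_right 0)"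
    by (rule tendsto_within_subset) auto
  have "\<forall>\<^sub>F t in at_right (0::real). 0 < t" by (rule eventually_at_right_less)
  then have "\<forall>\<^sub>F t in at_right 0. measure M {\<omega> \<in> space M. norm (X t \<omega> - X 0 \<omega>) > r} = measure (\<mu> t) {y. r < norm y}"
  proof eventually_elim
    case (elim t)
    have [measurable]: "X t \<in> borel_measurable M" "X 0 \<in> borel_measurable M" using elim by auto
    have "measure (\<mu> t) {y. r < norm y} = measure M (X t -` {y. r < norm y} \<inter> space M)"
      using elim by (simp add: law measure_distr)
    also have "\<dots> = measure M {\<omega> \<in> space M. norm (X t \<omega> - X 0 \<omega>) > r}"
      by (rule measure_eq_AE) (use X_0 in auto)
    finally show ?case ..
  qed
  then show ?thesis using lim by (rule Lim_transform_eventually[rotated])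
qed

lemma law_prob_p_iff: "0 \<le> t \<Longrightarrow> \<mu> t \<in> prob_p p \<longleftrightarrow> integrable (\<mu> t) (\<lambda>x. norm x powr p)"
  using law_prob law_sets by (simp add: prob_p_def)

lemma law_moment_add:
  assumes s: "0 \<le> s" and t: "0 \<le> t" and i: "\<mu> s \<in> prob_p p" "\<mu> t \<in> prob_p p"
  shows "\<mu> (s + t) \<in> prob_p p"
proof -
  have [measurable]: "X s \<in> borel_measurable M" "X (s + t) \<in> borel_measurable M"
    using s t by auto
  have "integrable M (\<lambda>\<omega>. norm (X s \<omega>) powr p)"
    using prob_pD(3)[OF i(1)] s by (simp add: law integrable_distr_eq)
  moreover have "integrable (distr M borel (\<lambda>\<omega>. X (s + t) \<omega> - X s \<omega>)) (\<lambda>x. norm x powr p)"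
    using prob_pD(3)[OF i(2)] unfolding increment_law[OF s t] .
  then have "integrable M (\<lambda>\<omega>. norm (X (s + t) \<omega> - X s \<omega>) powr p)"
    by (simp add: integrable_distr_eq)
  ultimately have "integrable M (\<lambda>\<omega>. 2 powr p * (norm (X s \<omega>) powr p + norm (X (s + t) \<omega> - X s \<omega>) powr p))"
    by simp
  then have "integrable M (\<lambda>\<omega>. norm (X (s + t) \<omega>) powr p)"
  proof (rule Bochner_Integration.integrable_bound)
    have "norm (X (s + t) \<omega>) powr p \<le> 2 powr p * (norm (X s \<omega>) powr p + norm (X (s + t) \<omega> - X s \<omega>) powr p)" for \<omega>
      using norm_add_powr_le[OF p, of "X s \<omega>" "X (s + t) \<omega> - X s \<omega>"] by simp
    then show "AE \<omega> in M. norm (norm (X (s + t) \<omega>) powr p)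
        \<le> norm (2 powr p * (norm (X s \<omega>) powr p + norm (X (s + t) \<omega> - X s \<omega>) powr p))"
      by (intro AE_I2) simp
  qed measurable
  then show ?thesis
    using s t by (simp add: law_prob_p_iff) (simp add: law integrable_distr_eq)
qed

text \<open>By Fubini a finite moment of an independent sum passes to almost every translate of a summand.\<close>

lemma law_moment_unit:
  assumes t: "0 \<le> t" "t \<le> 1"
  shows "\<mu> t \<in> prob_p p"
proof -
  consider "t = 0" | "t = 1" | "0 < t" "t < 1" using t by linarith
  then show ?thesis
  proof cases
    case 1
    have "integrable M (\<lambda>\<omega>. norm (X 0 \<omega>) powr p) \<longleftrightarrow> integrable M (\<lambda>\<omega>. 0 :: real)"
      by (rule integrable_cong_AE) (use X_0 p in auto)
    then show ?thesis using 1 by (simp add: law_prob_p_iff) (simp add: law integrable_distr_eq)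
  next
    case 2 then show ?thesis using moment by (simp add: law_prob_p_iff)
  next
    case 3
    define s where "s = 1 - t"
    have s: "0 < s" "s + t = 1" using 3 by (auto simp: s_def)
    interpret a: prob_space "\<mu> s" using law_prob s by simp
    interpret b: prob_space "\<mu> t" using law_prob 3 by simp
    interpret pair_prob_space "\<mu> s" "\<mu> t" ..
    have [measurable_cong]: "sets (\<mu> s) = sets borel" "sets (\<mu> t) = sets borel" using law_sets s 3 by simp_all
    have "integrable (distr (\<mu> s \<Otimes>\<^sub>M \<mu> t) borel (\<lambda>z. fst z + snd z)) (\<lambda>x. norm x powr p)"
      using moment law_add[OF s(1) 3(1)] s by simp
    then have "integrable (\<mu> s \<Otimes>\<^sub>M \<mu> t) (\<lambda>z. norm (fst z + snd z) powr p)"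
      by (simp add: integrable_distr_eq)
    from AE_integrable_fst'[OF this]
    have ae: "AE x in \<mu> s. integrable (\<mu> t) (\<lambda>y. norm (x + y) powr p)" by simp
    have "\<exists>x. integrable (\<mu> t) (\<lambda>y. norm (x + y) powr p)"
    proof (rule ccontr)
      assume "\<nexists>x. integrable (\<mu> t) (\<lambda>y. norm (x + y) powr p)"
      then have "AE x in \<mu> s. False" using ae by simp
      then show False by (simp add: a.AE_False)
    qed
    then obtain x where x: "integrable (\<mu> t) (\<lambda>y. norm (x + y) powr p)" by blast
    have "integrable (\<mu> t) (\<lambda>y. 2 powr p * (norm (x + y) powr p + norm (- x) powr p))"
      using x by simp
    then have "integrable (\<mu> t) (\<lambda>y. norm y powr p)"
    proof (rule Bochner_Integration.integrable_bound)
      have "norm y powr p \<le> 2 powr p * (norm (x + y) powr p + norm (- x) powr p)" for y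
        using norm_add_powr_le[OF p, of "x + y" "- x"] by simp
      then show "AE y in \<mu> t. norm (norm y powr p) \<le> norm (2 powr p * (norm (x + y) powr p + norm (- x) powr p))"
        by (intro AE_I2) simp
    qed measurable
    then show ?thesis using 3 by (simp add: law_prob_p_iff)
  qed
qed

text \<open>Times up to 1 are covered by \<open>law_moment_unit\<close>; longer ones are reached by
  adding increments of unit length.\<close>

lemma law_moment:
  assumes "0 \<le> t"
  shows "\<mu> t \<in> prob_p p"
proof -
  have "0 \<le> t \<Longrightarrow> t \<le> real (Suc n) \<Longrightarrow> \<mu> t \<in> prob_p p" for n t
  proof (induction n arbitrary: t)
    case 0 then show ?case using law_moment_unit by simp
  next
    case (Suc n)
    show ?case
    proof (cases "t \<le> 1")
      case True then show ?thesis using law_moment_unit Suc.prems by simp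
    next
      case False
      have "\<mu> (t - 1) \<in> prob_p p" using False Suc.prems by (intro Suc.IH) auto
      from law_moment_add[OF _ _ this law_moment_unit[of 1]] False show ?thesis by simp
    qed
  qed
  moreover obtain n where "t \<le> real n" using real_arch_simple by blast
  ultimately show ?thesis using assms by (meson le_SucI of_nat_le_iff order_trans le_refl)
qed

sublocale conv_semigroup \<mu>
  by (rule conv_semigroup.intro) (fact law_prob law_sets law_conv law_zero law_small)+

end

section \<open>Viscosity inequalities\<close>

text \<open>Uniform continuity on a compact ball combined with smallness outside. Values in a normed
  space allow its use for functions in \<open>C0\<close> and for their gradients alike.\<close>

lemma vanishing_uniform:
  fixes g :: "'a::euclidean_space \<Rightarrow> 'b::real_normed_vector"
  assumes cont: "continuous_on UNIV g" and lim: "(g \<longlongrightarrow> 0) at_infinity"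
  shows "\<exists>B. \<forall>x. norm (g x) \<le> B" and "\<And>e. 0 < e \<Longrightarrow> \<exists>d>0. \<forall>x z. norm z < d \<longrightarrow> norm (g (x + z) - g x) < e"
proof -
  have R: "\<exists>R. \<forall>x. R \<le> norm x \<longrightarrow> norm (g x) < e" if "0 < e" for e
    using lim that unfolding Lim_at_infinity by simp
  obtain R where R1: "\<And>x. R \<le> norm x \<Longrightarrow> norm (g x) < 1" using R[of 1] by auto
  have "bounded (g ` cball 0 R)"
    by (intro compact_imp_bounded compact_continuous_image continuous_on_subset[OF cont]) auto
  then obtain B where B: "\<And>x. norm x \<le> R \<Longrightarrow> norm (g x) \<le> B" by (force simp: bounded_iff)
  have "norm (g x) \<le> max B 1" for x
    using B[of x] R1[of x] by (cases "norm x \<le> R") (auto simp: le_max_iff_disj intro: less_imp_le)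
  then show "\<exists>B. \<forall>x. norm (g x) \<le> B" by blast
  fix e :: real assume e: "0 < e"
  obtain R where R2: "\<And>x. R \<le> norm x \<Longrightarrow> norm (g x) < e / 2" using R[of "e / 2"] e by auto
  have "uniformly_continuous_on (cball 0 (R + 2)) g"
    by (intro compact_uniformly_continuous continuous_on_subset[OF cont]) auto
  then obtain d where d: "0 < d"
    "\<And>x y. x \<in> cball 0 (R + 2) \<Longrightarrow> y \<in> cball 0 (R + 2) \<Longrightarrow> dist y x < d \<Longrightarrow> dist (g y) (g x) < e"
    using e unfolding uniformly_continuous_on_def by meson
  \<comment> \<open>With steps shorter than 1, both points lie in the ball of radius
    \<open>R + 2\<close>, or both have norm at least \<open>R\<close>.\<close>
  have "norm (g (x + z) - g x) < e" if z: "norm z < min d 1" for x z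
  proof (cases "norm x \<le> R + 1")
    case True
    then have "norm (x + z) \<le> R + 2" using z norm_triangle_ineq[of x z] by linarith
    then have "x \<in> cball 0 (R + 2)" "x + z \<in> cball 0 (R + 2)" using True by simp_all
    moreover have "dist (x + z) x < d" using z by (simp add: dist_norm)
    ultimately show ?thesis using d(2) by (simp flip: dist_norm)
  next
    case False
    then have "R \<le> norm (x + z)" using z norm_diff_ineq[of x z] by linarith
    then show ?thesis
      using R2[of x] R2[of "x + z"] False norm_triangle_ineq4[of "g (x + z)" "g x"] by linarith
  qed
  then show "\<exists>d>0. \<forall>x z. norm z < d \<longrightarrow> norm (g (x + z) - g x) < e"
    using d(1) by (intro exI[of _ "min d 1"]) auto
qed

lemma ucb_C0: "f \<in> C0 \<Longrightarrow> ucb (apply_bcontfun f)"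
  using vanishing_uniform[OF continuous_on_apply_bcontfun, of f] by (simp add: C0_def ucb_def)

lemma ucb_uniform_limit:
  assumes "\<And>e. 0 < e \<Longrightarrow> \<exists>f. ucb f \<and> (\<forall>x. \<bar>f x - w x\<bar> \<le> e)"
  shows "ucb w"
proof -
  obtain f where f: "ucb f" "\<And>x. \<bar>f x - w x\<bar> \<le> 1" using assms[of 1] by auto
  obtain B where B: "\<And>x. \<bar>f x\<bar> \<le> B" using ucb_bound[OF f(1)] by metis
  have "\<bar>w x\<bar> \<le> B + 1" for x using f(2)[of x] B[of x] by linarith
  moreover have "\<exists>d>0. \<forall>x z. norm z < d \<longrightarrow> \<bar>w (x + z) - w x\<bar> < e" if e: "0 < e" for e
  proof -
    obtain f where f: "ucb f" "\<And>x. \<bar>f x - w x\<bar> \<le> e / 3" using assms[of "e / 3"] e by auto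
    obtain d where d: "0 < d" "\<And>x z. norm z < d \<Longrightarrow> \<bar>f (x + z) - f x\<bar> < e / 3"
      using ucb_uniform[OF f(1), of "e / 3"] e by auto
    have "\<bar>w (x + z) - w x\<bar> < e" if "norm z < d" for x z
      using f(2)[of x] f(2)[of "x + z"] d(2)[OF that, of x] by linarith
    then show ?thesis using d(1) by blast
  qed
  ultimately show ?thesis unfolding ucb_def by blast
qed

text \<open>\<open>grad\<close> is a definite description, so it acquires meaning through existence
  (Riesz representation in the basis) and uniqueness of the gradient.\<close>

lemma GDERIV_grad:
  fixes f :: "'a::euclidean_space \<Rightarrow> real"
  assumes "f differentiable (at x)"
  shows "GDERIV f x :> grad f x"
proof -
  obtain f' where f': "(f has_derivative f') (at x)" using assms by (auto simp: differentiable_def)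
  interpret bounded_linear f' by (rule has_derivative_bounded_linear[OF f'])
  define D where "D = (\<Sum>b\<in>Basis. f' b *\<^sub>R b)"
  have "f' h = h \<bullet> D" for h
  proof -
    have "f' h = f' (\<Sum>b\<in>Basis. (h \<bullet> b) *\<^sub>R b)" by (simp only: euclidean_representation)
    also have "\<dots> = (\<Sum>b\<in>Basis. (h \<bullet> b) * f' b)" by (simp add: sum scaleR)
    finally show ?thesis by (simp add: D_def inner_sum_right mult.commute)
  qed
  then have "f' = (\<lambda>h. h \<bullet> D)" by auto
  then have D: "GDERIV f x :> D" using f' by (simp add: gderiv_def)
  have "E = D" if "GDERIV f x :> E" for E
  proof -
    have "(\<lambda>h. h \<bullet> E) = (\<lambda>h. h \<bullet> D)"
      using D that unfolding gderiv_def by (rule has_derivative_unique[rotated])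
    then have "\<forall>h. h \<bullet> E = h \<bullet> D" by metis
    then show ?thesis by (simp add: vector_eq_ldot)
  qed
  then show ?thesis unfolding grad_def by (rule theI[of "\<lambda>D. GDERIV f x :> D", OF D])
qed

text \<open>Mean value inequality for \<open>g\<close> minus the linear function of slope
  \<open>E\<close>. The choice \<open>E = 0\<close> yields the Lipschitz bound, and the gradient at
  \<open>y\<close> yields the first-order expansion.\<close>

lemma gradient_difference_bound:
  fixes g :: "'a::euclidean_space \<Rightarrow> real"
  assumes D: "\<And>x. GDERIV g x :> D x" and b: "\<And>x. norm (x - y) \<le> norm z \<Longrightarrow> norm (D x - E) \<le> b"
  shows "\<bar>g (y + z) - g y - E \<bullet> z\<bar> \<le> b * norm z"
proof -
  define F where "F x = g x - x \<bullet> E" for x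
  have "norm (F (y + z) - F y) \<le> b * norm (y + z - y)"
  proof (rule differentiable_bound[of "cball y (norm z)" F "\<lambda>x h. h \<bullet> (D x - E)"])
    fix x assume x: "x \<in> cball y (norm z)"
    show "(F has_derivative (\<lambda>h. h \<bullet> (D x - E))) (at x within cball y (norm z))"
      unfolding inner_diff_right F_def[abs_def]
      by (rule has_derivative_at_withinI, rule has_derivative_diff[OF D[unfolded gderiv_def]],
          rule bounded_linear_imp_has_derivative, rule bounded_linear_inner_left)
    have b': "norm (D x - E) \<le> b" using x by (intro b) (simp add: dist_norm norm_minus_commute)
    show "onorm (\<lambda>h. h \<bullet> (D x - E)) \<le> b"
    proof (rule onorm_le)
      fix h
      have "norm (h \<bullet> (D x - E)) \<le> norm (D x - E) * norm h"
        using Cauchy_Schwarz_ineq2[of h "D x - E"] by (simp add: mult.commute)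
      also have "\<dots> \<le> b * norm h" by (rule mult_right_mono[OF b']) simp
      finally show "norm (h \<bullet> (D x - E)) \<le> b * norm h" .
    qed
  qed (auto simp: dist_norm)
  then show ?thesis by (simp add: F_def inner_add_left inner_commute algebra_simps)
qed

lemma C1_0_gradient:
  assumes g: "g \<in> C1_0"
  obtains G where "0 < G" "\<And>x. norm (grad g x) \<le> G" "\<And>y z. \<bar>g (y + z) - g y\<bar> \<le> G * norm z"
    "\<And>e. 0 < e \<Longrightarrow> \<exists>d>0. \<forall>x z. norm z < d \<longrightarrow> norm (grad g (x + z) - grad g x) < e \<and>
      \<bar>g (x + z) - g x - grad g x \<bullet> z\<bar> \<le> e * norm z"
proof -
  have D: "GDERIV g x :> grad g x" for x using g by (intro GDERIV_grad) (simp add: C1_0_def)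
  have c: "continuous_on UNIV (grad g)" "(grad g \<longlongrightarrow> 0) at_infinity" using g by (auto simp: C1_0_def)
  obtain B where "\<And>x. norm (grad g x) \<le> B" using vanishing_uniform(1)[OF c] by blast
  then have G: "norm (grad g x) \<le> max B 1" for x by (simp add: le_max_iff_disj)
  show ?thesis
  proof (rule that[OF _ G])
    show "\<bar>g (y + z) - g y\<bar> \<le> max B 1 * norm z" for y z
      using gradient_difference_bound[OF D, of y z 0 "max B 1"] G by simp
    fix e :: real assume e: "0 < e"
    obtain d where d: "0 < d" "\<And>x z. norm z < d \<Longrightarrow> norm (grad g (x + z) - grad g x) < e"
      using vanishing_uniform(2)[OF c e] by blast
    have "\<bar>g (x + z) - g x - grad g x \<bullet> z\<bar> \<le> e * norm z" if z: "norm z < d" for x z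
    proof (rule gradient_difference_bound[OF D])
      fix y assume "norm (y - x) \<le> norm z"
      then show "norm (grad g y - grad g x) \<le> e" using d(2)[of "y - x" x] z by simp
    qed
    then show "\<exists>d>0. \<forall>x z. norm z < d \<longrightarrow> norm (grad g (x + z) - grad g x) < e \<and>
      \<bar>g (x + z) - g x - grad g x \<bullet> z\<bar> \<le> e * norm z" using d by blast
  qed simp
qed

text \<open>\<open>w\<close> is the time derivative of the test function: one step back in time
  perturbs \<open>g\<close> by \<open>- h * w\<close>, of the same order as the gain of
  \<open>H h\<close>. The estimate is uniform in \<open>y\<close> because it is averaged
  afterwards.\<close>

lemma (in hopf_lax) H_expansion:
  assumes g: "ucb g" and w: "ucb w" and e: "0 < e"
    and G: "\<And>x. norm (D x) \<le> G" "\<And>y z. \<bar>g (y + z) - g y\<bar> \<le> G * norm z"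
    and D: "\<And>e. 0 < e \<Longrightarrow> \<exists>d>0. \<forall>x z. norm z < d \<longrightarrow> \<bar>g (x + z) - g x - D x \<bullet> z\<bar> \<le> e * norm z"
  obtains h0 where "0 < h0"
    "\<And>h y. 0 < h \<Longrightarrow> h < h0 \<Longrightarrow> H h (\<lambda>x. g x - h * w x) y \<le> g y + h * (legendre (D y) - w y + e)"
proof -
  obtain B where B: "0 < B" "\<And>x. \<bar>w x\<bar> \<le> B" using ucb_bound[OF w] by blast
  \<comment> \<open>The margin \<open>2 * B\<close> pays for the two values of \<open>w\<close>, at
    \<open>y\<close> and at the displaced point.\<close>
  obtain R where R: "0 < R" "\<And>E v. norm E \<le> G \<Longrightarrow> v \<in> W \<Longrightarrow> R \<le> norm v \<Longrightarrow> E \<bullet> v - \<rho> v \<le> - (2 * B)"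
    using rho_radius by metis
  have "0 < e / (2 * R)" using e R by simp
  then obtain d1 where d1: "0 < d1" "\<And>x z. norm z < d1 \<Longrightarrow> \<bar>g (x + z) - g x - D x \<bullet> z\<bar> \<le> e / (2 * R) * norm z"
    using D by blast
  obtain d2 where d2: "0 < d2" "\<And>x z. norm z < d2 \<Longrightarrow> \<bar>w (x + z) - w x\<bar> < e / 2"
    using ucb_uniform[OF w, of "e / 2"] e by auto
  define h0 where "h0 = min d1 d2 / R"
  have "H h (\<lambda>x. g x - h * w x) y \<le> g y + h * (legendre (D y) - w y + e)" if h: "0 < h" "h < h0" for h y
  proof (rule H_least)
    fix v assume v: "v \<in> W"
    have hR: "h * R < min d1 d2" using h R by (simp add: h0_def pos_less_divide_eq)
    show "g (y + h *\<^sub>R v) - h * w (y + h *\<^sub>R v) - h * \<rho> v \<le> g y + h * (legendre (D y) - w y + e)"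
    proof (cases "R \<le> norm v")
      case True
      have G0: "0 \<le> G" using G(1)[of 0] norm_ge_zero[of "D 0"] by linarith
      have nv: "0 < norm v" using True R by linarith
      \<comment> \<open>Applied to a slope of length \<open>G\<close> parallel to \<open>v\<close>,
        the radius estimate bounds the Lipschitz gain \<open>G * norm v\<close>.\<close>
      then have "norm ((G / norm v) *\<^sub>R v) \<le> G" using G0 by simp
      from R(2)[OF this v True] have 1: "G * norm v - \<rho> v \<le> - (2 * B)"
        using nv by (simp add: power2_norm_eq_inner[symmetric] power2_eq_square)
      have 2: "g (y + h *\<^sub>R v) - g y \<le> h * (G * norm v)"
        using G(2)[of y "h *\<^sub>R v"] h by (simp add: abs_le_iff mult.left_commute)
      have 3: "- w (y + h *\<^sub>R v) \<le> B" "w y \<le> B" using B(2)[of "y + h *\<^sub>R v"] B(2)[of y] by (auto simp: abs_le_iff)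
      have "G * norm v - w (y + h *\<^sub>R v) - \<rho> v \<le> legendre (D y) - w y + e"
        using 1 3 legendre_nonneg[of "D y"] e by linarith
      then have "h * (G * norm v - w (y + h *\<^sub>R v) - \<rho> v) \<le> h * (legendre (D y) - w y + e)"
        using h by (intro mult_left_mono) auto
      then show ?thesis using 2 by (simp add: right_diff_distrib)
    next
      case False
      have "h * norm v < h * R" using h False by simp
      moreover have "norm (h *\<^sub>R v) = h * norm v" using h by simp
      ultimately have "norm (h *\<^sub>R v) < min d1 d2" using hR by linarith
      then have n: "norm (h *\<^sub>R v) < d1" "norm (h *\<^sub>R v) < d2" by simp_all
      have "e / (2 * R) * norm v \<le> e / (2 * R) * R" using False e R by (intro mult_left_mono) auto
      then have 0: "e / (2 * R) * norm v \<le> e / 2" using R by simp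
      have "g (y + h *\<^sub>R v) - g y \<le> h * (D y \<bullet> v) + h * (e / (2 * R) * norm v)"
        using d1(2)[OF n(1), of y] h by (simp add: abs_le_iff algebra_simps)
      also have "\<dots> \<le> h * (D y \<bullet> v) + h * (e / 2)"
        using h by (intro add_left_mono mult_left_mono[OF 0]) simp
      finally have 1: "g (y + h *\<^sub>R v) - g y \<le> h * (D y \<bullet> v + e / 2)" by (simp add: distrib_left)
      have "D y \<bullet> v + e / 2 - w (y + h *\<^sub>R v) - \<rho> v \<le> legendre (D y) - w y + e"
        using legendre_upper[OF v, of "D y"] d2(2)[OF n(2), of y] by linarith
      then have "h * (D y \<bullet> v + e / 2 - w (y + h *\<^sub>R v) - \<rho> v) \<le> h * (legendre (D y) - w y + e)"
        using h by (intro mult_left_mono) auto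
      then show ?thesis using 1 by (simp add: right_diff_distrib)
    qed
  qed
  moreover have "0 < h0" using d1(1) d2(1) R by (simp add: h0_def)
  ultimately show ?thesis using that by blast
qed

text \<open>Gives the nonlinear term along a test function a modulus of continuity, so that
  averaging it over a short time changes it little.\<close>

lemma (in hopf_lax) ucb_legendre:
  assumes G: "\<And>x. norm (D x) \<le> G"
    and D: "\<And>e. 0 < e \<Longrightarrow> \<exists>d>0. \<forall>x z. norm z < d \<longrightarrow> norm (D (x + z) - D x) < e"
  shows "ucb (\<lambda>x. legendre (D x))"
proof -
  obtain R where R: "0 < R" "\<And>E F. norm E \<le> G \<Longrightarrow> norm F \<le> G \<Longrightarrow> legendre F \<le> legendre E + R * norm (F - E)"
    using legendre_lipschitz by metis
  have G0: "0 \<le> G" using G[of 0] norm_ge_zero[of "D 0"] by linarith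
  have b: "\<bar>legendre (D x)\<bar> \<le> legendre 0 + R * G" for x
  proof -
    have "legendre (D x) \<le> legendre 0 + R * norm (D x - 0)" using R(2)[of 0 "D x"] G G0 by simp
    also have "\<dots> \<le> legendre 0 + R * G" using R G by simp
    finally show ?thesis using legendre_nonneg[of "D x"] by simp
  qed
  have "\<exists>d>0. \<forall>x z. norm z < d \<longrightarrow> \<bar>legendre (D (x + z)) - legendre (D x)\<bar> < e" if e: "0 < e" for e
  proof -
    obtain d where d: "0 < d" "\<And>x z. norm z < d \<Longrightarrow> norm (D (x + z) - D x) < e / R"
      using D[of "e / R"] e R by auto
    have "\<bar>legendre (D (x + z)) - legendre (D x)\<bar> < e" if "norm z < d" for x z
    proof -
      have "R * norm (D (x + z) - D x) < e" using d(2)[OF that, of x] R by (simp add: field_simps)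
      moreover have "legendre (D (x + z)) \<le> legendre (D x) + R * norm (D (x + z) - D x)"
        by (rule R(2)[OF G G])
      moreover have "legendre (D x) \<le> legendre (D (x + z)) + R * norm (D (x + z) - D x)"
        using R(2)[OF G[of "x + z"] G[of x]] by (simp add: norm_minus_commute)
      ultimately show ?thesis by linarith
    qed
    then show ?thesis using d(1) by blast
  qed
  then show ?thesis using b unfolding ucb_def by blast
qed

section \<open>Short-time expansions of the semigroup and of test functions\<close>

context conv_semigroup
begin

lemma apply_semigroup: "0 \<le> t \<Longrightarrow> apply_bcontfun (levy_semigroup \<mu> t f) x = S t (apply_bcontfun f) x"
  using apply_levy_semigroup[OF prob sets_mu] by (simp add: avg_def)

lemma generator_expansion:
  assumes g: "g \<in> generator_dom \<mu>"
  shows "generator \<mu> g \<in> C0"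
    and "\<And>e. 0 < e \<Longrightarrow> \<exists>h0>0. \<forall>h x. 0 < h \<longrightarrow> h < h0 \<longrightarrow> \<bar>S h g x - g x - h * generator \<mu> g x\<bar> \<le> h * e"
proof -
  obtain a where a: "a \<in> C0" "((\<lambda>t. (levy_semigroup \<mu> t g - g) /\<^sub>R t) \<longlongrightarrow> a) (at_right 0)"
    using g by (auto simp: generator_dom_def)
  have gen: "generator \<mu> g = a" unfolding generator_def by (rule tendsto_Lim[OF _ a(2)]) simp
  then show "generator \<mu> g \<in> C0" using a by simp
  fix e :: real assume "0 < e"
  then have "\<forall>\<^sub>F h in at_right 0. dist ((levy_semigroup \<mu> h g - g) /\<^sub>R h) a < e"
    using tendstoD[OF a(2)] by blast
  then obtain h0 where h0: "0 < h0" "\<And>h. 0 < h \<Longrightarrow> h < h0 \<Longrightarrow> dist ((levy_semigroup \<mu> h g - g) /\<^sub>R h) a < e"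
    by (auto simp: eventually_at_right_field)
  have "\<bar>S h g x - g x - h * a x\<bar> \<le> h * e" if h: "0 < h" "h < h0" for h x
  proof -
    have "\<bar>(S h g x - g x) / h - a x\<bar> \<le> e"
      using dist_bounded[of "(levy_semigroup \<mu> h g - g) /\<^sub>R h" x a] h0(2)[OF h] h
      by (simp add: dist_real_def apply_semigroup divide_inverse_commute)
    then have "h * \<bar>(S h g x - g x) / h - a x\<bar> \<le> h * e" using h by (intro mult_left_mono) auto
    moreover have "S h g x - g x - h * a x = h * ((S h g x - g x) / h - a x)"
      using h by (simp add: field_simps)
    then have "\<bar>S h g x - g x - h * a x\<bar> = h * \<bar>(S h g x - g x) / h - a x\<bar>"
      using h by (simp only: abs_mult abs_of_pos)
    ultimately show ?thesis by simp
  qed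
  then show "\<exists>h0>0. \<forall>h x. 0 < h \<longrightarrow> h < h0 \<longrightarrow> \<bar>S h g x - g x - h * generator \<mu> g x\<bar> \<le> h * e"
    using h0(1) gen by blast
qed

lemma S_linear:
  assumes t: "0 \<le> t" and f: "ucb f" and g: "ucb g"
  shows "S t (\<lambda>x. f x + c * g x) x = S t f x + c * S t g x"
  using ucb_integrable[OF prob[OF t] sets_mu[OF t] f, of x] ucb_integrable[OF prob[OF t] sets_mu[OF t] g, of x]
  by (simp add: avg_def)

end

text \<open>The expansion runs backward, since the solution at \<open>t\<close> is compared with the
  one at \<open>t - h\<close>; \<open>h0 < t\<close> keeps this time positive. \<open>w\<close> is a
  uniform limit of difference quotients of functions in \<open>C0\<close>, hence uniformly
  continuous.\<close>

lemma test_function_expansion: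
  assumes v: "test_function \<mu> v" and t: "0 < t"
  defines "w \<equiv> vector_derivative v (at t)"
  shows "ucb w"
    and "\<And>e. 0 < e \<Longrightarrow> \<exists>h0>0. h0 < t \<and> (\<forall>h x. 0 < h \<longrightarrow> h < h0 \<longrightarrow> \<bar>v (t - h) x - v t x + h * w x\<bar> \<le> h * e)"
proof -
  have "(v has_vector_derivative w) (at t)"
    using v t unfolding test_function_def w_def by (auto simp: vector_derivative_works[symmetric])
  then have der: "(v has_derivative (\<lambda>h. h *\<^sub>R w)) (at t)" by (simp add: has_vector_derivative_def)
  have main: "\<exists>h0>0. h0 < t \<and> (\<forall>h x. 0 < h \<longrightarrow> h < h0 \<longrightarrow> \<bar>v (t - h) x - v t x + h * w x\<bar> \<le> h * e)"
    if e: "0 < e" for e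
  proof -
    obtain d where d: "0 < d" "\<And>s. norm (s - t) < d \<Longrightarrow> norm (v s - v t - (s - t) *\<^sub>R w) \<le> e * norm (s - t)"
      using der e unfolding has_derivative_at_alt by blast
    have "\<bar>v (t - h) x - v t x + h * w x\<bar> \<le> h * e" if h: "0 < h" "h < min d (t / 2)" for h x
    proof -
      have "norm (v (t - h) - v t - (t - h - t) *\<^sub>R w) \<le> e * norm (t - h - t)"
        using h by (intro d(2)) simp
      then have "norm (v (t - h) - v t + h *\<^sub>R w) \<le> h * e" using h by (simp add: mult.commute)
      then show ?thesis
        using norm_bounded[of "v (t - h) - v t + h *\<^sub>R w" x] by simp
    qed
    then show ?thesis using d(1) t by (intro exI[of _ "min d (t / 2)"]) auto
  qed
  then show "\<And>e. 0 < e \<Longrightarrow> \<exists>h0>0. h0 < t \<and> (\<forall>h x. 0 < h \<longrightarrow> h < h0 \<longrightarrow> \<bar>v (t - h) x - v t x + h * w x\<bar> \<le> h * e)" .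
  have vC0: "ucb (v s)" if "0 < s" for s
    using v that by (intro ucb_C0) (auto simp: test_function_def C1_0_def)
  show "ucb w"
  proof (rule ucb_uniform_limit)
    fix e :: real assume "0 < e"
    then obtain h0 where h0: "0 < h0" "h0 < t" "\<And>h x. 0 < h \<Longrightarrow> h < h0 \<Longrightarrow> \<bar>v (t - h) x - v t x + h * w x\<bar> \<le> h * e"
      using main by metis
    define h where "h = h0 / 2"
    have h: "0 < h" "h < h0" "h < t" using h0 by (auto simp: h_def)
    define f where "f x = (- 1 / h) * (v (t - h) x - v t x)" for x
    have "ucb f" unfolding f_def[abs_def] using h t by (intro ucb_cmult ucb_diff vC0) auto
    moreover have "\<bar>f x - w x\<bar> \<le> e" for x
    proof -
      have "f x - w x = - ((v (t - h) x - v t x + h * w x) / h)" using h by (simp add: f_def field_simps)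
      then have "\<bar>f x - w x\<bar> = \<bar>v (t - h) x - v t x + h * w x\<bar> / h" using h by simp
      also have "\<dots> \<le> h * e / h" using h by (intro divide_right_mono h0(3)) auto
      finally show ?thesis using h by simp
    qed
    ultimately show "\<exists>f. ucb f \<and> (\<forall>x. \<bar>f x - w x\<bar> \<le> e)" by blast
  qed
qed

section \<open>The sub- and supersolution inequalities\<close>

context levy_hopf_lax
begin

lemma ucb_bcontfun: "ucb g \<Longrightarrow> apply_bcontfun (Bcontfun g) = g"
  by (intro Bcontfun_inverse) (auto simp: bcontfun_def ucb_continuous bounded_iff elim!: ucb_bound)

text \<open>Touching from above gives \<open>U f (t - h) \<le> g - h * w\<close> up to o(h). In
  \<open>U_step_upper\<close>, \<open>H h\<close> then contributes the Legendre transform and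
  \<open>S h\<close> the generator. As \<open>g x = U f t x\<close>, the terms of order 0 cancel and
  division by \<open>h\<close> leaves the inequality.\<close>

lemma U_subsolution:
  assumes f: "ucb f" and t: "0 < t" and v: "test_function \<mu> v"
    and le: "\<And>s y. 0 < s \<Longrightarrow> U f s y \<le> v s y" and eq: "v t x = U f t x"
  shows "vector_derivative v (at t) x \<le> generator \<mu> (v t) x + legendre (grad (v t) x)"
proof -
  define w where "w = apply_bcontfun (vector_derivative v (at t))"
  define g where "g = v t"
  have w: "ucb w" unfolding w_def by (rule test_function_expansion(1)[OF v t])
  have g: "g \<in> generator_dom \<mu>" "g \<in> C1_0" using v t by (auto simp: test_function_def g_def)
  have ug: "ucb g" using g by (intro ucb_C0) (simp add: C1_0_def)
  obtain G where G: "0 < G" "\<And>x. norm (grad g x) \<le> G" "\<And>y z. \<bar>g (y + z) - g y\<bar> \<le> G * norm z"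
    "\<And>e. 0 < e \<Longrightarrow> \<exists>d>0. \<forall>x z. norm z < d \<longrightarrow> norm (grad g (x + z) - grad g x) < e \<and>
      \<bar>g (x + z) - g x - grad g x \<bullet> z\<bar> \<le> e * norm z"
    using C1_0_gradient[OF g(2)] by blast
  have Dg: "\<exists>d>0. \<forall>x z. norm z < d \<longrightarrow> \<bar>g (x + z) - g x - grad g x \<bullet> z\<bar> \<le> e * norm z" if "0 < e" for e
    using G(4)[OF that] by meson
  have Dr: "\<exists>d>0. \<forall>x z. norm z < d \<longrightarrow> norm (grad g (x + z) - grad g x) < e" if "0 < e" for e
    using G(4)[OF that] by meson
  define q where "q x = legendre (grad g x) - w x" for x
  have q: "ucb q" unfolding q_def[abs_def]
    by (rule ucb_diff[OF ucb_legendre[OF G(2) Dr] w])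
  obtain B m where Bm: "0 < B" "modulus m" "q \<in> mod_class B m" using ucb_mod_class[OF q] by blast
  \<comment> \<open>Four errors \<open>h * e'\<close> accumulate: time derivative, Hopf-Lax
    expansion, averaging of \<open>q\<close>, and generator. The factor 5 leaves room for
    them.\<close>
  have "0 \<le> generator \<mu> g x + q x + e" if e': "0 < e'" and "e = 5 * e'" for e e'
  proof -
    obtain h1 where h1: "0 < h1"
      "\<And>h y. 0 < h \<Longrightarrow> h < h1 \<Longrightarrow> H h (\<lambda>x. g x - h * w x) y \<le> g y + h * (legendre (grad g y) - w y + e')"
      using H_expansion[OF ug w e' G(2,3) Dg] by blast
    obtain h2 where h2: "0 < h2"
      "\<And>h f y. 0 \<le> h \<Longrightarrow> h < h2 \<Longrightarrow> f \<in> mod_class B m \<Longrightarrow> \<bar>S h f y - f y\<bar> \<le> e'"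
      using S_small_time[OF Bm(2,1) e'] by metis
    obtain h3 where h3: "0 < h3" "\<And>h y. 0 < h \<Longrightarrow> h < h3 \<Longrightarrow> \<bar>S h g y - g y - h * generator \<mu> g y\<bar> \<le> h * e'"
      using generator_expansion(2)[OF g(1) e'] by blast
    obtain h4 where h4: "0 < h4" "h4 < t" "\<And>h y. 0 < h \<Longrightarrow> h < h4 \<Longrightarrow> \<bar>v (t - h) y - g y + h * w y\<bar> \<le> h * e'"
      using test_function_expansion(2)[OF v t e'] unfolding w_def g_def by blast
    obtain k where k: "1 / 2 ^ k < min (min h1 h2) (min h3 h4)"
      using small_dyadic[of "min (min h1 h2) (min h3 h4)"] h1(1) h2(1) h3(1) h4(1) by auto
    define h :: real where "h = 1 / 2 ^ k"
    have h: "0 < h" "h < h1" "h < h2" "h < h3" "h < h4" "h < t" using k h4 by (auto simp: h_def)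
    have h': "0 \<le> h" using h by simp
    have th: "0 < t - h" using h by simp
    have uU: "ucb (U f (t - h))" using th f by (intro ucb_U) auto
    have ugw: "ucb (\<lambda>x. g x - h * w x)" by (intro ucb_diff ucb_cmult ug w)
    have "H h (U f (t - h)) y \<le> g y + h * q y + 2 * h * e'" for y
    proof -
      have "U f (t - h) z \<le> g z - h * w z + h * e'" for z
        using le[OF th, of z] h4(3)[OF h(1,5), of z] by linarith
      then have "H h (U f (t - h)) y \<le> H h (\<lambda>x. g x - h * w x) y + h * e'"
        by (rule mono_op_le_add[OF mono_op_H[OF h'] uU ugw])
      then show ?thesis using h1(2)[OF h(1,2), of y] by (simp add: q_def algebra_simps)
    qed
    then have "S h (H h (U f (t - h))) x \<le> S h (\<lambda>y. g y + h * q y) x + 2 * h * e'"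
      by (intro mono_op_le_add[OF mono_op_S[OF h']] ucb_H uU h' ucb_add ucb_cmult ug q)
    also have "S h (\<lambda>y. g y + h * q y) x = S h g x + h * S h q x"
      by (rule S_linear[OF h' ug q])
    also have "h * S h q x \<le> h * (q x + e')"
      using h2(2)[OF h' h(3) Bm(3), of x] h by (intro mult_left_mono) (auto simp: abs_le_iff)
    also have "S h g x \<le> g x + h * generator \<mu> g x + h * e'"
      using h3(2)[OF h(1,4), of x] by linarith
    finally have "S h (H h (U f (t - h))) x \<le> g x + h * generator \<mu> g x + h * e' + h * (q x + e') + 2 * h * e'"
      by simp
    moreover have "g x \<le> S h (H h (U f (t - h))) x"
      using U_step_upper[of "t - h" f k x] th f eq by (simp add: g_def h_def)
    ultimately have "0 \<le> h * (generator \<mu> g x + q x + 4 * e')" by (simp add: algebra_simps)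
    then show ?thesis using h that by (simp add: zero_le_mult_iff)
  qed
  from this[of "_ / 5"] have "0 \<le> generator \<mu> g x + q x + e" if "0 < e" for e
    using that by simp
  then have "0 \<le> generator \<mu> g x + q x" by (rule field_le_epsilon)
  then show ?thesis by (simp add: q_def w_def g_def)
qed

text \<open>\<open>U_step_lower\<close> is used for one velocity \<open>z\<close> at a time and the
  supremum is taken last. All expansions are therefore made at \<open>x + h *\<^sub>R z\<close>, and
  continuity brings the generator and the time derivative back to \<open>x\<close>.\<close>

lemma U_supersolution:
  assumes f: "ucb f" and t: "0 < t" and v: "test_function \<mu> v"
    and le: "\<And>s y. 0 < s \<Longrightarrow> v s y \<le> U f s y" and eq: "v t x = U f t x"
  shows "generator \<mu> (v t) x + legendre (grad (v t) x) \<le> vector_derivative v (at t) x"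
proof -
  define w where "w = apply_bcontfun (vector_derivative v (at t))"
  define g where "g = v t"
  have w: "ucb w" unfolding w_def by (rule test_function_expansion(1)[OF v t])
  have g: "g \<in> generator_dom \<mu>" "g \<in> C1_0" using v t by (auto simp: test_function_def g_def)
  have ug: "ucb g" using g by (intro ucb_C0) (simp add: C1_0_def)
  have ua: "ucb (generator \<mu> g)" by (rule ucb_C0[OF generator_expansion(1)[OF g(1)]])
  obtain B m where Bm: "0 < B" "modulus m" "w \<in> mod_class B m" using ucb_mod_class[OF w] by blast
  obtain G where G: "0 < G" "\<And>x. norm (grad g x) \<le> G" "\<And>y z. \<bar>g (y + z) - g y\<bar> \<le> G * norm z"
    "\<And>e. 0 < e \<Longrightarrow> \<exists>d>0. \<forall>x z. norm z < d \<longrightarrow> norm (grad g (x + z) - grad g x) < e \<and>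
      \<bar>g (x + z) - g x - grad g x \<bullet> z\<bar> \<le> e * norm z"
    using C1_0_gradient[OF g(2)] by blast
  have "grad g x \<bullet> z - \<rho> z \<le> w x - generator \<mu> g x" if z: "z \<in> W" for z
  proof (rule field_le_epsilon)
    fix e0 :: real assume e0: "0 < e0"
    \<comment> \<open>The errors below amount to \<open>5 + norm z\<close> times
      \<open>h * e\<close>: the time derivative and the two generator estimates give 3, the average
      of \<open>w\<close> gives 2, and the first-order expansion gives
      \<open>norm z\<close>.\<close>
    define e where "e = e0 / (6 + norm z)"
    have n6: "0 < 6 + norm z" by (simp add: add_pos_nonneg)
    have e: "0 < e" "e * (6 + norm z) = e0" using e0 n6 by (auto simp: e_def)
    obtain h1 where h1: "0 < h1" "\<And>x y. norm y < h1 \<Longrightarrow> \<bar>g (x + y) - g x - grad g x \<bullet> y\<bar> \<le> e * norm y"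
      using G(4)[OF e(1)] by blast
    obtain h2 where h2: "0 < h2"
      "\<And>h f y. 0 \<le> h \<Longrightarrow> h < h2 \<Longrightarrow> f \<in> mod_class B m \<Longrightarrow> \<bar>S h f y - f y\<bar> \<le> e"
      using S_small_time[OF Bm(2,1) e(1)] by metis
    obtain h3 where h3: "0 < h3" "\<And>h y. 0 < h \<Longrightarrow> h < h3 \<Longrightarrow> \<bar>S h g y - g y - h * generator \<mu> g y\<bar> \<le> h * e"
      using generator_expansion(2)[OF g(1) e(1)] by blast
    obtain h4 where h4: "0 < h4" "h4 < t" "\<And>h y. 0 < h \<Longrightarrow> h < h4 \<Longrightarrow> \<bar>v (t - h) y - g y + h * w y\<bar> \<le> h * e"
      using test_function_expansion(2)[OF v t e(1)] unfolding w_def g_def by blast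
    obtain h5 where h5: "0 < h5" "\<And>x y. norm y < h5 \<Longrightarrow> \<bar>generator \<mu> g (x + y) - generator \<mu> g x\<bar> < e"
      using ucb_uniform[OF ua e(1)] by blast
    obtain h6 where h6: "0 < h6" "\<And>x y. norm y < h6 \<Longrightarrow> \<bar>w (x + y) - w x\<bar> < e"
      using ucb_uniform[OF w e(1)] by blast
    \<comment> \<open>Keeps the shift \<open>h *\<^sub>R z\<close> within the three spatial radii;
      the summand 1 admits \<open>z = 0\<close>.\<close>
    define r where "r = min h1 (min h5 h6) / (1 + norm z)"
    have n1: "0 < 1 + norm z" by (simp add: add_pos_nonneg)
    have r: "0 < r" using h1(1) h5(1) h6(1) n1 by (simp add: r_def)
    obtain k where k: "1 / 2 ^ k < min (min r h2) (min h3 h4)"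
      using small_dyadic[of "min (min r h2) (min h3 h4)"] r h2(1) h3(1) h4(1) by auto
    define h :: real where "h = 1 / 2 ^ k"
    have h: "0 < h" "h < r" "h < h2" "h < h3" "h < h4" "h < t" using k h4 by (auto simp: h_def)
    have h': "0 \<le> h" using h by simp
    have "h * (1 + norm z) < min h1 (min h5 h6)" using h(2) n1 by (simp add: r_def pos_less_divide_eq)
    moreover have "h * norm z \<le> h * (1 + norm z)" using h by simp
    moreover have "norm (h *\<^sub>R z) = h * norm z" using h by simp
    ultimately have "norm (h *\<^sub>R z) < min h1 (min h5 h6)" by linarith
    then have hz: "norm (h *\<^sub>R z) < h1" "norm (h *\<^sub>R z) < h5" "norm (h *\<^sub>R z) < h6" by simp_all
    have th: "0 < t - h" using h by simp
    have uU: "ucb (U f (t - h))" using th f by (intro ucb_U) auto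
    let ?y = "x + h *\<^sub>R z"
    have low: "g a + (- h) * w a \<le> U f (t - h) a + h * e" for a
      using le[OF th, of a] h4(3)[OF h(1,5), of a] by linarith
    have "S h (\<lambda>a. g a + (- h) * w a) ?y \<le> S h (U f (t - h)) ?y + h * e"
      by (rule mono_op_le_add[OF mono_op_S[OF h'] ucb_add[OF ug ucb_cmult[OF w]] uU low])
    then have 1: "S h g ?y - h * S h w ?y \<le> S h (U f (t - h)) ?y + h * e"
      using S_linear[OF h' ug w, of "- h" ?y] by simp
    have 2: "S h (U f (t - h)) ?y - h * \<rho> z \<le> g x"
      using U_step_lower[of "t - h" f z k x] th f z eq by (simp add: g_def h_def)
    have "S h w ?y \<le> w x + 2 * e"
      using h2(2)[OF h' h(3) Bm(3), of ?y] h6(2)[OF hz(3), of x] by linarith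
    then have 3: "h * S h w ?y \<le> h * (w x + 2 * e)" using h by (intro mult_left_mono) auto
    have "h * generator \<mu> g ?y \<ge> h * (generator \<mu> g x - e)"
      using h5(2)[OF hz(2), of x] h by (intro mult_left_mono) auto
    then have 4: "S h g ?y \<ge> g ?y + h * (generator \<mu> g x - e) - h * e"
      using h3(2)[OF h(1,4), of ?y] by linarith
    have 5: "g ?y \<ge> g x + h * (grad g x \<bullet> z) - h * (e * norm z)"
      using h1(2)[OF hz(1), of x] h by (simp add: abs_le_iff algebra_simps)
    have "h * (grad g x \<bullet> z - \<rho> z + generator \<mu> g x - w x - e * (5 + norm z)) \<le> 0"
      using 1 2 3 4 5 by (simp add: algebra_simps)
    then have "grad g x \<bullet> z - \<rho> z + generator \<mu> g x - w x - e * (5 + norm z) \<le> 0"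
      using h by (simp add: mult_le_0_iff)
    then show "grad g x \<bullet> z - \<rho> z \<le> w x - generator \<mu> g x + e0"
      using e by (simp add: algebra_simps)
  qed
  then have "legendre (grad g x) \<le> w x - generator \<mu> g x" by (rule legendre_least)
  then show ?thesis by (simp add: g_def w_def)
qed

end

text \<open>Apart from the two inequalities: values in \<open>C0\<close> come from
  \<open>vanishing_U\<close>, continuity in the supremum norm from the uniformity in space of
  \<open>U_time_continuity\<close>, and \<open>conjugate_norm\<close> leads back from
  \<open>legendre\<close> to the scalar conjugate.\<close>

theorem (in wasserstein_perturbation) viscosity_solution_limit_op:
  assumes f: "f \<in> C0"
  shows "\<exists>u :: real \<Rightarrow> ('a \<Rightarrow>\<^sub>C real).
    (\<forall>t\<ge>0. \<forall>x. apply_bcontfun (u t) x = limit_op p \<mu> \<phi> t (apply_bcontfun f) x) \<and> viscosity_solution \<mu> \<phi> f u"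
proof -
  have uf: "ucb f" by (rule ucb_C0[OF f])
  define u where "u t = Bcontfun (U f t)" for t
  have u: "apply_bcontfun (u t) = U f t" if "0 \<le> t" for t
    unfolding u_def by (rule ucb_bcontfun[OF ucb_U[OF that uf]])
  have C0: "u t \<in> C0" if "0 \<le> t" for t
    using vanishing_U[OF that uf] f by (simp add: C0_def u[OF that] vanishing_iff)
  have u0: "u 0 = f"
    by (rule bcontfun_eqI) (simp add: u U_0[OF uf])
  have cont: "continuous_on {0..} u"
    unfolding continuous_on_iff
  proof (intro ballI allI impI)
    fix t e :: real assume t: "t \<in> {0..}" and e: "0 < e"
    obtain d where d: "0 < d" "\<And>s t x. 0 \<le> s \<Longrightarrow> s \<le> t \<Longrightarrow> t < s + d \<Longrightarrow> \<bar>U f t x - U f s x\<bar> \<le> e / 2"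
      using U_time_continuity[OF uf, of "e / 2"] e by auto
    have "dist (u s) (u t) < e" if s: "s \<in> {0..}" "dist s t < d" for s
    proof -
      have "dist (u s x) (u t x) \<le> e / 2" for x
        using d(2)[of s t x] d(2)[of t s x] s t
        by (cases "s \<le> t") (auto simp: u dist_real_def abs_minus_commute)
      then have "dist (u s) (u t) \<le> e / 2" by (rule dist_bound)
      then show ?thesis using e by simp
    qed
    then show "\<exists>d>0. \<forall>s\<in>{0..}. dist s t < d \<longrightarrow> dist (u s) (u t) < e" using d(1) by blast
  qed
  have full: "full_generator \<mu> \<phi> g x = ereal (generator \<mu> g x + legendre (grad g x))" for g x
    by (simp add: full_generator_def conjugate_norm)
  have "viscosity_solution \<mu> \<phi> f u"
    unfolding viscosity_solution_def viscosity_subsolution_def viscosity_supersolution_def full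
    using C0 cont u0 U_subsolution[OF uf] U_supersolution[OF uf] by (auto simp: u)
  then show ?thesis
    using u limit_op_eq[OF _ uf] by (intro exI[of _ u]) auto
qed

theorem theorem2p12:
  fixes p :: real
    and M :: "'w measure"
    and X :: "real \<Rightarrow> 'w \<Rightarrow> 'a::euclidean_space"
    and \<mu> :: "real \<Rightarrow> 'a measure"
    and \<phi> :: "real \<Rightarrow> ereal"
    and f :: "'a \<Rightarrow>\<^sub>C real"
  assumes "1 < p"
    and "levy_process M X"
    and "\<And>t. 0 \<le> t \<Longrightarrow> \<mu> t = distr M borel (X t)"
    and "integrable (\<mu> 1) (\<lambda>x. norm x powr p)"
    and "\<And>x. 0 \<le> x \<Longrightarrow> 0 \<le> \<phi> x"
    and "lsc_nonneg \<phi>"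
    and "convex_nonneg \<phi>"
    and "mono_on {0..} \<phi>"
    and "\<not> \<phi> constant_on {0..}"
    and "\<phi> 0 = 0"
    and "convex_nonneg (\<lambda>x. \<phi> (x powr (1 / p)))"
    and "f \<in> C0"
  shows "\<exists>u :: real \<Rightarrow> ('a \<Rightarrow>\<^sub>C real).
    (\<forall>t\<ge>0. \<forall>x. apply_bcontfun (u t) x = limit_op p \<mu> \<phi> t (apply_bcontfun f) x) \<and> viscosity_solution \<mu> \<phi> f u"
proof -
  interpret levy M X \<mu> p
    using assms(1-4) by (simp add: levy_def)
  obtain c C where c: "0 < c" "0 \<le> C" "\<And>a. 0 \<le> a \<Longrightarrow> ereal (c * a powr p - C) \<le> \<phi> a"
    using convex_power_growth[OF assms(1) assms(5) assms(9-11)] by blast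
  interpret wasserstein_perturbation \<mu> p \<phi> c C
    by unfold_locales (use assms c law_moment in auto)
  show ?thesis by (rule viscosity_solution_limit_op[OF assms(12)])
qed

end
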